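(* Let $\Omega$ be a $C^{1,1}$ bounded domain of $\mathbb{R}^n$, let the coefficients of $L$ satisfy assumptions (a1) to (a6) listed in the context, let $E$ be the fundamental solution of $L$ constructed by the parametrix method, and let $G_\Omega^D$ be the parabolic Dirichlet-Green function of $L$ on $\Omega$. Let $c=\frac{1}{8M}$. Then there exist constants $\aleph_2>0$ and $\aleph_3\ge0$, depending only on $\mathfrak{D}=(n,\alpha,N_1,N_2,M,\kappa)$ (in particular not on $\Omega$), such that \[ E(x,t;\xi,\tau)\le\aleph_2e^{\aleph_3(t-\tau)}(t-\tau)^{-\frac n2}e^{-c\frac{|x-\xi|^2}{t-\tau}}\quad\text{for all }(x,t,\xi,\tau)\in Q, \] and, with the same constants, \[ 0\le G_\Omega^D(x,t;\xi,\tau)\le\aleph_2e^{\aleph_3(t-\tau)}(t-\tau)^{-\frac n2}e^{-c\frac{|x-\xi|^2}{t-\tau}} \] for all $(x,t,\xi,\tau)\in Q$ with $x,\xi\in\Omega$.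
   Context: Let $P=\mathbb{R}^n_x\times\mathbb{R}_t$ and $Q=\{(x,t,\xi,\tau):\ (x,t),(\xi,\tau)\in P,\ \tau<t\}$. $C_b^0(P)$ is the space of bounded continuous functions $f:P\to\mathbb{R}$. Fix $0<\alpha\le 1$. For $f\in C^0_b(P)$ set \[ [f]_\alpha=\sup_{(x,t)\ne(x',t')}\frac{|f(x,t)-f(x',t')|}{(|x-x'|^2+|t-t'|)^{\alpha/2}},\qquad \{f\}_\alpha=\sup_{t\in\mathbb{R},\,x\ne x'}\frac{|f(x,t)-f(x',t)|}{|x-x'|^\alpha}, \] and $C^\alpha(P)=\{f\in C_b^0(P):[f]_\alpha<\infty\}$. The operator is \[ L=\sum_{i,j=1}^na_{ij}(x,t)\partial^2_{ij}+\sum_{i=1}^nb_i(x,t)\partial_i+q(x,t)-\partial_t . \] Assumptions: (a1) $a_{ij}\in C^\alpha(P)$ for $1\le i,j\le n$. (a2) The matrix $\mathbf{a}(x,t)=(a_{ij}(x,t))$ is symmetric and real-valued, and there are constants $\kappa>0$, $M>0$ with $\kappa|\eta|^2\le\langle\mathbf{a}(x,t)\eta,\eta\rangle\le M|\eta|^2$ for all $(x,t)\in P$, $\eta\in\mathbb{R}^n$. (a3) $b_i,q\in C_b^0(P)$ for $1\le i\le n$. (a4) There is a constant $N_1>0$ with $\sum_{i,j=1}^n[a_{ij}]_\alpha\le N_1$. (a5) There is a constant $N_2>0$ with $\sum_{i=1}^n\|b_i\|_\infty+\|q\|_\infty\le N_2$. (a6) $\{b_i\}_\alpha<\infty$ for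 $1\le i\le n$ and $\{q\}_\alpha<\infty$. Construction of $E$ (parametrix method). For $(x,t,\xi,\tau)\in Q$ put \[ Z(x,t;\xi,\tau)=\frac{\sqrt{\det\mathbf{a}^{-1}(\xi,\tau)}}{(4\pi(t-\tau))^{n/2}}\,e^{-\frac{\langle\mathbf{a}^{-1}(\xi,\tau)(x-\xi),x-\xi\rangle}{4(t-\tau)}}, \] where $\mathbf{a}^{-1}(\xi,\tau)$ is the inverse matrix of $\mathbf{a}(\xi,\tau)$. Let $\Phi_1=LZ$ ($L$ acting in $(x,t)$), and for $\ell\ge1$ \[ \Phi_{\ell+1}(x,t;\xi,\tau)=\int_\tau^t\int_{\mathbb{R}^n}\Phi_1(x,t;\eta,\sigma)\Phi_\ell(\eta,\sigma;\xi,\tau)\,d\eta\,d\sigma,\qquad \Phi=\sum_{\ell\ge1}\Phi_\ell . \] Then \[ E(x,t;\xi,\tau)=Z(x,t;\xi,\tau)+\int_\tau^t\int_{\mathbb{R}^n}Z(x,t;\eta,\sigma)\Phi(\eta,\sigma;\xi,\tau)\,d\eta\,d\sigma . \] $E$ is a fundamental solution of $L$: $LE=0$ in the variables $(x,t)$, and $\lim_{t\to\tau}\int_{\mathbb{R}^n}E(x,t;\xi,\tau)f(\xi)\,d\xi=f(x)$ for $f\in C_0^\infty(\mathbb{R}^n)$. The parabolic Dirichlet-Green function $G_\Omega^D(x,t;\xi,\tau)$, $x,\xi\in\Omega$, $\tau<t$, is understood in the usual sense: it is the continuous kernel such that, for every $\tau\in\mathbb{R}$ and $f\in C_0^\infty(\Omega)$,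 the function $u(x,t)=\int_\Omega G_\Omega^D(x,t;\xi,\tau)f(\xi)\,d\xi$ is the classical solution of $Lu=0$ in $\Omega\times(\tau,\infty)$, $u=0$ on $\partial\Omega\times(\tau,\infty)$, $u(\cdot,\tau)=f$ in $\Omega$. *)

theory Defs
  imports "HOL-Analysis.Analysis"
begin

section \<open>Function spaces on space-time\<close>

definition parabolic_holder_seminorm ::
  "real \<Rightarrow> ((real^'n) \<times> real \<Rightarrow> real) \<Rightarrow> ereal"
  where "parabolic_holder_seminorm \<alpha> f =
    (SUP (z, w) \<in> {(z, w). z \<noteq> w}.
      ereal (\<bar>f z - f w\<bar> /
        ((norm (fst z - fst w))\<^sup>2 + \<bar>snd z - snd w\<bar>) powr (\<alpha> / 2)))"

definition spatial_holder_seminorm ::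
  "real \<Rightarrow> ((real^'n) \<times> real \<Rightarrow> real) \<Rightarrow> ereal"
  where "spatial_holder_seminorm \<alpha> f =
    (SUP (t, x, y) \<in> {(t, x, y). x \<noteq> y}.
      ereal (\<bar>f (x, t) - f (y, t)\<bar> / norm (x - y) powr \<alpha>))"

definition parabolic_holder_space :: "real \<Rightarrow> ((real^'n) \<times> real \<Rightarrow> real) set"
  where "parabolic_holder_space \<alpha> =
    {f \<in> bcontfun. parabolic_holder_seminorm \<alpha> f < \<infinity>}"

text \<open>Only used for bounded functions; otherwise the real supremum is unspecified.\<close>
definition sup_norm :: "('a \<Rightarrow> real) \<Rightarrow> real"
  where "sup_norm f = (SUP z. \<bar>f z\<bar>)"

definition partial :: "'n \<Rightarrow> (real^'n \<Rightarrow> real) \<Rightarrow> real^'n \<Rightarrow> real"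
  where "partial i f x = deriv (\<lambda>s. f (x + s *\<^sub>R axis i 1)) 0"

definition has_partial :: "'n \<Rightarrow> (real^'n \<Rightarrow> real) \<Rightarrow> real^'n \<Rightarrow> bool"
  where "has_partial i f x \<longleftrightarrow> (\<lambda>s. f (x + s *\<^sub>R axis i 1)) differentiable (at 0)"

primrec C_k :: "nat \<Rightarrow> (real^'n \<Rightarrow> real) \<Rightarrow> bool"
  where
    "C_k 0 f \<longleftrightarrow> continuous_on UNIV f"
  | "C_k (Suc k) f \<longleftrightarrow> continuous_on UNIV f \<and>
      (\<forall>i. (\<forall>x. has_partial i f x) \<and> C_k k (partial i f))"

definition test_functions :: "(real^'n) set \<Rightarrow> (real^'n \<Rightarrow> real) set"
  where "test_functions \<Omega> =
    {f. (\<forall>k. C_k k f) \<and> compact (closure {x. f x \<noteq> 0}) \<and> closure {x. f x \<noteq> 0} \<subseteq> \<Omega>}"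

text \<open>\<open>C\<^sup>2\<^sup>,\<^sup>1\<close>: two continuous derivatives in space, one in time.  Meant for open \<open>S\<close>.\<close>
definition C_2_1_on :: "((real^'n) \<times> real) set \<Rightarrow> (real^'n \<Rightarrow> real \<Rightarrow> real) \<Rightarrow> bool"
  where "C_2_1_on S u \<longleftrightarrow>
    continuous_on S (\<lambda>(x, t). u x t) \<and>
    (\<forall>i. (\<forall>(x, t) \<in> S. has_partial i (\<lambda>y. u y t) x) \<and>
         continuous_on S (\<lambda>(x, t). partial i (\<lambda>y. u y t) x)) \<and>
    (\<forall>i j. (\<forall>(x, t) \<in> S. has_partial i (partial j (\<lambda>y. u y t)) x) \<and>
         continuous_on S (\<lambda>(x, t). partial i (partial j (\<lambda>y. u y t)) x)) \<and>
    (\<forall>(x, t) \<in> S. u x differentiable (at t)) \<and>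
    continuous_on S (\<lambda>(x, t). deriv (u x) t)"

section \<open>The operator and its coefficients\<close>

definition parabolic_op ::
  "((real^'n) \<times> real \<Rightarrow> real^'n^'n) \<Rightarrow> ((real^'n) \<times> real \<Rightarrow> real^'n) \<Rightarrow>
   ((real^'n) \<times> real \<Rightarrow> real) \<Rightarrow> (real^'n \<Rightarrow> real \<Rightarrow> real) \<Rightarrow> real^'n \<Rightarrow> real \<Rightarrow> real"
  where "parabolic_op a b q u x t =
    (\<Sum>i\<in>UNIV. \<Sum>j\<in>UNIV. a (x, t) $ i $ j * partial i (partial j (\<lambda>y. u y t)) x) +
    (\<Sum>i\<in>UNIV. b (x, t) $ i * partial i (\<lambda>y. u y t) x) +
    q (x, t) * u x t - deriv (u x) t"

definition admissible_coefficients ::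
  "real \<Rightarrow> real \<Rightarrow> real \<Rightarrow> real \<Rightarrow> real \<Rightarrow>
   ((real^'n) \<times> real \<Rightarrow> real^'n^'n) \<Rightarrow> ((real^'n) \<times> real \<Rightarrow> real^'n) \<Rightarrow>
   ((real^'n) \<times> real \<Rightarrow> real) \<Rightarrow> bool"
  where "admissible_coefficients \<alpha> N\<^sub>1 N\<^sub>2 M \<kappa> a b q \<longleftrightarrow>
    (\<forall>i j. (\<lambda>z. a z $ i $ j) \<in> parabolic_holder_space \<alpha>) \<and>
    (\<forall>z. transpose (a z) = a z \<and>
      (\<forall>\<eta>. \<kappa> * (norm \<eta>)\<^sup>2 \<le> (a z *v \<eta>) \<bullet> \<eta> \<and> (a z *v \<eta>) \<bullet> \<eta> \<le> M * (norm \<eta>)\<^sup>2)) \<and>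
    (\<forall>i. (\<lambda>z. b z $ i) \<in> bcontfun) \<and> q \<in> bcontfun \<and>
    (\<Sum>i\<in>UNIV. \<Sum>j\<in>UNIV. parabolic_holder_seminorm \<alpha> (\<lambda>z. a z $ i $ j)) \<le> ereal N\<^sub>1 \<and>
    (\<Sum>i\<in>UNIV. sup_norm (\<lambda>z. b z $ i)) + sup_norm q \<le> N\<^sub>2 \<and>
    (\<forall>i. spatial_holder_seminorm \<alpha> (\<lambda>z. b z $ i) < \<infinity>) \<and>
    spatial_holder_seminorm \<alpha> q < \<infinity>"

section \<open>The fundamental solution constructed by the parametrix method\<close>

definition parametrix ::
  "((real^'n) \<times> real \<Rightarrow> real^'n^'n) \<Rightarrow> real^'n \<Rightarrow> real \<Rightarrow> real^'n \<Rightarrow> real \<Rightarrow> real"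
  where "parametrix a x t \<xi> \<tau> =
    sqrt (det (matrix_inv (a (\<xi>, \<tau>)))) / (4 * pi * (t - \<tau>)) powr (real CARD('n) / 2) *
    exp (- (((matrix_inv (a (\<xi>, \<tau>)) *v (x - \<xi>)) \<bullet> (x - \<xi>)) / (4 * (t - \<tau>))))"

text \<open>The index is shifted: \<open>parametrix_iterate a b q l\<close> is the iterate \<open>\<Phi>\<close> of index \<open>l + 1\<close>.\<close>
primrec parametrix_iterate ::
  "((real^'n) \<times> real \<Rightarrow> real^'n^'n) \<Rightarrow> ((real^'n) \<times> real \<Rightarrow> real^'n) \<Rightarrow>
   ((real^'n) \<times> real \<Rightarrow> real) \<Rightarrow> nat \<Rightarrow> real^'n \<Rightarrow> real \<Rightarrow> real^'n \<Rightarrow> real \<Rightarrow> real"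
  where
    "parametrix_iterate a b q 0 =
      (\<lambda>x t \<xi> \<tau>. parabolic_op a b q (\<lambda>y s. parametrix a y s \<xi> \<tau>) x t)"
  | "parametrix_iterate a b q (Suc l) =
      (\<lambda>x t \<xi> \<tau>. LBINT \<sigma>:{\<tau><..<t}. LBINT \<eta>.
        parabolic_op a b q (\<lambda>y s. parametrix a y s \<eta> \<sigma>) x t *
        parametrix_iterate a b q l \<eta> \<sigma> \<xi> \<tau>)"

definition parametrix_density ::
  "((real^'n) \<times> real \<Rightarrow> real^'n^'n) \<Rightarrow> ((real^'n) \<times> real \<Rightarrow> real^'n) \<Rightarrow>
   ((real^'n) \<times> real \<Rightarrow> real) \<Rightarrow> real^'n \<Rightarrow> real \<Rightarrow> real^'n \<Rightarrow> real \<Rightarrow> real"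
  where "parametrix_density a b q x t \<xi> \<tau> = (\<Sum>l. parametrix_iterate a b q l x t \<xi> \<tau>)"

definition fundamental_solution ::
  "((real^'n) \<times> real \<Rightarrow> real^'n^'n) \<Rightarrow> ((real^'n) \<times> real \<Rightarrow> real^'n) \<Rightarrow>
   ((real^'n) \<times> real \<Rightarrow> real) \<Rightarrow> real^'n \<Rightarrow> real \<Rightarrow> real^'n \<Rightarrow> real \<Rightarrow> real"
  where "fundamental_solution a b q x t \<xi> \<tau> =
    parametrix a x t \<xi> \<tau> +
    (LBINT \<sigma>:{\<tau><..<t}. LBINT \<eta>.
      parametrix a x t \<eta> \<sigma> * parametrix_density a b q \<eta> \<sigma> \<xi> \<tau>)"

section \<open>Domains and the Dirichlet-Green function\<close>

text \<open>Near each boundary point, \<open>\<Omega>\<close> is the strict epigraph, in some direction \<open>e\<close>, of a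
  \<open>C\<^sup>1\<^sup>,\<^sup>1\<close> function on the hyperplane orthogonal to \<open>e\<close>.  A function on that hyperplane is
  represented by one on the whole space, evaluated only at orthogonal projections: extending
  it constantly along \<open>e\<close> preserves \<open>C\<^sup>1\<^sup>,\<^sup>1\<close>.\<close>
definition bounded_C11_domain :: "(real^'n) set \<Rightarrow> bool"
  where "bounded_C11_domain \<Omega> \<longleftrightarrow>
    bounded \<Omega> \<and> open \<Omega> \<and> connected \<Omega> \<and> \<Omega> \<noteq> {} \<and>
    (\<forall>p \<in> frontier \<Omega>. \<exists>r > 0. \<exists>e \<phi> g K.
      norm e = 1 \<and> (\<forall>y. GDERIV \<phi> y :> g y) \<and> K-lipschitz_on UNIV g \<and>
      \<Omega> \<inter> ball p r = {y \<in> ball p r. \<phi> (y - (y \<bullet> e) *\<^sub>R e) < y \<bullet> e})"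

definition classical_dirichlet_solution ::
  "((real^'n) \<times> real \<Rightarrow> real^'n^'n) \<Rightarrow> ((real^'n) \<times> real \<Rightarrow> real^'n) \<Rightarrow>
   ((real^'n) \<times> real \<Rightarrow> real) \<Rightarrow> (real^'n) set \<Rightarrow> real \<Rightarrow> (real^'n \<Rightarrow> real) \<Rightarrow>
   (real^'n \<Rightarrow> real \<Rightarrow> real) \<Rightarrow> bool"
  where "classical_dirichlet_solution a b q \<Omega> \<tau> f u \<longleftrightarrow>
    continuous_on (closure \<Omega> \<times> {\<tau>..}) (\<lambda>(x, t). u x t) \<and>
    C_2_1_on (\<Omega> \<times> {\<tau><..}) u \<and>
    (\<forall>x \<in> \<Omega>. \<forall>t > \<tau>. parabolic_op a b q u x t = 0) \<and>
    (\<forall>x \<in> frontier \<Omega>. \<forall>t > \<tau>. u x t = 0) \<and>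
    (\<forall>x \<in> \<Omega>. u x \<tau> = f x)"

text \<open>The values of \<open>G\<close> are relevant only for \<open>x, \<xi> \<in> \<Omega>\<close> and \<open>\<tau> < t\<close>; the integral represents
  the solution there, and the boundary and initial values are attained continuously.\<close>
definition dirichlet_green_function ::
  "((real^'n) \<times> real \<Rightarrow> real^'n^'n) \<Rightarrow> ((real^'n) \<times> real \<Rightarrow> real^'n) \<Rightarrow>
   ((real^'n) \<times> real \<Rightarrow> real) \<Rightarrow> (real^'n) set \<Rightarrow>
   (real^'n \<Rightarrow> real \<Rightarrow> real^'n \<Rightarrow> real \<Rightarrow> real) \<Rightarrow> bool"
  where "dirichlet_green_function a b q \<Omega> G \<longleftrightarrow>
    continuous_on {(x, t, \<xi>, \<tau>). x \<in> \<Omega> \<and> \<xi> \<in> \<Omega> \<and> \<tau> < t} (\<lambda>(x, t, \<xi>, \<tau>). G x t \<xi> \<tau>) \<and>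
    (\<forall>\<tau>. \<forall>f \<in> test_functions \<Omega>. \<exists>u.
      classical_dirichlet_solution a b q \<Omega> \<tau> f u \<and>
      (\<forall>x \<in> \<Omega>. \<forall>t > \<tau>. u x t = (LBINT \<xi>:\<Omega>. G x t \<xi> \<tau> * f \<xi>)))"

end

theory Submission
  imports Defs "HOL-Probability.Probability"
begin

text \<open>
  Write \<open>n\<close> for the dimension, \<open>\<beta> = \<alpha> / 2\<close>, \<open>H(v, s) = s\<^sup>-\<^sup>n\<^sup>/\<^sup>2 exp(- \<bar>v\<bar>\<^sup>2 / (8 M s))\<close>, and \<open>s = t - \<tau>\<close>.

  The kernel with coefficients frozen at \<open>(\<xi>, \<tau>)\<close> decays like \<open>exp(- \<bar>x - \<xi>\<bar>\<^sup>2 / (4 M s))\<close>. Its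
  derivatives are worse only by powers of \<open>1 / s\<close> and of \<open>\<bar>x - \<xi>\<bar>\<^sup>2 / s\<close>. The passage from \<open>4 M\<close> to \<open>8 M\<close> in
  the exponent absorbs the latter, and Hoelder continuity of \<open>a\<close> gains \<open>s\<^sup>\<beta>\<close>. Hence \<open>L\<close> maps the frozen kernel to something
  bounded by \<open>C s\<^sup>\<beta>\<^sup>-\<^sup>1 e\<^sup>s H\<close> (\<open>abs_frozen_defect_le\<close>). Put \<open>K = s\<^sup>\<beta>\<^sup>-\<^sup>1 e\<^sup>\<mu>\<^sup>s H\<close>. As \<open>H\<close> reproduces itself
  under convolution and \<open>s\<^sup>\<beta>\<^sup>-\<^sup>1\<close> is integrable at zero, convolution of that bound with \<open>K\<close> is at most
  \<open>\<theta> K\<close>, where \<open>\<theta>\<close> is as small as desired once \<open>\<mu>\<close> is large (\<open>nn_integral_defect_iterate\<close>).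

  For \<open>E\<close>, the choice \<open>\<theta> = 1/2\<close> makes the iterates decay geometrically, so the parametrix density is at
  most a multiple of \<open>K\<close>, and one more convolution gives the bound (\<open>fundamental_solution_le\<close>).

  The Green function is compared with a supersolution rather than with \<open>E\<close>; differentiating the heat
  potential in the definition of \<open>E\<close> twice would need Hoelder estimates for its density. The supersolution
  is the frozen kernel with pole at \<open>(\<xi>, \<tau> - r\<^sup>2)\<close>, plus a potential of a large multiple \<open>A K\<close> of \<open>K\<close> whose
  kernel is cut off smoothly near the diagonal. With the cutoff, the integrand and its
  derivatives are continuous on a compact box, so that differentiation under the integral is elementary. The
  time derivative of the cutoff contributes at most \<open>- m\<^sub>0 A K\<close> up to an arbitrarily small error, by mere
  uniform continuity of \<open>K\<close>, and this compensates the other contributions, which add up to at most \<open>m\<^sub>0 A K\<close> if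
  \<open>\<theta> = m\<^sub>0 / 2\<close> and \<open>A\<close> is large (\<open>barrier_exists\<close>). Here \<open>m\<^sub>0\<close> is a positive lower bound for the mass
  of the unnormalised frozen kernel near its pole.

  A bump of height at most one and width \<open>r\<close> around \<open>\<xi>\<close> lies below a multiple, of order \<open>r\<^sup>n\<close>, of the supersolution
  at time \<open>\<tau>\<close>. The minimum principle (\<open>parabolic_minimum_principle\<close>) transfers this to the solution with that
  initial value, which is the integral of \<open>G\<close> against the bump. The bump has mass of order \<open>r\<^sup>n\<close>, so
  \<open>r \<rightarrow> 0\<close> and continuity of \<open>G\<close> give the pointwise bound (\<open>green_function_bounds\<close>). Nonnegativity follows in the
  same way, with zero as the comparison function.
\<close>

section \<open>Uniformly elliptic matrices and their inverses\<close>

definition elliptic :: "real \<Rightarrow> real \<Rightarrow> real^'n^'n \<Rightarrow> bool"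
  where "elliptic \<kappa> M A \<longleftrightarrow> transpose A = A \<and>
    (\<forall>\<eta>. \<kappa> * (norm \<eta>)\<^sup>2 \<le> (A *v \<eta>) \<bullet> \<eta> \<and> (A *v \<eta>) \<bullet> \<eta> \<le> M * (norm \<eta>)\<^sup>2)"

lemma elliptic_symmetric: "elliptic \<kappa> M A \<Longrightarrow> (A *v x) \<bullet> y = x \<bullet> (A *v y)"
  unfolding elliptic_def by (metis dot_lmul_matrix vector_transpose_matrix)

lemma elliptic_norm_ge:
  assumes "elliptic \<kappa> M A"
  shows "\<kappa> * norm \<eta> \<le> norm (A *v \<eta>)"
proof (cases "\<eta> = 0")
  case False
  have "\<kappa> * norm \<eta> * norm \<eta> \<le> (A *v \<eta>) \<bullet> \<eta>"
    using assms by (simp add: elliptic_def power2_eq_square mult.assoc)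
  also have "\<dots> \<le> norm (A *v \<eta>) * norm \<eta>" by (rule norm_cauchy_schwarz)
  finally show ?thesis using False by simp
qed auto

lemma matrix_inv_inverse:
  assumes "invertible A"
  shows "A ** matrix_inv A = mat 1" "matrix_inv A ** A = mat 1"
proof -
  have "\<exists>A'. A ** A' = mat 1 \<and> A' ** A = mat 1" using assms by (simp add: invertible_def)
  then have "A ** matrix_inv A = mat 1 \<and> matrix_inv A ** A = mat 1"
    unfolding matrix_inv_def by (rule someI_ex)
  then show "A ** matrix_inv A = mat 1" "matrix_inv A ** A = mat 1" by auto
qed

context
  fixes \<kappa> M :: real and A :: "real^'n^'n"
  assumes \<kappa>: "0 < \<kappa>" and M: "0 < M" and ell: "elliptic \<kappa> M A"
begin

lemma elliptic_invertible: "invertible A"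
proof -
  have "x = 0" if "A *v x = 0" for x
  proof -
    have "\<kappa> * norm x \<le> 0" using elliptic_norm_ge[OF ell, of x] that by simp
    with \<kappa> show ?thesis by (simp add: mult_le_0_iff)
  qed
  then show ?thesis
    by (metis invertible_left_inverse matrix_left_invertible_ker)
qed

lemma mult_matrix_inv: "A *v (matrix_inv A *v x) = x" "matrix_inv A *v (A *v x) = x"
  using matrix_inv_inverse[OF elliptic_invertible]
  by (simp_all add: matrix_vector_mul_assoc)

lemma matrix_inv_symmetric: "(matrix_inv A *v x) \<bullet> y = x \<bullet> (matrix_inv A *v y)"
  by (metis elliptic_symmetric[OF ell] mult_matrix_inv(1))

lemma matrix_inv_entry: "matrix_inv A $ i $ j = (matrix_inv A *v axis j 1) $ i"
  by (simp add: matrix_vector_mult_basis column_def)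

lemma matrix_inv_entry_symmetric: "matrix_inv A $ i $ j = matrix_inv A $ j $ i"
proof -
  have "matrix_inv A $ i $ j = (matrix_inv A *v axis j 1) \<bullet> axis i 1"
    by (simp add: matrix_inv_entry inner_axis)
  also have "\<dots> = (matrix_inv A *v axis i 1) \<bullet> axis j 1"
    by (metis matrix_inv_symmetric inner_commute)
  finally show ?thesis by (simp add: matrix_inv_entry inner_axis)
qed

lemma norm_matrix_inv_le: "norm (matrix_inv A *v x) \<le> norm x / \<kappa>"
  using elliptic_norm_ge[OF ell, of "matrix_inv A *v x"] \<kappa>
  by (simp add: mult_matrix_inv field_simps)

lemma matrix_inv_component_le: "\<bar>(matrix_inv A *v x) $ i\<bar> \<le> norm x / \<kappa>"
  using norm_matrix_inv_le component_le_norm_cart order_trans by blast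

lemma matrix_inv_entry_le: "\<bar>matrix_inv A $ i $ j\<bar> \<le> 1 / \<kappa>"
  using matrix_inv_component_le[of "axis j 1" i] by (simp add: matrix_inv_entry)

lemma matrix_inv_quadratic_le: "(matrix_inv A *v x) \<bullet> x \<le> (norm x)\<^sup>2 / \<kappa>"
proof -
  have "(matrix_inv A *v x) \<bullet> x \<le> norm (matrix_inv A *v x) * norm x" by (rule norm_cauchy_schwarz)
  also have "\<dots> \<le> norm x / \<kappa> * norm x" by (intro mult_right_mono norm_matrix_inv_le) auto
  finally show ?thesis by (simp add: power2_eq_square)
qed

text \<open>The bound \<open>A \<le> M\<close> gives \<open>\<bar>A \<eta>\<bar>\<^sup>2 \<le> M \<langle>A \<eta>, \<eta>\<rangle>\<close>, by nonnegativity of the form of \<open>A\<close> at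
  \<open>\<eta> - A \<eta> / M\<close>; with \<open>\<eta> = A\<^sup>-\<^sup>1 x\<close> this is the claim.\<close>
lemma matrix_inv_quadratic_ge: "(norm x)\<^sup>2 / M \<le> (matrix_inv A *v x) \<bullet> x"
proof -
  define y where "y = matrix_inv A *v x"
  have Ay: "A *v y = x" by (simp add: y_def mult_matrix_inv)
  let ?w = "y - (1 / M) *\<^sub>R x"
  have "0 \<le> \<kappa> * (norm ?w)\<^sup>2" using \<kappa> by simp
  also have "\<dots> \<le> (A *v ?w) \<bullet> ?w" using ell by (simp add: elliptic_def)
  also have "\<dots> = x \<bullet> y - 2 / M * (x \<bullet> x) + (1 / M)\<^sup>2 * ((A *v x) \<bullet> x)"
    using elliptic_symmetric[OF ell, of x y]
    by (simp add: matrix_vector_mult_diff_distrib matrix_vector_mult_scaleR Ay inner_diff_left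
        inner_diff_right inner_commute power2_eq_square diff_divide_distrib)
  also have "\<dots> \<le> x \<bullet> y - 2 / M * (x \<bullet> x) + (1 / M)\<^sup>2 * (M * (norm x)\<^sup>2)"
    using ell by (intro add_left_mono mult_left_mono) (auto simp: elliptic_def)
  also have "\<dots> = x \<bullet> y - (norm x)\<^sup>2 / M"
    unfolding power2_norm_eq_inner using M by (simp add: field_simps power2_eq_square)
  finally show ?thesis by (simp add: y_def inner_commute)
qed

lemma abs_det_matrix_inv_le: "\<bar>det (matrix_inv A)\<bar> \<le> fact CARD('n) * (1 / \<kappa>) ^ CARD('n)"
proof -
  have "\<bar>det (matrix_inv A)\<bar> \<le> (\<Sum>p | p permutes (UNIV :: 'n set).
      \<bar>of_int (sign p) * (\<Prod>i\<in>UNIV. matrix_inv A $ i $ p i)\<bar>)"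
    unfolding det_def by (rule sum_abs)
  also have "\<dots> \<le> (\<Sum>p | p permutes (UNIV :: 'n set). (1 / \<kappa>) ^ CARD('n))"
  proof (rule sum_mono)
    fix p :: "'n \<Rightarrow> 'n"
    have "\<bar>\<Prod>i\<in>UNIV. matrix_inv A $ i $ p i\<bar> \<le> (\<Prod>i\<in>(UNIV::'n set). 1 / \<kappa>)"
      unfolding abs_prod by (intro prod_mono) (auto simp: matrix_inv_entry_le[simplified])
    then show "\<bar>of_int (sign p) * (\<Prod>i\<in>UNIV. matrix_inv A $ i $ p i)\<bar> \<le> (1 / \<kappa>) ^ CARD('n)"
      by (simp add: abs_mult sign_def)
  qed
  also have "\<dots> = fact CARD('n) * (1 / \<kappa>) ^ CARD('n)"
    by (simp add: card_permutations[OF refl])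
  finally show ?thesis .
qed

end

text \<open>Inversion is continuous because
  \<open>B\<^sub>z - B\<^sub>w = B\<^sub>z (A\<^sub>w - A\<^sub>z) B\<^sub>w\<close> for \<open>B = A\<^sup>-\<^sup>1\<close>, and the norm of \<open>B\<^sub>z\<close> is at most \<open>1 / \<kappa>\<close>.\<close>
lemma continuous_on_matrix_inv:
  fixes a :: "'b::metric_space \<Rightarrow> real^'n^'n"
  assumes \<kappa>: "0 < \<kappa>" and M: "0 < M" and ell: "\<And>z. elliptic \<kappa> M (a z)"
    and cont: "\<And>i j. continuous_on UNIV (\<lambda>z. a z $ i $ j)"
  shows "continuous_on UNIV (\<lambda>z. matrix_inv (a z))"
proof -
  have a: "isCont a w" for w
  proof -
    have "continuous_on UNIV a"
      using continuous_on_vec_lambda[where f="\<lambda>i z. a z $ i",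
          OF continuous_on_vec_lambda[where f="\<lambda>j z. a z $ i $ j" for i, simplified, OF cont]]
      by simp
    then show ?thesis by (simp add: continuous_on_eq_continuous_at)
  qed
  have tend: "((\<lambda>z. matrix_inv (a z) *v v) \<longlongrightarrow> matrix_inv (a w) *v v) (at w)" for w v
  proof -
    let ?u = "matrix_inv (a w) *v v"
    have "((\<lambda>z. (a w - a z) *v ?u) \<longlongrightarrow> (a w - a w) *v ?u) (at w)"
      unfolding matrix_vector_mult_def using a
      by (intro tendsto_intros tendsto_vec_lambda) (auto simp: isCont_def)
    then have 0: "((\<lambda>z. norm ((a w - a z) *v ?u) / \<kappa>) \<longlongrightarrow> 0) (at w)"
      using \<kappa> by (auto intro!: tendsto_eq_intros simp: tendsto_norm_zero)
    have "norm (matrix_inv (a z) *v v - ?u) \<le> norm ((a w - a z) *v ?u) / \<kappa>" for z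
    proof -
      have "matrix_inv (a z) *v v - ?u = matrix_inv (a z) *v ((a w - a z) *v ?u)"
        using mult_matrix_inv[OF \<kappa> M ell]
        by (simp add: matrix_vector_mult_diff_distrib matrix_vector_mult_diff_rdistrib)
      then show ?thesis using norm_matrix_inv_le[OF \<kappa> M ell] by simp
    qed
    then show ?thesis
      by (intro LIM_zero_cancel[OF Lim_null_comparison[OF always_eventually 0]]) simp
  qed
  have "continuous_on UNIV (\<lambda>z. \<chi> i j. (matrix_inv (a z) *v axis j 1) $ i)"
    unfolding continuous_on_eq_continuous_at[OF open_UNIV] isCont_def
    by (intro ballI tendsto_vec_lambda tendsto_vec_nth tend)
  moreover have "(\<chi> i j. (matrix_inv (a z) *v axis j 1) $ i) = matrix_inv (a z)" for z
    by (simp add: vec_eq_iff matrix_inv_entry[OF \<kappa> M ell])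
  ultimately show ?thesis by simp
qed

section \<open>Bounds on the coefficients\<close>

lemma abs_le_sup_norm:
  assumes "f \<in> bcontfun"
  shows "\<bar>f z\<bar> \<le> sup_norm f"
proof -
  have "bdd_above (range (\<lambda>z. \<bar>f z\<bar>))"
    using assms by (auto simp: bcontfun_def bounded_iff bdd_above_def)
  then show ?thesis unfolding sup_norm_def by (rule cSUP_upper2) auto
qed

lemma parabolic_holder_seminorm_ge:
  assumes "z \<noteq> w"
  shows "ereal (\<bar>f z - f w\<bar> / ((norm (fst z - fst w))\<^sup>2 + \<bar>snd z - snd w\<bar>) powr (\<alpha> / 2))
    \<le> parabolic_holder_seminorm \<alpha> f"
  unfolding parabolic_holder_seminorm_def using assms by (intro SUP_upper2[of "(z, w)"]) auto

lemma parabolic_holder_seminorm_nonneg: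
  fixes f :: "(real^'n) \<times> real \<Rightarrow> real"
  shows "0 \<le> parabolic_holder_seminorm \<alpha> f"
proof -
  have "(0 :: real^'n, 0 :: real) \<noteq> (0, 1)" by simp
  then show ?thesis
    by (intro order_trans[OF _ parabolic_holder_seminorm_ge]) auto
qed

context
  fixes \<alpha> N\<^sub>1 N\<^sub>2 M \<kappa> :: real and a :: "(real^'n) \<times> real \<Rightarrow> real^'n^'n"
    and b :: "(real^'n) \<times> real \<Rightarrow> real^'n" and q :: "(real^'n) \<times> real \<Rightarrow> real"
  assumes adm: "admissible_coefficients \<alpha> N\<^sub>1 N\<^sub>2 M \<kappa> a b q"
begin

lemma admissible_elliptic: "elliptic \<kappa> M (a z)"
  using adm unfolding admissible_coefficients_def elliptic_def by blast

lemma admissible_continuous: "continuous_on UNIV (\<lambda>z. a z $ i $ j)"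
  using adm by (auto simp: admissible_coefficients_def parabolic_holder_space_def bcontfun_def)

lemma admissible_holder:
  assumes "z \<noteq> w"
  shows "\<bar>a z $ i $ j - a w $ i $ j\<bar>
    \<le> N\<^sub>1 * ((norm (fst z - fst w))\<^sup>2 + \<bar>snd z - snd w\<bar>) powr (\<alpha> / 2)"
proof -
  let ?S = "\<lambda>i j. parabolic_holder_seminorm \<alpha> (\<lambda>z. a z $ i $ j)"
  let ?d = "((norm (fst z - fst w))\<^sup>2 + \<bar>snd z - snd w\<bar>)"
  have "?d \<noteq> 0" using assms by (auto simp: add_nonneg_eq_0_iff prod_eq_iff)
  then have d: "?d powr (\<alpha> / 2) > 0" by simp
  have "?S i j \<le> (\<Sum>j\<in>UNIV. ?S i j)"
    using sum_mono2[of UNIV "{j}" "?S i"] by (simp add: parabolic_holder_seminorm_nonneg)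
  also have "\<dots> \<le> (\<Sum>i\<in>UNIV. \<Sum>j\<in>UNIV. ?S i j)"
    using sum_mono2[of UNIV "{i}" "\<lambda>i. \<Sum>j\<in>UNIV. ?S i j"]
    by (simp add: parabolic_holder_seminorm_nonneg sum_nonneg)
  also have "\<dots> \<le> ereal N\<^sub>1" using adm by (simp add: admissible_coefficients_def)
  finally have "ereal (\<bar>a z $ i $ j - a w $ i $ j\<bar> / ?d powr (\<alpha> / 2)) \<le> ereal N\<^sub>1"
    using parabolic_holder_seminorm_ge[OF assms] order_trans by blast
  then show ?thesis using d by (simp add: field_simps)
qed

lemma admissible_lower_order: "\<bar>b z $ i\<bar> \<le> N\<^sub>2" "\<bar>q z\<bar> \<le> N\<^sub>2"
proof -
  have bc: "(\<lambda>z. b z $ i) \<in> bcontfun" "q \<in> bcontfun" for i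
    using adm by (auto simp: admissible_coefficients_def)
  have nn: "0 \<le> sup_norm (\<lambda>z. b z $ i)" "0 \<le> sup_norm q" for i
    using abs_le_sup_norm[OF bc(1), of undefined] abs_le_sup_norm[OF bc(2), of undefined]
    by (meson abs_ge_zero order_trans)+
  have N: "(\<Sum>i\<in>UNIV. sup_norm (\<lambda>z. b z $ i)) + sup_norm q \<le> N\<^sub>2"
    using adm by (simp add: admissible_coefficients_def)
  have "sup_norm (\<lambda>z. b z $ i) \<le> (\<Sum>i\<in>UNIV. sup_norm (\<lambda>z. b z $ i))"
    by (rule member_le_sum) (auto simp: nn)
  then show "\<bar>b z $ i\<bar> \<le> N\<^sub>2" using abs_le_sup_norm[OF bc(1), where i1=i and z=z] N nn(2) by linarith
  have "0 \<le> (\<Sum>i\<in>UNIV. sup_norm (\<lambda>z. b z $ i))" by (intro sum_nonneg) (auto simp: nn)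
  then show "\<bar>q z\<bar> \<le> N\<^sub>2" using abs_le_sup_norm[OF bc(2), of z] N by linarith
qed

end

section \<open>The comparison Gaussian\<close>

definition gauss_kernel :: "real \<Rightarrow> real^'n \<Rightarrow> real \<Rightarrow> real"
  where "gauss_kernel M v s = s powr (- (real CARD('n) / 2)) * exp (- (norm v)\<^sup>2 / (8 * M * s))"

lemma gauss_kernel_nonneg: "0 \<le> gauss_kernel M v s"
  by (simp add: gauss_kernel_def)

lemma nn_integral_exp_square:
  assumes "0 < (c::real)"
  shows "(\<integral>\<^sup>+y. ennreal (exp (- c * (y - m)\<^sup>2)) \<partial>lborel) = ennreal (sqrt (pi / c))"
proof -
  define \<sigma> where "\<sigma> = sqrt (1 / (2 * c))"
  have \<sigma>: "\<sigma> > 0" "\<sigma>\<^sup>2 = 1 / (2 * c)" using assms by (auto simp: \<sigma>_def)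
  have "exp (- c * (y - m)\<^sup>2) = sqrt (pi / c) * normal_density m \<sigma> y" for y
    using assms by (simp add: normal_density_def \<sigma>(2) field_simps real_sqrt_divide real_sqrt_mult)
  then have "(\<integral>\<^sup>+y. ennreal (exp (- c * (y - m)\<^sup>2)) \<partial>lborel)
      = (\<integral>\<^sup>+y. ennreal (sqrt (pi / c)) * ennreal (normal_density m \<sigma> y) \<partial>lborel)"
    using assms by (simp add: ennreal_mult)
  also have "\<dots> = ennreal (sqrt (pi / c)) * (\<integral>\<^sup>+y. ennreal (normal_density m \<sigma> y) \<partial>lborel)"
    by (rule nn_integral_cmult) simp
  also have "(\<integral>\<^sup>+y. ennreal (normal_density m \<sigma> y) \<partial>lborel) = 1"
    using \<sigma>(1) by (subst nn_integral_eq_integral) (auto simp: integrable_normal_density)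
  finally show ?thesis by simp
qed

lemma nn_integral_exp_norm_square:
  fixes m :: "real^'n"
  assumes c: "0 < (c::real)"
  shows "(\<integral>\<^sup>+y. ennreal (exp (- c * (norm (y - m))\<^sup>2)) \<partial>lborel)
    = ennreal ((pi / c) powr (real CARD('n) / 2))"
proof -
  have *: "ennreal (exp (- c * (norm (y - m))\<^sup>2))
      = (\<Prod>b\<in>Basis. ennreal (exp (- c * (y \<bullet> b - m \<bullet> b)\<^sup>2)))" for y
  proof -
    have "(norm (y - m))\<^sup>2 = (\<Sum>b\<in>Basis. (y \<bullet> b - m \<bullet> b)\<^sup>2)"
      by (subst power2_norm_eq_inner, subst euclidean_inner)
         (simp add: inner_diff_left power2_eq_square)
    then have "exp (- c * (norm (y - m))\<^sup>2) = (\<Prod>b\<in>Basis. exp (- c * (y \<bullet> b - m \<bullet> b)\<^sup>2))"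
      by (simp add: sum_distrib_left flip: exp_sum)
    then show ?thesis by (simp add: prod_ennreal)
  qed
  have "(\<integral>\<^sup>+y. ennreal (exp (- c * (norm (y - m))\<^sup>2)) \<partial>lborel)
      = (\<Prod>b\<in>(Basis :: (real^'n) set). ennreal (sqrt (pi / c)))"
    unfolding * using nn_integral_exp_square[OF c]
    by (subst nn_integral_lborel_prod[where f="\<lambda>b x. ennreal (exp (- c * (x - m \<bullet> b)\<^sup>2))"]) auto
  also have "\<dots> = ennreal ((pi / c) powr (real CARD('n) / 2))"
    using c by (simp add: ennreal_power powr_half_sqrt[symmetric] powr_powr powr_realpow[symmetric]
        del: powr_realpow)
  finally show ?thesis .
qed

text \<open>The square is completed at the weighted mean \<open>(r x + p \<xi>) / (p + r)\<close>, which minimises the left hand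
  side in \<open>\<eta>\<close>.\<close>
lemma norm_square_complete:
  fixes x \<eta> \<xi> :: "'a::real_inner"
  assumes p: "0 < p" and r: "0 < r"
  shows "(norm (x - \<eta>))\<^sup>2 / p + (norm (\<eta> - \<xi>))\<^sup>2 / r
    = (norm (x - \<xi>))\<^sup>2 / (p + r)
      + (p + r) / (p * r) * (norm (\<eta> - (\<xi> + (r / (p + r)) *\<^sub>R (x - \<xi>))))\<^sup>2"
proof -
  define u v where "u = \<eta> - \<xi>" and "v = x - \<xi>"
  have "x - \<eta> = v - u" "\<eta> - (\<xi> + (r / (p + r)) *\<^sub>R (x - \<xi>)) = u - (r / (p + r)) *\<^sub>R v"
    by (simp_all add: u_def v_def)
  moreover have "(norm (v - u))\<^sup>2 = v \<bullet> v - 2 * (u \<bullet> v) + u \<bullet> u"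
    by (simp add: power2_norm_eq_inner inner_diff_left inner_diff_right inner_commute)
  moreover have "(norm (u - (r / (p + r)) *\<^sub>R v))\<^sup>2
      = u \<bullet> u - 2 * (r / (p + r)) * (u \<bullet> v) + (r / (p + r))\<^sup>2 * (v \<bullet> v)"
    unfolding power2_norm_eq_inner by (simp add: inner_diff_left inner_diff_right inner_commute power2_eq_square)
  moreover have "(v \<bullet> v - 2 * (u \<bullet> v) + u \<bullet> u) / p + u \<bullet> u / r = v \<bullet> v / (p + r) + (p + r) / (p * r) *
      (u \<bullet> u - 2 * (r / (p + r)) * (u \<bullet> v) + (r / (p + r))\<^sup>2 * (v \<bullet> v))"
  proof -
    have ne: "p \<noteq> 0" "r \<noteq> 0" "p + r \<noteq> 0" using p r by auto
    have "(p + r) / (p * r) * (u \<bullet> u - 2 * (r / (p + r)) * (u \<bullet> v) + (r / (p + r))\<^sup>2 * (v \<bullet> v))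
      = (p + r) / (p * r) * (u \<bullet> u) - 2 / p * (u \<bullet> v) + r / (p * (p + r)) * (v \<bullet> v)"
    proof -
      have "(p + r) / (p * r) * (2 * (r / (p + r)) * (u \<bullet> v)) = 2 / p * (u \<bullet> v)"
        "(p + r) / (p * r) * ((r / (p + r))\<^sup>2 * (v \<bullet> v)) = r / (p * (p + r)) * (v \<bullet> v)"
        using ne by (simp_all add: power2_eq_square)
      then show ?thesis by (simp only: right_diff_distrib distrib_left)
    qed
    moreover have "1 / (p + r) + r / (p * (p + r)) = 1 / p"
      using ne by (simp add: divide_simps)
    then have "v \<bullet> v / p = v \<bullet> v / (p + r) + r / (p * (p + r)) * (v \<bullet> v)"
      by (metis (no_types, opaque_lifting) distrib_right mult.commute mult_1 times_divide_eq_left)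
    ultimately show ?thesis using ne
      by (simp add: diff_divide_distrib add_divide_distrib distrib_right)
  qed
  ultimately show ?thesis by (simp only: u_def[symmetric] v_def[symmetric]
      power2_norm_eq_inner[of u] power2_norm_eq_inner[of v])
qed

abbreviation gauss_mass :: "'n itself \<Rightarrow> real \<Rightarrow> real"
  where "gauss_mass _ M \<equiv> (8 * pi * M) powr (real CARD('n) / 2)"

text \<open>The semigroup property of the heat kernel, by completing the square. The factor
  \<open>(8 \<pi> M)\<^sup>n\<^sup>/\<^sup>2\<close> is the mass of the unnormalised kernel.\<close>
lemma nn_integral_gauss_kernel_convolution:
  fixes x \<xi> :: "real^'n"
  assumes M: "0 < M" and p: "0 < p" and r: "0 < r"
  shows "(\<integral>\<^sup>+\<eta>. ennreal (gauss_kernel M (x - \<eta>) p * gauss_kernel M (\<eta> - \<xi>) r) \<partial>lborel)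
    = ennreal (gauss_mass TYPE('n) M * gauss_kernel M (x - \<xi>) (p + r))"
proof -
  define m where "m = \<xi> + (r / (p + r)) *\<^sub>R (x - \<xi>)"
  define c where "c = (p + r) / (8 * M * p * r)"
  define N where "N = real CARD('n) / 2"
  define D where "D = p powr (- N) * r powr (- N) * exp (- (norm (x - \<xi>))\<^sup>2 / (8 * M * (p + r)))"
  have c: "c > 0" using M p r by (simp add: c_def)
  have e: "gauss_kernel M (x - \<eta>) p * gauss_kernel M (\<eta> - \<xi>) r
      = D * exp (- c * (norm (\<eta> - m))\<^sup>2)" for \<eta>
  proof -
    have "- (norm (x - \<eta>))\<^sup>2 / (8 * M * p) + - (norm (\<eta> - \<xi>))\<^sup>2 / (8 * M * r)
        = - (1 / (8 * M)) * ((norm (x - \<eta>))\<^sup>2 / p + (norm (\<eta> - \<xi>))\<^sup>2 / r)"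
      using M p r by (simp add: field_simps)
    also have "\<dots> = - (norm (x - \<xi>))\<^sup>2 / (8 * M * (p + r)) + - c * (norm (\<eta> - m))\<^sup>2"
      unfolding norm_square_complete[OF p r] m_def[symmetric] c_def using M p r
      by (simp add: algebra_simps add_divide_distrib)
    finally show ?thesis
      by (simp add: gauss_kernel_def D_def N_def mult_exp_exp)
  qed
  have "(\<integral>\<^sup>+\<eta>. ennreal (gauss_kernel M (x - \<eta>) p * gauss_kernel M (\<eta> - \<xi>) r) \<partial>lborel)
      = (\<integral>\<^sup>+\<eta>. ennreal D * ennreal (exp (- c * (norm (\<eta> - m))\<^sup>2)) \<partial>lborel)"
    unfolding e by (simp add: ennreal_mult D_def)
  also have "\<dots> = ennreal D * (\<integral>\<^sup>+\<eta>. ennreal (exp (- c * (norm (\<eta> - m))\<^sup>2)) \<partial>lborel)"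
    by (rule nn_integral_cmult) measurable
  also have "\<dots> = ennreal (D * (pi / c) powr N)"
    unfolding nn_integral_exp_norm_square[OF c] by (simp add: ennreal_mult D_def N_def)
  also have "D * (pi / c) powr N = gauss_mass TYPE('n) M * gauss_kernel M (x - \<xi>) (p + r)"
  proof -
    have "pi / c = 8 * pi * M * p * r / (p + r)" using p r M by (simp add: c_def)
    then have "(pi / c) powr N = (8 * pi * M) powr N * p powr N * r powr N * (p + r) powr (- N)"
      unfolding \<open>pi / c = _\<close> using p r M
      by (simp add: powr_mult powr_divide powr_minus_divide)
    moreover have "p powr (- N) * p powr N = 1" "r powr (- N) * r powr N = 1"
      using p r by (simp_all flip: powr_add)
    moreover have "D * ((8 * pi * M) powr N * p powr N * r powr N * (p + r) powr (- N))
      = (p powr (- N) * p powr N) * (r powr (- N) * r powr N) * ((8 * pi * M) powr N *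
        ((p + r) powr (- N) * exp (- (norm (x - \<xi>))\<^sup>2 / (8 * M * (p + r)))))"
      by (simp add: D_def)
    ultimately show ?thesis by (simp add: gauss_kernel_def N_def)
  qed
  finally show ?thesis .
qed

section \<open>A singular Volterra kernel\<close>

lemma nn_integral_powr:
  assumes \<beta>: "0 < (\<beta>::real)" and c: "0 \<le> c"
  shows "(\<integral>\<^sup>+r. ennreal (r powr (\<beta> - 1)) * indicator {0<..<c} r \<partial>lborel) \<le> ennreal (c powr \<beta> / \<beta>)"
proof -
  have "(\<integral>\<^sup>+r. ennreal (r powr (\<beta> - 1)) * indicator {0<..<c} r \<partial>lborel)
      \<le> (\<integral>\<^sup>+r. ennreal (r powr (\<beta> - 1)) * indicator {0..c} r \<partial>lborel)"
    by (intro nn_integral_mono) (auto simp: indicator_def)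
  also have "((\<lambda>r. r powr (\<beta> - 1)) has_integral (c powr \<beta> / \<beta>)) {0..c}"
    using has_integral_powr_from_0[of "\<beta> - 1" c] \<beta> c by simp
  then have "(\<integral>\<^sup>+r. ennreal (r powr (\<beta> - 1)) * indicator {0..c} r \<partial>lborel) = ennreal (c powr \<beta> / \<beta>)"
    by (intro nn_integral_has_integral_lebesgue'[OF _ ]) auto
  finally show ?thesis .
qed

lemma nn_integral_exp_decay:
  assumes "0 < (\<Lambda>::real)"
  shows "(\<integral>\<^sup>+p. ennreal (exp (- \<Lambda> * p)) * indicator {0<..<s} p \<partial>lborel) \<le> ennreal (1 / \<Lambda>)"
proof -
  have "(\<integral>\<^sup>+p. ennreal (exp (- \<Lambda> * p)) * indicator {0<..<s} p \<partial>lborel)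
      \<le> (\<integral>\<^sup>+p. ennreal (exp (- \<Lambda> * p)) * indicator {0..} p \<partial>lborel)"
    by (intro nn_integral_mono) (auto simp: indicator_def)
  also have "\<dots> = ennreal (0 - (- exp (- \<Lambda> * 0) / \<Lambda>))"
  proof (rule nn_integral_FTC_atLeast)
    have "filterlim (\<lambda>x::real. \<Lambda> * x) at_top at_top"
      using assms by (rule filterlim_tendsto_pos_mult_at_top[OF tendsto_const _ filterlim_ident])
    then have "((\<lambda>x. exp (- (\<Lambda> * x))) \<longlongrightarrow> 0) at_top"
      by (intro filterlim_compose[OF exp_at_bot]) (simp add: filterlim_uminus_at_bot)
    from tendsto_divide[OF tendsto_minus[OF this] tendsto_const, of \<Lambda>]
    show "((\<lambda>x. - exp (- \<Lambda> * x) / \<Lambda>) \<longlongrightarrow> 0) at_top"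
      using assms by simp
  qed (use assms in \<open>auto intro!: derivative_eq_intros\<close>)
  finally show ?thesis by simp
qed

lemma powr_le_level_split:
  fixes \<beta> \<Lambda> q :: real
  assumes \<beta>: "0 < \<beta>" "\<beta> \<le> 1" and \<Lambda>: "0 < \<Lambda>" and q: "0 < q"
  shows "q powr (\<beta> - 1) \<le> q powr (\<beta> - 1) * indicator {0<..<1/\<Lambda>} q + \<Lambda> powr (1 - \<beta>)"
proof (cases "q < 1 / \<Lambda>")
  case False
  then have "q powr (\<beta> - 1) \<le> (1 / \<Lambda>) powr (\<beta> - 1)"
    using \<beta> \<Lambda> by (intro powr_mono2') auto
  also have "\<dots> = \<Lambda> powr (1 - \<beta>)" using \<Lambda> by (simp add: powr_divide powr_minus[symmetric] flip: powr_minus_divide)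
  finally show ?thesis using False by simp
qed (use q in auto)

lemma nn_integral_reflect:
  fixes f :: "real \<Rightarrow> ennreal"
  assumes [measurable]: "f \<in> borel_measurable borel"
  shows "(\<integral>\<^sup>+r. f (c - r) \<partial>lborel) = (\<integral>\<^sup>+r. f r \<partial>lborel)"
  using nn_integral_real_affine[of f "-1" c] by simp

lemma volterra_half:
  assumes \<beta>: "0 < \<beta>" "\<beta> \<le> 1" and \<Lambda>: "0 < \<Lambda>" and s: "0 < s"
  shows "(\<integral>\<^sup>+p. ennreal (p powr (\<beta> - 1) * exp (- \<Lambda> * p)) * indicator {0<..<s} p \<partial>lborel)
      \<le> ennreal ((1 / \<beta> + 1) * \<Lambda> powr (- \<beta>))" (is "?I \<le> _")
    and "(\<integral>\<^sup>+p. ennreal ((s - p) powr (\<beta> - 1) * exp (- \<Lambda> * p)) * indicator {0<..<s} p \<partial>lborel)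
      \<le> ennreal ((1 / \<beta> + 1) * \<Lambda> powr (- \<beta>))" (is "?J \<le> _")
proof -
  let ?A = "\<lambda>q. ennreal (q powr (\<beta> - 1)) * indicator {0<..<1/\<Lambda>} q"
  let ?B = "\<lambda>p. ennreal (\<Lambda> powr (1 - \<beta>)) * (ennreal (exp (- \<Lambda> * p)) * indicator {0<..<s} p)"
  have A: "(\<integral>\<^sup>+q. ?A q \<partial>lborel) \<le> ennreal ((1 / \<beta>) * \<Lambda> powr (- \<beta>))"
    using nn_integral_powr[of \<beta> "1 / \<Lambda>"] \<beta> \<Lambda> by (simp add: powr_divide powr_minus field_simps)
  have B: "(\<integral>\<^sup>+p. ?B p \<partial>lborel) \<le> ennreal (\<Lambda> powr (- \<beta>))"
  proof -
    have "(\<integral>\<^sup>+p. ?B p \<partial>lborel)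
        = ennreal (\<Lambda> powr (1 - \<beta>)) * (\<integral>\<^sup>+p. ennreal (exp (- \<Lambda> * p)) * indicator {0<..<s} p \<partial>lborel)"
      by (rule nn_integral_cmult) measurable
    also have "\<dots> \<le> ennreal (\<Lambda> powr (1 - \<beta>)) * ennreal (1 / \<Lambda>)"
      by (intro mult_left_mono nn_integral_exp_decay \<Lambda>) simp
    also have "\<dots> = ennreal (\<Lambda> powr (- \<beta>))"
      using \<Lambda> by (simp add: powr_diff powr_minus field_simps flip: ennreal_mult)
    finally show ?thesis .
  qed
  have fin: "(\<integral>\<^sup>+q. ?A q \<partial>lborel) + (\<integral>\<^sup>+p. ?B p \<partial>lborel) \<le> ennreal ((1 / \<beta> + 1) * \<Lambda> powr (- \<beta>))"
    using add_mono[OF A B] \<beta> by (simp add: distrib_right flip: ennreal_plus)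
  have pt: "ennreal (q powr (\<beta> - 1) * exp (- \<Lambda> * p)) * indicator {0<..<s} p \<le> ?A q + ?B p"
    if "p \<in> {0<..<s} \<Longrightarrow> 0 < q" for p q
  proof (cases "p \<in> {0<..<s}")
    case True
    have "q powr (\<beta> - 1) * exp (- \<Lambda> * p)
        \<le> (q powr (\<beta> - 1) * indicator {0<..<1/\<Lambda>} q + \<Lambda> powr (1 - \<beta>)) * exp (- \<Lambda> * p)"
      using powr_le_level_split[OF \<beta> \<Lambda> that[OF True]] by (rule mult_right_mono) simp
    also have "\<dots> \<le> q powr (\<beta> - 1) * indicator {0<..<1/\<Lambda>} q + \<Lambda> powr (1 - \<beta>) * exp (- \<Lambda> * p)"
      unfolding distrib_right using True \<Lambda>
      by (intro add_mono order.refl mult_left_le) (auto simp: indicator_def)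
    finally have "ennreal (q powr (\<beta> - 1) * exp (- \<Lambda> * p))
        \<le> ennreal (q powr (\<beta> - 1) * indicator {0<..<1/\<Lambda>} q + \<Lambda> powr (1 - \<beta>) * exp (- \<Lambda> * p))"
      by (rule ennreal_leI)
    then show ?thesis using True
      by (simp add: ennreal_mult' ennreal_indicator)
  qed simp
  have "?I \<le> (\<integral>\<^sup>+p. (?A p + ?B p) \<partial>lborel)"
    by (intro nn_integral_mono pt) auto
  also have "\<dots> = (\<integral>\<^sup>+p. ?A p \<partial>lborel) + (\<integral>\<^sup>+p. ?B p \<partial>lborel)"
    by (rule nn_integral_add) measurable
  finally show "?I \<le> ennreal ((1 / \<beta> + 1) * \<Lambda> powr (- \<beta>))" using fin by (rule order_trans)
  have "?J \<le> (\<integral>\<^sup>+p. (?A (s - p) + ?B p) \<partial>lborel)"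
    by (intro nn_integral_mono pt) auto
  also have "\<dots> = (\<integral>\<^sup>+p. ?A (s - p) \<partial>lborel) + (\<integral>\<^sup>+p. ?B p \<partial>lborel)"
    by (rule nn_integral_add) measurable
  also have "(\<integral>\<^sup>+p. ?A (s - p) \<partial>lborel) = (\<integral>\<^sup>+p. ?A p \<partial>lborel)"
    by (rule nn_integral_reflect) measurable
  finally show "?J \<le> ennreal ((1 / \<beta> + 1) * \<Lambda> powr (- \<beta>))" using fin by (rule order_trans)
qed

text \<open>For the weakly singular kernel \<open>p\<^sup>\<beta>\<^sup>-\<^sup>1\<close>, a large exponential weight makes the Volterra
  operator a contraction: with \<open>p + r = s\<close>, one of the two singular factors is at most
  \<open>2 s\<^sup>\<beta>\<^sup>-\<^sup>1\<close>, and the other one integrates against \<open>e\<^sup>-\<^sup>\<Lambda>\<^sup>p\<close> to \<open>O(\<Lambda>\<^sup>-\<^sup>\<beta>)\<close>, as one sees by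
  splitting it at the level \<open>1 / \<Lambda>\<close>.\<close>
lemma volterra_contraction:
  assumes \<beta>: "0 < \<beta>" "\<beta> \<le> 1" and \<Lambda>: "0 < \<Lambda>" and s: "0 < s"
  shows "(\<integral>\<^sup>+p. ennreal (p powr (\<beta> - 1) * (s - p) powr (\<beta> - 1) * exp (- \<Lambda> * p)) * indicator {0<..<s} p \<partial>lborel)
    \<le> ennreal (4 * (1 / \<beta> + 1) * \<Lambda> powr (- \<beta>) * s powr (\<beta> - 1))"
proof -
  let ?e = "\<lambda>p. exp (- \<Lambda> * p)"
  let ?c = "ennreal (2 * s powr (\<beta> - 1))"
  let ?I = "\<lambda>p. ennreal (p powr (\<beta> - 1) * ?e p) * indicator {0<..<s} p"
  let ?J = "\<lambda>p. ennreal ((s - p) powr (\<beta> - 1) * ?e p) * indicator {0<..<s} p"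
  have half: "q powr (\<beta> - 1) \<le> 2 * s powr (\<beta> - 1)" if "s / 2 \<le> q" for q
  proof -
    have "q powr (\<beta> - 1) \<le> (s / 2) powr (\<beta> - 1)" using that s \<beta> by (intro powr_mono2') auto
    also have "\<dots> = 2 powr (1 - \<beta>) * s powr (\<beta> - 1)"
      using s by (simp add: powr_divide powr_diff field_simps)
    also have "2 powr (1 - \<beta>) \<le> (2::real) powr 1" using \<beta> by (intro powr_mono) auto
    finally show ?thesis by (simp add: mult_right_mono)
  qed
  have "p powr (\<beta> - 1) * (s - p) powr (\<beta> - 1) * ?e p
      \<le> 2 * s powr (\<beta> - 1) * (p powr (\<beta> - 1) * ?e p + (s - p) powr (\<beta> - 1) * ?e p)" for p
  proof -
    have "p powr (\<beta> - 1) * (s - p) powr (\<beta> - 1)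
        \<le> 2 * s powr (\<beta> - 1) * (p powr (\<beta> - 1) + (s - p) powr (\<beta> - 1))"
    proof (cases "s / 2 \<le> p")
      case True
      have "p powr (\<beta> - 1) * (s - p) powr (\<beta> - 1) \<le> 2 * s powr (\<beta> - 1) * (s - p) powr (\<beta> - 1)"
        by (intro mult_right_mono half True) simp
      also have "\<dots> \<le> 2 * s powr (\<beta> - 1) * (p powr (\<beta> - 1) + (s - p) powr (\<beta> - 1))"
        by (intro mult_left_mono) auto
      finally show ?thesis .
    next
      case False
      then have "p powr (\<beta> - 1) * (s - p) powr (\<beta> - 1) \<le> p powr (\<beta> - 1) * (2 * s powr (\<beta> - 1))"
        by (intro mult_left_mono half) auto
      also have "\<dots> \<le> 2 * s powr (\<beta> - 1) * (p powr (\<beta> - 1) + (s - p) powr (\<beta> - 1))"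
        by (simp add: algebra_simps)
      finally show ?thesis .
    qed
    then have "p powr (\<beta> - 1) * (s - p) powr (\<beta> - 1) * ?e p
      \<le> 2 * s powr (\<beta> - 1) * (p powr (\<beta> - 1) + (s - p) powr (\<beta> - 1)) * ?e p"
      by (rule mult_right_mono) simp
    then show ?thesis by (simp add: algebra_simps)
  qed
  then have "(\<integral>\<^sup>+p. ennreal (p powr (\<beta> - 1) * (s - p) powr (\<beta> - 1) * ?e p) * indicator {0<..<s} p \<partial>lborel)
      \<le> (\<integral>\<^sup>+p. ennreal (2 * s powr (\<beta> - 1) * (p powr (\<beta> - 1) * ?e p + (s - p) powr (\<beta> - 1) * ?e p)) * indicator {0<..<s} p \<partial>lborel)"
    by (intro nn_integral_mono mult_right_mono ennreal_leI) auto
  also have "\<dots> = (\<integral>\<^sup>+p. ?c * (?I p + ?J p) \<partial>lborel)"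
    by (intro nn_integral_cong) (simp add: ennreal_mult distrib_right split: split_indicator)
  also have "\<dots> = ?c * (\<integral>\<^sup>+p. (?I p + ?J p) \<partial>lborel)"
    by (rule nn_integral_cmult) measurable
  also have "(\<integral>\<^sup>+p. (?I p + ?J p) \<partial>lborel) = (\<integral>\<^sup>+p. ?I p \<partial>lborel) + (\<integral>\<^sup>+p. ?J p \<partial>lborel)"
    by (rule nn_integral_add) measurable
  also have "?c * \<dots> \<le> ?c * (ennreal ((1 / \<beta> + 1) * \<Lambda> powr (- \<beta>)) + ennreal ((1 / \<beta> + 1) * \<Lambda> powr (- \<beta>)))"
    by (intro mult_left_mono add_mono volterra_half \<beta> \<Lambda> s) auto
  also have "\<dots> = ennreal (4 * (1 / \<beta> + 1) * \<Lambda> powr (- \<beta>) * s powr (\<beta> - 1))"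
    using \<beta> by (simp flip: ennreal_mult ennreal_plus add: algebra_simps)
  finally show ?thesis .
qed

section \<open>The frozen Gaussian kernel\<close>

text \<open>The kernel without its normalising factor, which depends on \<open>B\<close> only and reappears in
  \<open>parametrix_factor\<close>.\<close>
definition matrix_gauss :: "real^'n^'n \<Rightarrow> real^'n \<Rightarrow> real \<Rightarrow> real"
  where "matrix_gauss B v s =
    s powr (- (real CARD('n) / 2)) * exp (- ((B *v v) \<bullet> v / (4 * s)))"

lemma matrix_gauss_nonneg: "0 \<le> matrix_gauss B v s"
  by (simp add: matrix_gauss_def)

lemma quadratic_form_line:
  fixes B :: "real^'n^'n"
  assumes sym: "\<And>x y. (B *v x) \<bullet> y = x \<bullet> (B *v y)"
  shows "(B *v (v + r *\<^sub>R axis i 1)) \<bullet> (v + r *\<^sub>R axis i 1)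
    = (B *v v) \<bullet> v + 2 * r * (B *v v) $ i + r\<^sup>2 * B $ i $ i"
proof -
  have "(B *v axis i 1) \<bullet> v = (B *v v) $ i"
    using sym[of "axis i 1" v] by (simp add: inner_axis' )
  moreover have "(B *v axis i 1) \<bullet> axis i 1 = B $ i $ i"
    by (simp add: matrix_vector_mult_basis column_def inner_axis)
  ultimately show ?thesis
    by (simp add: matrix_vector_right_distrib matrix_vector_mult_scaleR inner_add_left
        inner_add_right inner_axis power2_eq_square algebra_simps)
qed

lemma matrix_gauss_partial:
  fixes B :: "real^'n^'n"
  assumes sym: "\<And>x y. (B *v x) \<bullet> y = x \<bullet> (B *v y)" and s: "0 < s"
  shows "((\<lambda>r. matrix_gauss B (v + r *\<^sub>R axis i 1) s) has_real_derivative
    - ((B *v v) $ i / (2 * s)) * matrix_gauss B v s) (at 0)"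
  unfolding matrix_gauss_def quadratic_form_line[OF sym]
  using s by (auto intro!: derivative_eq_intros)

lemma matrix_gauss_partial2:
  fixes B :: "real^'n^'n"
  assumes sym: "\<And>x y. (B *v x) \<bullet> y = x \<bullet> (B *v y)" and s: "0 < s"
  shows "((\<lambda>r. - ((B *v (v + r *\<^sub>R axis i 1)) $ j / (2 * s)) * matrix_gauss B (v + r *\<^sub>R axis i 1) s)
    has_real_derivative
      ((B *v v) $ i * (B *v v) $ j / (4 * s\<^sup>2) - B $ j $ i / (2 * s)) * matrix_gauss B v s) (at 0)"
proof -
  have "(B *v (v + r *\<^sub>R axis i 1)) $ j = (B *v v) $ j + r * B $ j $ i" for r
    by (simp add: matrix_vector_right_distrib matrix_vector_mult_scaleR
        matrix_vector_mult_basis column_def)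
  then have *: "(\<lambda>r. - ((B *v (v + r *\<^sub>R axis i 1)) $ j / (2 * s)) * matrix_gauss B (v + r *\<^sub>R axis i 1) s)
     = (\<lambda>r. - (((B *v v) $ j + r * B $ j $ i) / (2 * s)) * matrix_gauss B (v + r *\<^sub>R axis i 1) s)"
    by simp
  have "((\<lambda>r. - (((B *v v) $ j + r * B $ j $ i) / (2 * s))) has_real_derivative - (B $ j $ i / (2 * s))) (at 0)"
    using s by (auto intro!: derivative_eq_intros simp: field_simps)
  from DERIV_mult[OF this matrix_gauss_partial[OF sym s]] show ?thesis
    unfolding * by (rule DERIV_cong) (simp add: power2_eq_square algebra_simps)
qed

lemma matrix_gauss_time_derivative:
  fixes B :: "real^'n^'n"
  assumes "0 < s"
  shows "(matrix_gauss B v has_real_derivative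
    ((B *v v) \<bullet> v / (4 * s\<^sup>2) - real CARD('n) / (2 * s)) * matrix_gauss B v s) (at s)"
proof -
  define N where "N = real CARD('n) / 2"
  have "((\<lambda>s. s powr (- N) * exp (- ((B *v v) \<bullet> v / (4 * s)))) has_real_derivative
    ((B *v v) \<bullet> v / (4 * s\<^sup>2) - N / s) * (s powr (- N) * exp (- ((B *v v) \<bullet> v / (4 * s))))) (at s)"
    using assms by (auto intro!: derivative_eq_intros
        simp: powr_diff field_simps power2_eq_square)
  then show ?thesis using assms unfolding matrix_gauss_def N_def by (simp add: matrix_gauss_def[abs_def])
qed

text \<open>The value of \<open>L\<close> on the frozen kernel, after the cancellation coming from the equation
  \<open>\<Sum> a\<^sub>i\<^sub>j(\<xi>, \<tau>) \<partial>\<^sub>i\<^sub>j = \<partial>\<^sub>t\<close> that the kernel solves.\<close>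
definition frozen_defect ::
  "((real^'n) \<times> real \<Rightarrow> real^'n^'n) \<Rightarrow> ((real^'n) \<times> real \<Rightarrow> real^'n) \<Rightarrow>
   ((real^'n) \<times> real \<Rightarrow> real) \<Rightarrow> real^'n \<Rightarrow> real \<Rightarrow> real^'n \<Rightarrow> real \<Rightarrow> real"
  where "frozen_defect a b q x t \<xi> \<tau> =
    (let B = matrix_inv (a (\<xi>, \<tau>)); v = x - \<xi>; s = t - \<tau> in
      ((\<Sum>i\<in>UNIV. \<Sum>j\<in>UNIV. (a (x, t) $ i $ j - a (\<xi>, \<tau>) $ i $ j) *
          ((B *v v) $ i * (B *v v) $ j / (4 * s\<^sup>2) - B $ i $ j / (2 * s))) +
       (\<Sum>i\<in>UNIV. b (x, t) $ i * - ((B *v v) $ i / (2 * s))) + q (x, t)) * matrix_gauss B v s)"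

text \<open>For \<open>B = A\<^sup>-\<^sup>1\<close>, both contractions are explicit: \<open>\<langle>A B v, B v\<rangle> = \<langle>B v, v\<rangle>\<close>, and the trace of
  \<open>A B\<close> is \<open>n\<close>. The right hand side is the logarithmic time derivative of the kernel.\<close>
lemma frozen_coefficients_cancel:
  fixes A :: "real^'n^'n"
  assumes \<kappa>: "0 < \<kappa>" and M: "0 < M" and ell: "elliptic \<kappa> M A"
  defines "B \<equiv> matrix_inv A"
  shows "(\<Sum>i\<in>UNIV. \<Sum>j\<in>UNIV. A $ i $ j * ((B *v v) $ i * (B *v v) $ j / (4 * s\<^sup>2) - B $ i $ j / (2 * s)))
    = (B *v v) \<bullet> v / (4 * s\<^sup>2) - real CARD('n) / (2 * s)"
proof -
  have "(\<Sum>i\<in>UNIV. \<Sum>j\<in>UNIV. A $ i $ j * ((B *v v) $ i * (B *v v) $ j)) = (A *v (B *v v)) \<bullet> (B *v v)"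
    by (simp add: inner_vec_def matrix_vector_mult_def[of A] sum_distrib_right sum_distrib_left mult_ac)
  also have "\<dots> = (B *v v) \<bullet> v"
    unfolding B_def by (simp add: mult_matrix_inv[OF \<kappa> M ell] inner_commute)
  finally have 1: "(\<Sum>i\<in>UNIV. \<Sum>j\<in>UNIV. A $ i $ j * ((B *v v) $ i * (B *v v) $ j)) = (B *v v) \<bullet> v" .
  have "(\<Sum>j\<in>UNIV. A $ i $ j * B $ i $ j) = (A ** B) $ i $ i" for i
    unfolding B_def matrix_matrix_mult_def
    by (simp add: matrix_inv_entry_symmetric[OF \<kappa> M ell, of i])
  moreover have "A ** B = mat 1"
    unfolding B_def by (rule matrix_inv_inverse[OF elliptic_invertible[OF \<kappa> M ell]])
  ultimately have 2: "(\<Sum>i\<in>UNIV. \<Sum>j\<in>UNIV. A $ i $ j * B $ i $ j) = real CARD('n)"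
    by (simp add: mat_def)
  have "(\<Sum>i\<in>UNIV. \<Sum>j\<in>UNIV. A $ i $ j * ((B *v v) $ i * (B *v v) $ j / (4 * s\<^sup>2) - B $ i $ j / (2 * s)))
    = (\<Sum>i\<in>UNIV. \<Sum>j\<in>UNIV. A $ i $ j * ((B *v v) $ i * (B *v v) $ j)) / (4 * s\<^sup>2)
      - (\<Sum>i\<in>UNIV. \<Sum>j\<in>UNIV. A $ i $ j * B $ i $ j) / (2 * s)"
    by (simp add: right_diff_distrib sum_subtractf sum_divide_distrib)
  then show ?thesis unfolding 1 2 .
qed

text \<open>The three summands come from the terms of order two, one and zero in
  \<open>abs_frozen_defect_le\<close>, the factor \<open>(1 + 16 M)\<^sup>2\<close> from \<open>one_plus_square_le_exp\<close>.\<close>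
definition defect_constant :: "'n itself \<Rightarrow> real \<Rightarrow> real \<Rightarrow> real \<Rightarrow> real \<Rightarrow> real"
  where "defect_constant _ N\<^sub>1 N\<^sub>2 M \<kappa> = (1 + 16 * M)\<^sup>2 *
    ((real CARD('n))\<^sup>2 * N\<^sub>1 * (1 / (4 * \<kappa>\<^sup>2) + 1 / (2 * \<kappa>)) + real CARD('n) * N\<^sub>2 / (2 * \<kappa>) + N\<^sub>2)"

lemma matrix_gauss_le_gauss_kernel:
  fixes A :: "real^'n^'n"
  assumes \<kappa>: "0 < \<kappa>" and M: "0 < M" and ell: "elliptic \<kappa> M A" and s: "0 < s"
  shows "matrix_gauss (matrix_inv A) v s
    \<le> exp (- ((norm v)\<^sup>2 / s) / (8 * M)) * gauss_kernel M v s"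
proof -
  have "- ((matrix_inv A *v v) \<bullet> v / (4 * s)) \<le> - ((norm v)\<^sup>2 / M / (4 * s))"
    using divide_right_mono[OF matrix_inv_quadratic_ge[OF \<kappa> M ell, of v], of "4 * s"] s by simp
  also have "\<dots> = - ((norm v)\<^sup>2 / s) / (8 * M) + - (norm v)\<^sup>2 / (8 * M * s)"
    using s M by (simp add: field_simps)
  finally have "exp (- ((matrix_inv A *v v) \<bullet> v / (4 * s)))
      \<le> exp (- ((norm v)\<^sup>2 / s) / (8 * M)) * exp (- (norm v)\<^sup>2 / (8 * M * s))"
    by (simp flip: exp_add)
  from mult_left_mono[OF this, of "s powr (- (real CARD('n) / 2))"] show ?thesis
    by (simp add: matrix_gauss_def gauss_kernel_def mult_ac)
qed

lemma matrix_gauss_le_gauss_kernel':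
  fixes A :: "real^'n^'n"
  assumes \<kappa>: "0 < \<kappa>" and M: "0 < M" and ell: "elliptic \<kappa> M A" and s: "0 < s"
  shows "matrix_gauss (matrix_inv A) v s \<le> gauss_kernel M v s"
  using matrix_gauss_le_gauss_kernel[OF assms, of v] mult_left_le_one_le[OF gauss_kernel_nonneg, of
      "exp (- ((norm v)\<^sup>2 / s) / (8 * M))" M v s] s M
  by (simp add: divide_nonneg_nonneg)

text \<open>For \<open>z = y / (16 M)\<close>, one has \<open>1 + y \<le> (1 + 16 M) (1 + z) \<le> (1 + 16 M) e\<^sup>z\<close>.\<close>
lemma one_plus_square_le_exp:
  assumes M: "0 < (M::real)" and y: "0 \<le> y"
  shows "(1 + y)\<^sup>2 * exp (- y / (8 * M)) \<le> (1 + 16 * M)\<^sup>2"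
proof -
  define z where "z = y / (16 * M)"
  have z: "z \<ge> 0" "y = 16 * M * z" using M y by (auto simp: z_def)
  have "1 + y \<le> (1 + 16 * M) * (1 + z)" using M z by (simp add: algebra_simps)
  also have "\<dots> \<le> (1 + 16 * M) * exp z" using M by (intro mult_left_mono exp_ge_add_one_self) auto
  finally have "(1 + y)\<^sup>2 \<le> ((1 + 16 * M) * exp z)\<^sup>2" using y by (intro power_mono) auto
  then have "(1 + y)\<^sup>2 * exp (- y / (8 * M)) \<le> ((1 + 16 * M) * exp z)\<^sup>2 * exp (- y / (8 * M))"
    by (rule mult_right_mono) simp
  also have "\<dots> = (1 + 16 * M)\<^sup>2 * (exp (2 * z) * exp (- y / (8 * M)))"
    by (simp add: power_mult_distrib exp_double)
  also have "exp (2 * z) * exp (- y / (8 * M)) = 1" using M by (simp add: z_def flip: exp_add)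
  finally show ?thesis by simp
qed

lemma powr_le_powr_exp:
  assumes "0 \<le> (c::real)" "c \<le> 1" "0 < s"
  shows "s powr (e + c) \<le> s powr e * exp s"
proof -
  have "s powr c \<le> exp s"
  proof (cases "s \<le> 1")
    case True
    then have "s powr c \<le> 1" using assms by (intro powr_le1) auto
    also have "\<dots> \<le> exp s" using assms by simp
    finally show ?thesis .
  next
    case False
    then have "s powr c \<le> s powr 1" using assms by (intro powr_mono) auto
    also have "s powr 1 = s" using assms by simp
    also have "s \<le> exp s" using exp_ge_add_one_self[of s] by linarith
    finally show ?thesis .
  qed
  then show ?thesis by (simp add: powr_add mult_left_mono)
qed

text \<open>The constant \<open>C\<^sub>0\<close> is a parameter that is fixed by an equation, to keep its dependence on the
  dimension out of the notation. The same holds for the constants of the locales below.\<close>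
locale parabolic_coefficients =
  fixes \<alpha> N\<^sub>1 N\<^sub>2 M \<kappa> C\<^sub>0 :: real and a :: "(real^'n) \<times> real \<Rightarrow> real^'n^'n"
    and b :: "(real^'n) \<times> real \<Rightarrow> real^'n" and q :: "(real^'n) \<times> real \<Rightarrow> real"
  assumes adm: "admissible_coefficients \<alpha> N\<^sub>1 N\<^sub>2 M \<kappa> a b q"
    and \<alpha>: "0 < \<alpha>" "\<alpha> \<le> 1" and N\<^sub>1: "0 < N\<^sub>1" and N\<^sub>2: "0 < N\<^sub>2" and M: "0 < M" and \<kappa>: "0 < \<kappa>"
    and C\<^sub>0: "C\<^sub>0 = defect_constant TYPE('n) N\<^sub>1 N\<^sub>2 M \<kappa>"
begin

abbreviation \<beta> :: real where "\<beta> \<equiv> \<alpha> / 2"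

lemmas ell = admissible_elliptic[OF adm]

abbreviation B :: "(real^'n) \<times> real \<Rightarrow> real^'n^'n" where "B z \<equiv> matrix_inv (a z)"

lemma B_symmetric: "(B z *v x) \<bullet> y = x \<bullet> (B z *v y)"
  by (rule matrix_inv_symmetric[OF \<kappa> M ell])

lemma C\<^sub>0_pos: "0 < C\<^sub>0"
  using N\<^sub>1 N\<^sub>2 M \<kappa> unfolding C\<^sub>0 defect_constant_def by (intro mult_pos_pos add_pos_pos divide_pos_pos) auto

text \<open>With \<open>y = \<bar>v\<bar>\<^sup>2 / s\<close>, the Hoelder condition contributes a factor \<open>s\<^sup>\<beta> (1 + y)\<close>, the second
  derivatives one of order \<open>(1 + y) / s\<close>; the gap between the decay \<open>e\<^sup>-\<^sup>y\<^sup>/\<^sup>4\<^sup>M\<close> of the kernel and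
  the decay \<open>e\<^sup>-\<^sup>y\<^sup>/\<^sup>8\<^sup>M\<close> of the comparison Gaussian absorbs the powers of \<open>1 + y\<close>. In the terms of
  lower order, the missing negative powers of \<open>s\<close> are supplied at the cost of the factor \<open>e\<^sup>s\<close>.\<close>
lemma abs_frozen_defect_le:
  assumes t: "\<tau> < t"
  shows "\<bar>frozen_defect a b q x t \<xi> \<tau>\<bar>
    \<le> C\<^sub>0 * (t - \<tau>) powr (\<beta> - 1) * exp (t - \<tau>) * gauss_kernel M (x - \<xi>) (t - \<tau>)"
proof -
  define v s where "v = x - \<xi>" and "s = t - \<tau>"
  have s: "0 < s" using t by (simp add: s_def)
  define y where "y = (norm v)\<^sup>2 / s"
  have y: "0 \<le> y" using s by (simp add: y_def)
  have vy: "(norm v)\<^sup>2 = s * y" using s by (simp add: y_def)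
  define w where "w = B (\<xi>, \<tau>) *v v"
  define D where "D = 1 / (4 * \<kappa>\<^sup>2) + 1 / (2 * \<kappa>)"
  define n where "n = real CARD('n)"
  let ?E = "s powr (\<beta> - 1) * exp s"
  have wle: "\<bar>w $ i\<bar> \<le> norm v / \<kappa>" for i
    unfolding w_def by (rule matrix_inv_component_le[OF \<kappa> M ell])
  have E1: "s powr \<beta> * (1 / s) \<le> ?E"
    using s by (simp add: powr_diff divide_right_mono)
  have H: "\<bar>a (x, t) $ i $ j - a (\<xi>, \<tau>) $ i $ j\<bar> \<le> N\<^sub>1 * (s powr \<beta> * (1 + y))" for i j
  proof -
    have "\<bar>a (x, t) $ i $ j - a (\<xi>, \<tau>) $ i $ j\<bar> \<le> N\<^sub>1 * ((norm v)\<^sup>2 + s) powr \<beta>"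
      using admissible_holder[OF adm, of "(x, t)" "(\<xi>, \<tau>)" i j] t by (simp add: v_def s_def)
    also have "(norm v)\<^sup>2 + s = s * (1 + y)" by (simp add: vy algebra_simps)
    also have "(s * (1 + y)) powr \<beta> = s powr \<beta> * (1 + y) powr \<beta>" using s y by (simp add: powr_mult)
    also have "(1 + y) powr \<beta> \<le> (1 + y) powr 1" using y \<alpha> by (intro powr_mono) auto
    finally show ?thesis using y N\<^sub>1 by (simp add: mult_left_mono)
  qed
  have S: "\<bar>w $ i * w $ j / (4 * s\<^sup>2) - B (\<xi>, \<tau>) $ i $ j / (2 * s)\<bar> \<le> D * (1 / s) * (1 + y)" for i j
  proof -
    have "\<bar>w $ i * w $ j\<bar> \<le> (norm v / \<kappa>) * (norm v / \<kappa>)"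
      unfolding abs_mult using \<kappa> by (intro mult_mono wle) auto
    also have "\<dots> = s * y / \<kappa>\<^sup>2" by (simp add: power2_eq_square flip: vy)
    finally have "\<bar>w $ i * w $ j\<bar> \<le> s * y / \<kappa>\<^sup>2" .
    then have "\<bar>w $ i * w $ j / (4 * s\<^sup>2)\<bar> \<le> (s * y / \<kappa>\<^sup>2) / (4 * s\<^sup>2)"
      using divide_right_mono[of _ _ "4 * s\<^sup>2"] by (fastforce simp: abs_divide)
    moreover have "\<bar>B (\<xi>, \<tau>) $ i $ j / (2 * s)\<bar> \<le> (1 / \<kappa>) / (2 * s)"
      using divide_right_mono[OF matrix_inv_entry_le[OF \<kappa> M ell, of "(\<xi>, \<tau>)" i j], of "2 * s"] s
      by (simp add: abs_divide)
    ultimately have "\<bar>w $ i * w $ j / (4 * s\<^sup>2) - B (\<xi>, \<tau>) $ i $ j / (2 * s)\<bar>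
      \<le> (s * y / \<kappa>\<^sup>2) / (4 * s\<^sup>2) + (1 / \<kappa>) / (2 * s)" by linarith
    also have "\<dots> = 1 / (4 * \<kappa>\<^sup>2) * (1 / s) * y + 1 / (2 * \<kappa>) * (1 / s)"
      using s \<kappa> by (simp add: power2_eq_square)
    also have "\<dots> \<le> D * (1 / s) * (1 + y)"
    proof -
      have "1 / (4 * \<kappa>\<^sup>2) * (1 / s) * y \<le> 1 / (4 * \<kappa>\<^sup>2) * (1 / s) * (1 + y)"
        "1 / (2 * \<kappa>) * (1 / s) * 1 \<le> 1 / (2 * \<kappa>) * (1 / s) * (1 + y)"
        using s \<kappa> y by (intro mult_left_mono; simp)+
      moreover have "D * (1 / s) * (1 + y)
        = 1 / (4 * \<kappa>\<^sup>2) * (1 / s) * (1 + y) + 1 / (2 * \<kappa>) * (1 / s) * (1 + y)"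
        by (simp only: D_def distrib_right)
      ultimately show ?thesis by linarith
    qed
    finally show ?thesis .
  qed
  have 1: "\<bar>\<Sum>i\<in>UNIV. \<Sum>j\<in>UNIV. (a (x, t) $ i $ j - a (\<xi>, \<tau>) $ i $ j) *
      (w $ i * w $ j / (4 * s\<^sup>2) - B (\<xi>, \<tau>) $ i $ j / (2 * s))\<bar> \<le> n\<^sup>2 * N\<^sub>1 * D * ?E * (1 + y)\<^sup>2"
  proof -
    have D0: "0 \<le> D" using \<kappa> by (simp add: D_def)
    have "\<bar>(a (x, t) $ i $ j - a (\<xi>, \<tau>) $ i $ j) * (w $ i * w $ j / (4 * s\<^sup>2) - B (\<xi>, \<tau>) $ i $ j / (2 * s))\<bar>
      \<le> N\<^sub>1 * (s powr \<beta> * (1 + y)) * (D * (1 / s) * (1 + y))" for i j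
      unfolding abs_mult using y N\<^sub>1 by (intro mult_mono H S) auto
    also have "N\<^sub>1 * (s powr \<beta> * (1 + y)) * (D * (1 / s) * (1 + y))
        = N\<^sub>1 * D * (s powr \<beta> * (1 / s)) * (1 + y)\<^sup>2" by (simp add: power2_eq_square mult_ac)
    also have "\<dots> \<le> N\<^sub>1 * D * ?E * (1 + y)\<^sup>2"
      using D0 N\<^sub>1 by (intro mult_right_mono mult_left_mono E1) auto
    finally have "\<bar>\<Sum>i\<in>UNIV. \<Sum>j\<in>UNIV. (a (x, t) $ i $ j - a (\<xi>, \<tau>) $ i $ j) *
        (w $ i * w $ j / (4 * s\<^sup>2) - B (\<xi>, \<tau>) $ i $ j / (2 * s))\<bar>
      \<le> (\<Sum>i\<in>(UNIV::'n set). \<Sum>j\<in>(UNIV::'n set). N\<^sub>1 * D * ?E * (1 + y)\<^sup>2)"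
      by (intro order_trans[OF sum_abs] sum_mono)
    then show ?thesis by (simp add: n_def power2_eq_square mult_ac)
  qed
  have N: "norm v / s \<le> ?E * (1 + y)"
  proof -
    have "norm v = sqrt (s * y)" using vy by (metis norm_ge_zero real_sqrt_unique)
    also have "\<dots> = sqrt s * sqrt y" by (rule real_sqrt_mult)
    also have "sqrt y \<le> 1 + y" using y by (intro real_le_lsqrt) (auto simp: power2_eq_square algebra_simps)
    finally have "norm v / s \<le> sqrt s * (1 + y) / s" using s by (simp add: divide_right_mono mult_left_mono)
    also have "\<dots> = s powr (1 / 2 - 1) * (1 + y)"
      using s by (subst powr_diff) (simp add: powr_half_sqrt)
    also have "\<dots> = s powr (\<beta> - 1 + (1 / 2 - \<beta>)) * (1 + y)" by simp
    also have "\<dots> \<le> ?E * (1 + y)" using \<alpha> s y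
      by (intro mult_right_mono powr_le_powr_exp) auto
    finally show ?thesis .
  qed
  have 2: "\<bar>\<Sum>i\<in>UNIV. b (x, t) $ i * - (w $ i / (2 * s))\<bar> \<le> n * N\<^sub>2 / (2 * \<kappa>) * ?E * (1 + y)\<^sup>2"
  proof -
    have "\<bar>b (x, t) $ i * - (w $ i / (2 * s))\<bar> \<le> N\<^sub>2 * ((norm v / \<kappa>) / (2 * s))" for i
      unfolding abs_mult abs_minus_cancel abs_divide
      using s \<kappa> N\<^sub>2 admissible_lower_order(1)[OF adm] wle by (intro mult_mono frac_le) auto
    also have "N\<^sub>2 * ((norm v / \<kappa>) / (2 * s)) = N\<^sub>2 / (2 * \<kappa>) * (norm v / s)" by simp
    also have "\<dots> \<le> N\<^sub>2 / (2 * \<kappa>) * (?E * (1 + y))" using N\<^sub>2 \<kappa> by (intro mult_left_mono N) auto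
    also have "\<dots> \<le> N\<^sub>2 / (2 * \<kappa>) * (?E * (1 + y)\<^sup>2)" using N\<^sub>2 \<kappa> y
      by (intro mult_left_mono self_le_power) auto
    finally have "\<bar>\<Sum>i\<in>UNIV. b (x, t) $ i * - (w $ i / (2 * s))\<bar>
        \<le> (\<Sum>i\<in>(UNIV::'n set). N\<^sub>2 / (2 * \<kappa>) * (?E * (1 + y)\<^sup>2))"
      by (intro order_trans[OF sum_abs] sum_mono)
    then show ?thesis by (simp add: n_def mult_ac)
  qed
  have 3: "\<bar>q (x, t)\<bar> \<le> N\<^sub>2 * ?E * (1 + y)\<^sup>2"
  proof -
    have "\<bar>q (x, t)\<bar> \<le> N\<^sub>2 * (1 * 1)" using admissible_lower_order(2)[OF adm] by simp
    also have "\<dots> \<le> N\<^sub>2 * (?E * (1 + y)\<^sup>2)"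
      using powr_le_powr_exp[of "1 - \<beta>" s "\<beta> - 1"] \<alpha> s y N\<^sub>2
      by (intro mult_left_mono mult_mono one_le_power) auto
    finally show ?thesis by simp
  qed
  define P where "P = (\<Sum>i\<in>UNIV. \<Sum>j\<in>UNIV. (a (x, t) $ i $ j - a (\<xi>, \<tau>) $ i $ j) *
      (w $ i * w $ j / (4 * s\<^sup>2) - B (\<xi>, \<tau>) $ i $ j / (2 * s)))
    + (\<Sum>i\<in>UNIV. b (x, t) $ i * - (w $ i / (2 * s))) + q (x, t)"
  define K where "K = n\<^sup>2 * N\<^sub>1 * D + n * N\<^sub>2 / (2 * \<kappa>) + N\<^sub>2"
  have K0: "K \<ge> 0" unfolding K_def n_def D_def using N\<^sub>1 N\<^sub>2 \<kappa> by simp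
  have "\<bar>P\<bar> \<le> n\<^sup>2 * N\<^sub>1 * D * ?E * (1 + y)\<^sup>2 + n * N\<^sub>2 / (2 * \<kappa>) * ?E * (1 + y)\<^sup>2 + N\<^sub>2 * ?E * (1 + y)\<^sup>2"
    unfolding P_def using 1 2 3 by linarith
  also have "\<dots> = K * ?E * (1 + y)\<^sup>2" by (simp add: K_def algebra_simps)
  finally have P: "\<bar>P\<bar> \<le> K * ?E * (1 + y)\<^sup>2" .
  have "\<bar>frozen_defect a b q x t \<xi> \<tau>\<bar> = \<bar>P\<bar> * matrix_gauss (B (\<xi>, \<tau>)) v s"
    unfolding frozen_defect_def Let_def abs_mult P_def w_def v_def s_def
    by (simp add: abs_of_nonneg[OF matrix_gauss_nonneg])
  also have "\<dots> \<le> (K * ?E * (1 + y)\<^sup>2) * (exp (- y / (8 * M)) * gauss_kernel M v s)"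
    using P matrix_gauss_le_gauss_kernel[OF \<kappa> M ell s, of "(\<xi>, \<tau>)" v]
    by (intro mult_mono) (auto simp: y_def matrix_gauss_nonneg gauss_kernel_nonneg)
  also have "\<dots> = K * ?E * gauss_kernel M v s * ((1 + y)\<^sup>2 * exp (- y / (8 * M)))" by (simp add: mult_ac)
  also have "\<dots> \<le> K * ?E * gauss_kernel M v s * (1 + 16 * M)\<^sup>2"
    using K0 by (intro mult_left_mono one_plus_square_le_exp M y) (auto simp: gauss_kernel_nonneg)
  also have "\<dots> = C\<^sub>0 * s powr (\<beta> - 1) * exp s * gauss_kernel M v s"
    by (simp add: C\<^sub>0 defect_constant_def K_def D_def n_def mult_ac)
  finally show ?thesis by (simp add: v_def s_def)
qed

end

section \<open>The Gaussian bound for the fundamental solution\<close>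

text \<open>The singularity \<open>s\<^sup>\<beta>\<^sup>-\<^sup>1\<close> is the one of \<open>frozen_defect\<close>; the weight \<open>e\<^sup>\<mu>\<^sup>s\<close> is what makes the
  Volterra iteration contract.\<close>
definition iterate_majorant :: "real \<Rightarrow> real \<Rightarrow> real \<Rightarrow> real^'n \<Rightarrow> real \<Rightarrow> real"
  where "iterate_majorant \<beta> \<mu> M v s = s powr (\<beta> - 1) * exp (\<mu> * s) * gauss_kernel M v s"

lemma iterate_majorant_nonneg: "0 \<le> iterate_majorant \<beta> \<mu> M v s"
  by (simp add: iterate_majorant_def gauss_kernel_nonneg)

abbreviation iterated_nn_integral :: "real set \<Rightarrow> (real \<Rightarrow> 'a::euclidean_space \<Rightarrow> real) \<Rightarrow> ennreal"
  where "iterated_nn_integral S f \<equiv>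
    (\<integral>\<^sup>+\<sigma>. (\<integral>\<^sup>+\<eta>. ennreal (f \<sigma> \<eta>) \<partial>lborel) * indicator S \<sigma> \<partial>lborel)"

text \<open>A common form of the two space-time convolutions below: the spatial integral is the
  semigroup property, so that only the integral over the time weights remains.\<close>
lemma nn_integral_spacetime_convolution:
  fixes x \<xi> :: "real^'n"
  assumes M: "0 < M"
    and f: "\<And>p. 0 \<le> f p" and g: "\<And>p. 0 \<le> g p"
    and fg: "\<And>\<sigma>. \<sigma> \<in> {\<tau><..<t} \<Longrightarrow> f (t - \<sigma>) * g (\<sigma> - \<tau>) = h (t - \<sigma>)"
    and meas [measurable]: "h \<in> borel_measurable borel"
    and h: "(\<integral>\<^sup>+p. ennreal (h p) * indicator {0<..<t - \<tau>} p \<partial>lborel) \<le> ennreal c" and c: "0 \<le> c"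
  shows "iterated_nn_integral {\<tau><..<t} (\<lambda>\<sigma> \<eta>. f (t - \<sigma>) * gauss_kernel M (x - \<eta>) (t - \<sigma>) *
      (g (\<sigma> - \<tau>) * gauss_kernel M (\<eta> - \<xi>) (\<sigma> - \<tau>)))
    \<le> ennreal (c * gauss_mass TYPE('n) M * gauss_kernel M (x - \<xi>) (t - \<tau>))" (is "?L \<le> _")
proof -
  let ?G = "gauss_mass TYPE('n) M * gauss_kernel M (x - \<xi>) (t - \<tau>)"
  have inner: "(\<integral>\<^sup>+\<eta>. ennreal (f (t - \<sigma>) * gauss_kernel M (x - \<eta>) (t - \<sigma>) *
      (g (\<sigma> - \<tau>) * gauss_kernel M (\<eta> - \<xi>) (\<sigma> - \<tau>))) \<partial>lborel) = ennreal (h (t - \<sigma>)) * ennreal ?G"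
    if \<sigma>: "\<sigma> \<in> {\<tau><..<t}" for \<sigma>
  proof -
    have "(\<integral>\<^sup>+\<eta>. ennreal (f (t - \<sigma>) * gauss_kernel M (x - \<eta>) (t - \<sigma>) *
        (g (\<sigma> - \<tau>) * gauss_kernel M (\<eta> - \<xi>) (\<sigma> - \<tau>))) \<partial>lborel)
      = (\<integral>\<^sup>+\<eta>. ennreal (h (t - \<sigma>)) *
        ennreal (gauss_kernel M (x - \<eta>) (t - \<sigma>) * gauss_kernel M (\<eta> - \<xi>) (\<sigma> - \<tau>)) \<partial>lborel)"
      using f g unfolding fg[OF \<sigma>, symmetric]
      by (intro nn_integral_cong) (simp add: gauss_kernel_nonneg mult_ac flip: ennreal_mult)
    also have "\<dots> = ennreal (h (t - \<sigma>)) *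
      (\<integral>\<^sup>+\<eta>. ennreal (gauss_kernel M (x - \<eta>) (t - \<sigma>) * gauss_kernel M (\<eta> - \<xi>) (\<sigma> - \<tau>)) \<partial>lborel)"
      unfolding gauss_kernel_def by (rule nn_integral_cmult) measurable
    finally show ?thesis
      using nn_integral_gauss_kernel_convolution[OF M, of "t - \<sigma>" "\<sigma> - \<tau>" x \<xi>] \<sigma> by simp
  qed
  have "?L = (\<integral>\<^sup>+\<sigma>. ennreal ?G * (ennreal (h (t - \<sigma>)) * indicator {0<..<t - \<tau>} (t - \<sigma>)) \<partial>lborel)"
  proof (rule nn_integral_cong)
    fix \<sigma>
    show "(\<integral>\<^sup>+\<eta>. ennreal (f (t - \<sigma>) * gauss_kernel M (x - \<eta>) (t - \<sigma>) *
        (g (\<sigma> - \<tau>) * gauss_kernel M (\<eta> - \<xi>) (\<sigma> - \<tau>))) \<partial>lborel) * indicator {\<tau><..<t} \<sigma>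
      = ennreal ?G * (ennreal (h (t - \<sigma>)) * indicator {0<..<t - \<tau>} (t - \<sigma>))"
    proof (cases "\<sigma> \<in> {\<tau><..<t}")
      case True
      then show ?thesis unfolding inner[OF True] by (simp add: mult.commute)
    qed (auto split: split_indicator)
  qed
  also have "\<dots> = ennreal ?G * (\<integral>\<^sup>+\<sigma>. ennreal (h (t - \<sigma>)) * indicator {0<..<t - \<tau>} (t - \<sigma>) \<partial>lborel)"
    by (rule nn_integral_cmult) measurable
  also have "(\<integral>\<^sup>+\<sigma>. ennreal (h (t - \<sigma>)) * indicator {0<..<t - \<tau>} (t - \<sigma>) \<partial>lborel)
      = (\<integral>\<^sup>+p. ennreal (h p) * indicator {0<..<t - \<tau>} p \<partial>lborel)"
    by (rule nn_integral_reflect[where f="\<lambda>p. ennreal (h p) * indicator {0<..<t - \<tau>} p"]) measurable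
  also have "ennreal ?G * \<dots> \<le> ennreal ?G * ennreal c" by (intro mult_left_mono h) simp
  also have "\<dots> = ennreal (c * gauss_mass TYPE('n) M * gauss_kernel M (x - \<xi>) (t - \<tau>))"
    using c by (simp add: gauss_kernel_nonneg mult_ac flip: ennreal_mult)
  finally show ?thesis .
qed

lemma abs_lebesgue_integral_le:
  fixes f :: "'a \<Rightarrow> real"
  shows "ennreal \<bar>integral\<^sup>L N f\<bar> \<le> (\<integral>\<^sup>+x. ennreal \<bar>f x\<bar> \<partial>N)"
proof (cases "integrable N f")
  case True
  then show ?thesis using integral_norm_bound_ennreal[of N f] by simp
qed (simp add: not_integrable_integral_eq)

text \<open>A non-integrable integrand has integral zero, so that the bound holds for arbitrary \<open>f\<close>.\<close>
lemma abs_iterated_integral_le: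
  fixes f :: "real \<Rightarrow> 'a::euclidean_space \<Rightarrow> real"
  assumes "\<And>\<sigma> \<eta>. \<sigma> \<in> S \<Longrightarrow> \<bar>f \<sigma> \<eta>\<bar> \<le> g \<sigma> \<eta>"
    and "iterated_nn_integral S (\<lambda>\<sigma> \<eta>. g \<sigma> \<eta>) \<le> ennreal c" and "0 \<le> c"
  shows "\<bar>LBINT \<sigma>:S. LBINT \<eta>. f \<sigma> \<eta>\<bar> \<le> c"
proof -
  have "ennreal \<bar>LBINT \<sigma>:S. LBINT \<eta>. f \<sigma> \<eta>\<bar>
      \<le> (\<integral>\<^sup>+\<sigma>. ennreal \<bar>indicator S \<sigma> *\<^sub>R (LBINT \<eta>. f \<sigma> \<eta>)\<bar> \<partial>lborel)"
    unfolding set_lebesgue_integral_def by (rule abs_lebesgue_integral_le)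
  also have "\<dots> \<le> iterated_nn_integral S (\<lambda>\<sigma> \<eta>. g \<sigma> \<eta>)"
  proof (rule nn_integral_mono)
    fix \<sigma>
    have "ennreal \<bar>LBINT \<eta>. f \<sigma> \<eta>\<bar> \<le> (\<integral>\<^sup>+\<eta>. ennreal (g \<sigma> \<eta>) \<partial>lborel)" if "\<sigma> \<in> S"
      using assms(1)[OF that]
      by (intro order_trans[OF abs_lebesgue_integral_le] nn_integral_mono ennreal_leI)
    then show "ennreal \<bar>indicator S \<sigma> *\<^sub>R (LBINT \<eta>. f \<sigma> \<eta>)\<bar>
        \<le> (\<integral>\<^sup>+\<eta>. ennreal (g \<sigma> \<eta>) \<partial>lborel) * indicator S \<sigma>"
      by (auto split: split_indicator)
  qed
  also have "\<dots> \<le> ennreal c" by fact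
  finally show ?thesis using assms(3) by simp
qed

lemma abs_iterated_integral_le_scaled:
  fixes f :: "real \<Rightarrow> 'a::euclidean_space \<Rightarrow> real"
  assumes "\<And>\<sigma> \<eta>. \<sigma> \<in> S \<Longrightarrow> \<bar>f \<sigma> \<eta>\<bar> \<le> k * g \<sigma> \<eta>" and k: "0 < k"
    and "iterated_nn_integral S (\<lambda>\<sigma> \<eta>. g \<sigma> \<eta>) \<le> ennreal c" and "0 \<le> c"
  shows "\<bar>LBINT \<sigma>:S. LBINT \<eta>. f \<sigma> \<eta>\<bar> \<le> k * c"
proof -
  have "\<bar>f \<sigma> \<eta> / k\<bar> \<le> g \<sigma> \<eta>" if "\<sigma> \<in> S" for \<sigma> \<eta>
    using assms(1)[OF that, of \<eta>] k by (simp add: abs_divide divide_le_eq mult.commute)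
  from abs_iterated_integral_le[OF this assms(3,4)]
  have "\<bar>(LBINT \<sigma>:S. LBINT \<eta>. f \<sigma> \<eta>) / k\<bar> \<le> c" by simp
  then show ?thesis using k by (simp add: abs_divide divide_le_eq mult.commute)
qed

text \<open>The left hand side of the inequality is the contraction factor that \<open>volterra_contraction\<close>
  yields for \<open>\<Lambda> = \<mu> - 1\<close>: one exponential is used up by the factor \<open>e\<^sup>s\<close> in the majorant of the defect.\<close>
definition admissible_weight :: "'n itself \<Rightarrow> real \<Rightarrow> real \<Rightarrow> real \<Rightarrow> real \<Rightarrow> real \<Rightarrow> bool"
  where "admissible_weight _ M \<beta> C \<theta> \<mu> \<longleftrightarrow> 1 < \<mu> \<and>
    C * (4 * (1 / \<beta> + 1) * (\<mu> - 1) powr (- \<beta>)) * gauss_mass TYPE('n) M \<le> \<theta>"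

lemma admissible_weight_exists:
  assumes "0 < \<beta>" "0 < \<theta>"
  shows "\<exists>\<mu>. admissible_weight TYPE('n) M \<beta> C \<theta> \<mu>"
proof -
  define K where "K = C * (4 * (1 / \<beta> + 1)) * gauss_mass TYPE('n) M"
  have "((\<lambda>\<Lambda>::real. \<Lambda> powr (- \<beta>)) \<longlongrightarrow> 0) at_top"
    using assms by (intro tendsto_neg_powr filterlim_ident) auto
  from tendsto_mult_left[OF this, of K] have "((\<lambda>\<Lambda>. K * \<Lambda> powr (- \<beta>)) \<longlongrightarrow> 0) at_top" by simp
  then have "eventually (\<lambda>\<Lambda>. K * \<Lambda> powr (- \<beta>) < \<theta>) at_top"
    using assms by (simp add: order_tendsto_iff)
  then have "eventually (\<lambda>\<Lambda>. K * \<Lambda> powr (- \<beta>) < \<theta> \<and> 0 < \<Lambda>) at_top"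
    using eventually_gt_at_top[of 0] by eventually_elim auto
  then obtain \<Lambda> where "K * \<Lambda> powr (- \<beta>) < \<theta>" "0 < \<Lambda>"
    using eventually_happens'[OF trivial_limit_at_top_linorder] by blast
  then have "admissible_weight TYPE('n) M \<beta> C \<theta> (\<Lambda> + 1)"
    by (simp add: admissible_weight_def K_def mult_ac)
  then show ?thesis by blast
qed

text \<open>One step of the iteration: integrated in space, the two Gaussians give one, and the
  remaining time integral is that of \<open>volterra_contraction\<close>.\<close>
lemma nn_integral_defect_iterate:
  fixes x \<xi> :: "real^'n"
  assumes \<mu>: "admissible_weight TYPE('n) M \<beta> C \<theta> \<mu>" and M: "0 < M" and \<beta>: "0 < \<beta>" "\<beta> \<le> 1"
    and C: "0 \<le> C" and t: "\<tau> < t"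
  shows "iterated_nn_integral {\<tau><..<t} (\<lambda>\<sigma> \<eta>. C * (t - \<sigma>) powr (\<beta> - 1) * exp (t - \<sigma>) * gauss_kernel M (x - \<eta>) (t - \<sigma>)
      * iterate_majorant \<beta> \<mu> M (\<eta> - \<xi>) (\<sigma> - \<tau>))
    \<le> ennreal (\<theta> * iterate_majorant \<beta> \<mu> M (x - \<xi>) (t - \<tau>))"
proof -
  define s where "s = t - \<tau>"
  have s: "0 < s" using t by (simp add: s_def)
  have \<mu>1: "0 < \<mu> - 1" and \<theta>: "C * (4 * (1 / \<beta> + 1) * (\<mu> - 1) powr (- \<beta>)) * gauss_mass TYPE('n) M \<le> \<theta>"
    using \<mu> by (auto simp: admissible_weight_def)
  let ?c = "C * exp (\<mu> * s) * (4 * (1 / \<beta> + 1) * (\<mu> - 1) powr (- \<beta>) * s powr (\<beta> - 1))"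
  let ?h = "\<lambda>p. C * exp (\<mu> * s) * (p powr (\<beta> - 1) * (s - p) powr (\<beta> - 1) * exp (- (\<mu> - 1) * p))"
  have h: "(\<integral>\<^sup>+p. ennreal (?h p) * indicator {0<..<t - \<tau>} p \<partial>lborel) \<le> ennreal ?c"
  proof -
    have "(\<integral>\<^sup>+p. ennreal (?h p) * indicator {0<..<t - \<tau>} p \<partial>lborel)
      = (\<integral>\<^sup>+p. ennreal (C * exp (\<mu> * s)) *
        (ennreal (p powr (\<beta> - 1) * (s - p) powr (\<beta> - 1) * exp (- (\<mu> - 1) * p)) * indicator {0<..<s} p) \<partial>lborel)"
      using C by (intro nn_integral_cong) (simp add: ennreal_mult s_def mult_ac)
    also have "\<dots> = ennreal (C * exp (\<mu> * s)) * (\<integral>\<^sup>+p.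
        ennreal (p powr (\<beta> - 1) * (s - p) powr (\<beta> - 1) * exp (- (\<mu> - 1) * p)) * indicator {0<..<s} p \<partial>lborel)"
      by (rule nn_integral_cmult) measurable
    also have "\<dots> \<le> ennreal (C * exp (\<mu> * s)) * ennreal (4 * (1 / \<beta> + 1) * (\<mu> - 1) powr (- \<beta>) * s powr (\<beta> - 1))"
      by (intro mult_left_mono volterra_contraction \<beta> \<mu>1 s) auto
    also have "\<dots> = ennreal ?c" using C \<beta> by (simp flip: ennreal_mult)
    finally show ?thesis .
  qed
  have "iterated_nn_integral {\<tau><..<t} (\<lambda>\<sigma> \<eta>. C * (t - \<sigma>) powr (\<beta> - 1) * exp (t - \<sigma>) * gauss_kernel M (x - \<eta>) (t - \<sigma>)
      * iterate_majorant \<beta> \<mu> M (\<eta> - \<xi>) (\<sigma> - \<tau>))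
    \<le> ennreal (?c * gauss_mass TYPE('n) M * gauss_kernel M (x - \<xi>) (t - \<tau>))"
    unfolding iterate_majorant_def
  proof (rule nn_integral_spacetime_convolution[where h="?h" and c="?c"
        and f="\<lambda>p. C * p powr (\<beta> - 1) * exp p" and g="\<lambda>p. p powr (\<beta> - 1) * exp (\<mu> * p)"])
    fix \<sigma>
    have "exp (t - \<sigma>) * exp (\<mu> * (\<sigma> - \<tau>)) = exp (\<mu> * s) * exp (- (\<mu> - 1) * (t - \<sigma>))"
      by (simp add: s_def algebra_simps flip: exp_add)
    then show "C * (t - \<sigma>) powr (\<beta> - 1) * exp (t - \<sigma>) * ((\<sigma> - \<tau>) powr (\<beta> - 1) * exp (\<mu> * (\<sigma> - \<tau>))) = ?h (t - \<sigma>)"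
      by (simp add: s_def mult_ac) 
  qed (use C \<beta> M h in \<open>auto intro!: mult_nonneg_nonneg\<close>)
  also have "\<dots> \<le> ennreal (\<theta> * iterate_majorant \<beta> \<mu> M (x - \<xi>) (t - \<tau>))"
  proof (rule ennreal_leI)
    have "?c * gauss_mass TYPE('n) M * gauss_kernel M (x - \<xi>) (t - \<tau>)
      = C * (4 * (1 / \<beta> + 1) * (\<mu> - 1) powr (- \<beta>)) * gauss_mass TYPE('n) M *
        iterate_majorant \<beta> \<mu> M (x - \<xi>) (t - \<tau>)"
      by (simp add: iterate_majorant_def s_def mult_ac)
    also have "\<dots> \<le> \<theta> * iterate_majorant \<beta> \<mu> M (x - \<xi>) (t - \<tau>)"
      by (intro mult_right_mono \<theta> iterate_majorant_nonneg)
    finally show "?c * gauss_mass TYPE('n) M * gauss_kernel M (x - \<xi>) (t - \<tau>)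
      \<le> \<theta> * iterate_majorant \<beta> \<mu> M (x - \<xi>) (t - \<tau>)" .
  qed
  finally show ?thesis .
qed

lemma nn_integral_gauss_iterate:
  fixes x \<xi> :: "real^'n"
  assumes \<mu>: "0 \<le> \<mu>" and M: "0 < M" and \<beta>: "0 < \<beta>" "\<beta> \<le> 1" and t: "\<tau> < t"
  shows "iterated_nn_integral {\<tau><..<t} (\<lambda>\<sigma> \<eta>. gauss_kernel M (x - \<eta>) (t - \<sigma>)
      * iterate_majorant \<beta> \<mu> M (\<eta> - \<xi>) (\<sigma> - \<tau>))
    \<le> ennreal (gauss_mass TYPE('n) M / \<beta> * exp ((\<mu> + 1) * (t - \<tau>)) * gauss_kernel M (x - \<xi>) (t - \<tau>))"
proof -
  define s where "s = t - \<tau>"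
  have s: "0 < s" using t by (simp add: s_def)
  let ?h = "\<lambda>p. (s - p) powr (\<beta> - 1) * exp (\<mu> * (s - p))"
  let ?c = "exp (\<mu> * s) * (s powr \<beta> / \<beta>)"
  have h: "(\<integral>\<^sup>+p. ennreal (?h p) * indicator {0<..<t - \<tau>} p \<partial>lborel) \<le> ennreal ?c"
  proof -
    have "(\<integral>\<^sup>+p. ennreal (?h p) * indicator {0<..<t - \<tau>} p \<partial>lborel)
      \<le> (\<integral>\<^sup>+p. ennreal (exp (\<mu> * s)) * (ennreal ((s - p) powr (\<beta> - 1)) * indicator {0<..<s} (s - p)) \<partial>lborel)"
    proof (rule nn_integral_mono)
      fix p
      have "?h p \<le> exp (\<mu> * s) * (s - p) powr (\<beta> - 1)" if "0 < p"
        using that \<mu> by (subst mult.commute) (intro mult_right_mono, auto intro: mult_left_mono)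
      then show "ennreal (?h p) * indicator {0<..<t - \<tau>} p
        \<le> ennreal (exp (\<mu> * s)) * (ennreal ((s - p) powr (\<beta> - 1)) * indicator {0<..<s} (s - p))"
        by (auto simp: s_def split: split_indicator intro!: ennreal_leI simp flip: ennreal_mult)
    qed
    also have "\<dots> = ennreal (exp (\<mu> * s)) * (\<integral>\<^sup>+p. ennreal ((s - p) powr (\<beta> - 1)) * indicator {0<..<s} (s - p) \<partial>lborel)"
      by (rule nn_integral_cmult) measurable
    also have "(\<integral>\<^sup>+p. ennreal ((s - p) powr (\<beta> - 1)) * indicator {0<..<s} (s - p) \<partial>lborel)
      = (\<integral>\<^sup>+p. ennreal (p powr (\<beta> - 1)) * indicator {0<..<s} p \<partial>lborel)"
      by (rule nn_integral_reflect[where f="\<lambda>p. ennreal (p powr (\<beta> - 1)) * indicator {0<..<s} p"]) measurable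
    also have "ennreal (exp (\<mu> * s)) * \<dots> \<le> ennreal (exp (\<mu> * s)) * ennreal (s powr \<beta> / \<beta>)"
      using s \<beta> by (intro mult_left_mono nn_integral_powr) auto
    also have "\<dots> = ennreal ?c" using \<beta> by (simp flip: ennreal_mult)
    finally show ?thesis .
  qed
  have "iterated_nn_integral {\<tau><..<t} (\<lambda>\<sigma> \<eta>. 1 * gauss_kernel M (x - \<eta>) (t - \<sigma>)
      * iterate_majorant \<beta> \<mu> M (\<eta> - \<xi>) (\<sigma> - \<tau>))
    \<le> ennreal (?c * gauss_mass TYPE('n) M * gauss_kernel M (x - \<xi>) (t - \<tau>))"
    unfolding iterate_majorant_def
    by (rule nn_integral_spacetime_convolution[where h="?h" and c="?c"
        and f="\<lambda>p. 1" and g="\<lambda>p. p powr (\<beta> - 1) * exp (\<mu> * p)"])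
      (use \<beta> M h in \<open>auto simp: s_def\<close>)
  also have "\<dots> \<le> ennreal (gauss_mass TYPE('n) M / \<beta> * exp ((\<mu> + 1) * (t - \<tau>)) * gauss_kernel M (x - \<xi>) (t - \<tau>))"
  proof (intro ennreal_leI mult_right_mono gauss_kernel_nonneg)
    have "exp ((\<mu> + 1) * s) = exp (\<mu> * s) * exp s" by (simp add: distrib_right exp_add)
    have "s powr \<beta> \<le> exp s" using powr_le_powr_exp[of \<beta> s 0] \<beta> s by simp
    then have "?c \<le> exp (\<mu> * s) * (exp s / \<beta>)" using \<beta> by (intro mult_left_mono divide_right_mono) auto
    then have "?c * gauss_mass TYPE('n) M \<le> exp (\<mu> * s) * (exp s / \<beta>) * gauss_mass TYPE('n) M"
      by (rule mult_right_mono) simp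
    then show "?c * gauss_mass TYPE('n) M \<le> gauss_mass TYPE('n) M / \<beta> * exp ((\<mu> + 1) * (t - \<tau>))"
      unfolding s_def[symmetric] \<open>exp ((\<mu> + 1) * s) = exp (\<mu> * s) * exp s\<close> by (simp add: mult_ac)
  qed
  finally show ?thesis by simp
qed

text \<open>A function together with the derivatives that enter \<open>parabolic_op\<close>, at all times after \<open>\<tau>\<close>.
  Giving the derivatives explicitly makes the class stable under sums and under integration
  with respect to a parameter.\<close>
definition has_parabolic_derivatives ::
  "real \<Rightarrow> (real^'n \<Rightarrow> real \<Rightarrow> real) \<Rightarrow> ('n \<Rightarrow> real^'n \<Rightarrow> real \<Rightarrow> real) \<Rightarrow>
   ('n \<Rightarrow> 'n \<Rightarrow> real^'n \<Rightarrow> real \<Rightarrow> real) \<Rightarrow> (real^'n \<Rightarrow> real \<Rightarrow> real) \<Rightarrow> bool"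
  where "has_parabolic_derivatives \<tau> u D DD T \<longleftrightarrow> (\<forall>x t. \<tau> < t \<longrightarrow>
    (\<forall>i. ((\<lambda>r. u (x + r *\<^sub>R axis i 1) t) has_real_derivative D i x t) (at 0)) \<and>
    (\<forall>i j. ((\<lambda>r. D j (x + r *\<^sub>R axis i 1) t) has_real_derivative DD i j x t) (at 0)) \<and>
    (u x has_real_derivative T x t) (at t))"

lemma partialI:
  assumes "((\<lambda>r. f (x + r *\<^sub>R axis i 1)) has_real_derivative D) (at 0)"
  shows "partial i f x = D" "has_partial i f x"
  using assms DERIV_imp_deriv by (auto simp: partial_def has_partial_def real_differentiable_def)

lemma has_parabolic_derivatives_partials:
  assumes "has_parabolic_derivatives \<tau> u D DD T" "\<tau> < t"
  shows "partial i (\<lambda>y. u y t) = (\<lambda>x. D i x t)" "has_partial i (\<lambda>y. u y t) x"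
    "partial i (partial j (\<lambda>y. u y t)) x = DD i j x t" "has_partial i (partial j (\<lambda>y. u y t)) x"
    "deriv (u x) t = T x t" "u x differentiable (at t)"
proof -
  have 1: "((\<lambda>r. u (x + r *\<^sub>R axis i 1) t) has_real_derivative D i x t) (at 0)"
    and 2: "((\<lambda>r. D j (x + r *\<^sub>R axis i 1) t) has_real_derivative DD i j x t) (at 0)"
    and 3: "(u x has_real_derivative T x t) (at t)" for i j x
    using assms by (auto simp: has_parabolic_derivatives_def)
  show p: "partial i (\<lambda>y. u y t) = (\<lambda>x. D i x t)" for i
    using partialI[where f="\<lambda>y. u y t", OF 1] by auto
  show "has_partial i (\<lambda>y. u y t) x" using partialI[where f="\<lambda>y. u y t", OF 1] by auto
  show "partial i (partial j (\<lambda>y. u y t)) x = DD i j x t" "has_partial i (partial j (\<lambda>y. u y t)) x"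
    unfolding p using partialI[where f="\<lambda>y. D j y t", OF 2] by auto
  show "deriv (u x) t = T x t" "u x differentiable (at t)"
    using 3 DERIV_imp_deriv by (auto simp: real_differentiable_def)
qed

lemma parabolic_op_eq:
  assumes "has_parabolic_derivatives \<tau> u D DD T" "\<tau> < t"
  shows "parabolic_op a b q u x t = (\<Sum>i\<in>UNIV. \<Sum>j\<in>UNIV. a (x, t) $ i $ j * DD i j x t) +
    (\<Sum>i\<in>UNIV. b (x, t) $ i * D i x t) + q (x, t) * u x t - T x t"
  by (simp add: parabolic_op_def has_parabolic_derivatives_partials(3,5)[OF assms]
      fun_cong[OF has_parabolic_derivatives_partials(1)[OF assms]])

lemma has_parabolic_derivatives_cong:
  assumes "has_parabolic_derivatives \<tau> u D DD T" and eq: "\<And>x t. \<tau> < t \<Longrightarrow> u' x t = u x t"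
  shows "has_parabolic_derivatives \<tau> u' D DD T"
  unfolding has_parabolic_derivatives_def
proof (intro allI impI conjI)
  fix x t assume t: "\<tau> < t"
  show "((\<lambda>r. u' (x + r *\<^sub>R axis i 1) t) has_real_derivative D i x t) (at 0)" for i
    using assms(1) t by (auto simp: has_parabolic_derivatives_def eq)
  show "((\<lambda>r. D j (x + r *\<^sub>R axis i 1) t) has_real_derivative DD i j x t) (at 0)" for i j
    using assms(1) t by (auto simp: has_parabolic_derivatives_def)
  have "(u x has_real_derivative T x t) (at t)"
    using assms(1) t by (auto simp: has_parabolic_derivatives_def)
  then show "(u' x has_real_derivative T x t) (at t)"
    by (rule has_field_derivative_transform_within_open[where S="{\<tau><..}"]) (use t eq in auto)
qed

lemma has_parabolic_derivatives_cmult: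
  assumes "has_parabolic_derivatives \<tau> u D DD T"
  shows "has_parabolic_derivatives \<tau> (\<lambda>x t. c * u x t) (\<lambda>i x t. c * D i x t)
    (\<lambda>i j x t. c * DD i j x t) (\<lambda>x t. c * T x t)"
  using assms unfolding has_parabolic_derivatives_def by (auto intro!: DERIV_cmult)

abbreviation gauss_D :: "real^'n^'n \<Rightarrow> 'n \<Rightarrow> real^'n \<Rightarrow> real \<Rightarrow> real"
  where "gauss_D B i v s \<equiv> - ((B *v v) $ i / (2 * s)) * matrix_gauss B v s"

abbreviation gauss_DD :: "real^'n^'n \<Rightarrow> 'n \<Rightarrow> 'n \<Rightarrow> real^'n \<Rightarrow> real \<Rightarrow> real"
  where "gauss_DD B i j v s \<equiv>
    ((B *v v) $ i * (B *v v) $ j / (4 * s\<^sup>2) - B $ j $ i / (2 * s)) * matrix_gauss B v s"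

abbreviation gauss_T :: "real^'n^'n \<Rightarrow> real^'n \<Rightarrow> real \<Rightarrow> real"
  where "gauss_T B v s \<equiv>
    ((B *v v) \<bullet> v / (4 * s\<^sup>2) - real CARD('n) / (2 * s)) * matrix_gauss B v s"

lemma matrix_gauss_derivatives:
  fixes B :: "real^'n^'n"
  assumes sym: "\<And>x y. (B *v x) \<bullet> y = x \<bullet> (B *v y)"
  shows "has_parabolic_derivatives \<tau> (\<lambda>x t. matrix_gauss B (x - \<xi>) (t - \<tau>))
    (\<lambda>i x t. gauss_D B i (x - \<xi>) (t - \<tau>))
    (\<lambda>i j x t. gauss_DD B i j (x - \<xi>) (t - \<tau>))
    (\<lambda>x t. gauss_T B (x - \<xi>) (t - \<tau>))"
  unfolding has_parabolic_derivatives_def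
proof (intro allI impI conjI)
  fix x :: "real^'n" and t assume t: "\<tau> < t"
  have *: "x + r *\<^sub>R axis i 1 - \<xi> = x - \<xi> + r *\<^sub>R axis i 1" for r i by simp
  show "((\<lambda>r. matrix_gauss B (x + r *\<^sub>R axis i 1 - \<xi>) (t - \<tau>)) has_real_derivative
      gauss_D B i (x - \<xi>) (t - \<tau>)) (at 0)" for i
    unfolding * using t by (intro matrix_gauss_partial sym) auto
  show "((\<lambda>r. - ((B *v (x + r *\<^sub>R axis i 1 - \<xi>)) $ j / (2 * (t - \<tau>))) *
        matrix_gauss B (x + r *\<^sub>R axis i 1 - \<xi>) (t - \<tau>)) has_real_derivative
      gauss_DD B i j (x - \<xi>) (t - \<tau>)) (at 0)" for i j
    unfolding * using t by (intro matrix_gauss_partial2 sym) auto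
  show "((\<lambda>t. matrix_gauss B (x - \<xi>) (t - \<tau>)) has_real_derivative
      gauss_T B (x - \<xi>) (t - \<tau>)) (at t)"
  proof -
    have "0 < t - \<tau>" using t by simp
    moreover have "((\<lambda>t. t - \<tau>) has_real_derivative 1) (at t)"
      by (auto intro!: derivative_eq_intros)
    ultimately show ?thesis
      using DERIV_chain2[where g="\<lambda>t. t - \<tau>" and x=t and f="matrix_gauss B (x - \<xi>)" and Db=1,
        OF matrix_gauss_time_derivative] by simp
  qed
qed

definition parametrix_factor :: "real^'n^'n \<Rightarrow> real"
  where "parametrix_factor A = sqrt (det (matrix_inv A)) / (4 * pi) powr (real CARD('n) / 2)"

definition parametrix_constant :: "'n itself \<Rightarrow> real \<Rightarrow> real"
  where "parametrix_constant _ \<kappa> =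
    sqrt (fact CARD('n) * (1 / \<kappa>) ^ CARD('n)) / (4 * pi) powr (real CARD('n) / 2)"

lemma parametrix_eq_matrix_gauss:
  fixes x \<xi> :: "real^'n"
  assumes "\<tau> < t"
  shows "parametrix a x t \<xi> \<tau>
    = parametrix_factor (a (\<xi>, \<tau>)) * matrix_gauss (matrix_inv (a (\<xi>, \<tau>))) (x - \<xi>) (t - \<tau>)"
  unfolding parametrix_def parametrix_factor_def matrix_gauss_def
  using assms by (simp add: powr_mult powr_minus_divide)

context parabolic_coefficients
begin

lemma parametrix_factor_le: "\<bar>parametrix_factor (a z)\<bar> \<le> parametrix_constant TYPE('n) \<kappa>"
proof -
  have "\<bar>sqrt (det (B z))\<bar> = sqrt \<bar>det (B z)\<bar>"
    by (auto simp: abs_if real_sqrt_minus)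
  also have "\<dots> \<le> sqrt (fact CARD('n) * (1 / \<kappa>) ^ CARD('n))"
    using abs_det_matrix_inv_le[OF \<kappa> M ell, of z] by (rule real_sqrt_le_mono)
  finally have "\<bar>sqrt (det (B z))\<bar> \<le> sqrt (fact CARD('n) * (1 / \<kappa>) ^ CARD('n))" .
  then show ?thesis
    unfolding parametrix_factor_def parametrix_constant_def abs_divide by (simp add: divide_right_mono)
qed

lemma parametrix_constant_pos: "0 < parametrix_constant TYPE('n) \<kappa>"
  using \<kappa> by (simp add: parametrix_constant_def)

lemma parabolic_expression_matrix_gauss:
  assumes "\<tau> < t"
  shows "(\<Sum>i\<in>UNIV. \<Sum>j\<in>UNIV. a (x, t) $ i $ j * (gauss_DD (B (\<xi>, \<tau>)) i j (x - \<xi>) (t - \<tau>))) +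
    (\<Sum>i\<in>UNIV. b (x, t) $ i * (gauss_D (B (\<xi>, \<tau>)) i (x - \<xi>) (t - \<tau>))) +
    q (x, t) * matrix_gauss (B (\<xi>, \<tau>)) (x - \<xi>) (t - \<tau>) -
    gauss_T (B (\<xi>, \<tau>)) (x - \<xi>) (t - \<tau>)
    = frozen_defect a b q x t \<xi> \<tau>"
proof -
  define v s g where "v = x - \<xi>" and "s = t - \<tau>" and "g = matrix_gauss (B (\<xi>, \<tau>)) v s"
  let ?w = "B (\<xi>, \<tau>) *v v"
  let ?S = "\<lambda>i j. ?w $ i * ?w $ j / (4 * s\<^sup>2) - B (\<xi>, \<tau>) $ j $ i / (2 * s)"
  have sym: "?w $ i * ?w $ j / (4 * s\<^sup>2) - B (\<xi>, \<tau>) $ i $ j / (2 * s) = ?S i j" for i j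
    using matrix_inv_entry_symmetric[OF \<kappa> M ell, of "(\<xi>, \<tau>)" i j] by simp
  define P where "P = (\<Sum>i\<in>UNIV. \<Sum>j\<in>UNIV. a (x, t) $ i $ j * ?S i j)"
  define P' where "P' = (\<Sum>i\<in>UNIV. b (x, t) $ i * - (?w $ i / (2 * s)))"
  define P'' where "P'' = ?w \<bullet> v / (4 * s\<^sup>2) - real CARD('n) / (2 * s)"
  have 1: "(\<Sum>i\<in>UNIV. \<Sum>j\<in>UNIV. a (x, t) $ i $ j * (?S i j * g))
      = P * g"
    unfolding P_def by (simp add: sum_distrib_right mult.assoc)
  have 2: "(\<Sum>i\<in>UNIV. b (x, t) $ i * (- (?w $ i / (2 * s)) * g))
      = P' * g"
    unfolding P'_def by (simp only: sum_distrib_right mult.assoc)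
  have 3: "(\<Sum>i\<in>UNIV. \<Sum>j\<in>UNIV. (a (x, t) $ i $ j - a (\<xi>, \<tau>) $ i $ j) * ?S i j)
      = P - P''"
  proof -
    have "(\<Sum>i\<in>UNIV. \<Sum>j\<in>UNIV. a (\<xi>, \<tau>) $ i $ j * ?S i j) = P''"
      unfolding P''_def frozen_coefficients_cancel[OF \<kappa> M ell[of "(\<xi>, \<tau>)"], symmetric]
      by (intro sum.cong refl arg_cong2[where f="(*)"] sym[symmetric])
    then show ?thesis unfolding P_def by (simp only: left_diff_distrib sum_subtractf)
  qed
  have 4: "(\<Sum>i\<in>UNIV. \<Sum>j\<in>UNIV. (a (x, t) $ i $ j - a (\<xi>, \<tau>) $ i $ j) *
      (?w $ i * ?w $ j / (4 * s\<^sup>2) - B (\<xi>, \<tau>) $ i $ j / (2 * s))) = P - P''"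
    unfolding 3[symmetric] by (intro sum.cong refl arg_cong2[where f="(*)"] sym)
  show ?thesis
    unfolding frozen_defect_def Let_def v_def[symmetric] s_def[symmetric] g_def[symmetric] 1 2 4
      P'_def[symmetric] P''_def[symmetric]
    by (simp add: algebra_simps)
qed

lemma parabolic_op_parametrix:
  assumes "\<tau> < t"
  shows "parabolic_op a b q (\<lambda>y s. parametrix a y s \<xi> \<tau>) x t
    = parametrix_factor (a (\<xi>, \<tau>)) * frozen_defect a b q x t \<xi> \<tau>"
proof -
  note * = has_parabolic_derivatives_cong[where u'="\<lambda>x t. parametrix a x t \<xi> \<tau>", OF has_parabolic_derivatives_cmult[OF
      matrix_gauss_derivatives[OF B_symmetric, of \<tau> "(\<xi>, \<tau>)" \<xi>], of "parametrix_factor (a (\<xi>, \<tau>))"],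
      OF parametrix_eq_matrix_gauss]
  have comm: "p * (c * r) = c * (p * r)" for p c r :: real by simp
  show ?thesis
    using parabolic_op_eq[OF * assms, of a b q x]
    unfolding parabolic_expression_matrix_gauss[OF assms, symmetric]
      parametrix_eq_matrix_gauss[OF assms]
    by (simp only: comm[of _ "parametrix_factor (a (\<xi>, \<tau>))"] sum_distrib_left[symmetric]
        distrib_left right_diff_distrib)
qed

end

locale parametrix_iteration = parabolic_coefficients \<alpha> N\<^sub>1 N\<^sub>2 M \<kappa> C\<^sub>0 a b q
  for \<alpha> N\<^sub>1 N\<^sub>2 M \<kappa> C\<^sub>0 :: real and a :: "(real^'n) \<times> real \<Rightarrow> real^'n^'n"
    and b :: "(real^'n) \<times> real \<Rightarrow> real^'n" and q :: "(real^'n) \<times> real \<Rightarrow> real" +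
  fixes C\<^sub>1 \<mu> :: real
  assumes C\<^sub>1: "C\<^sub>1 = parametrix_constant TYPE('n) \<kappa> * C\<^sub>0"
    and \<mu>: "admissible_weight TYPE('n) M \<beta> C\<^sub>1 (1 / 2) \<mu>"
begin

lemma C\<^sub>1_pos: "0 < C\<^sub>1"
  unfolding C\<^sub>1 using parametrix_constant_pos C\<^sub>0_pos by simp

abbreviation K where "K \<equiv> iterate_majorant \<beta> \<mu> M"

lemma abs_parabolic_op_parametrix_le:
  assumes t: "\<tau> < t"
  shows "\<bar>parabolic_op a b q (\<lambda>y s. parametrix a y s \<xi> \<tau>) x t\<bar>
    \<le> C\<^sub>1 * (t - \<tau>) powr (\<beta> - 1) * exp (t - \<tau>) * gauss_kernel M (x - \<xi>) (t - \<tau>)"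
proof -
  have "\<bar>parabolic_op a b q (\<lambda>y s. parametrix a y s \<xi> \<tau>) x t\<bar>
    \<le> parametrix_constant TYPE('n) \<kappa> * (C\<^sub>0 * (t - \<tau>) powr (\<beta> - 1) * exp (t - \<tau>) * gauss_kernel M (x - \<xi>) (t - \<tau>))"
    unfolding parabolic_op_parametrix[OF t] abs_mult
    using parametrix_constant_pos
    by (intro mult_mono parametrix_factor_le abs_frozen_defect_le t) auto
  then show ?thesis by (simp add: C\<^sub>1 mult_ac)
qed

text \<open>By the choice of \<open>\<mu>\<close>, each step of the iteration gains a factor \<open>1 / 2\<close>, so that the series
  of the iterates is dominated by a geometric one.\<close>
lemma abs_parametrix_iterate_le:
  assumes "\<tau> < t"
  shows "\<bar>parametrix_iterate a b q l x t \<xi> \<tau>\<bar> \<le> (1 / 2) ^ l * C\<^sub>1 * K (x - \<xi>) (t - \<tau>)"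
  using assms
proof (induction l arbitrary: x t)
  case 0
  have "C\<^sub>1 * (t - \<tau>) powr (\<beta> - 1) * exp (t - \<tau>) * gauss_kernel M (x - \<xi>) (t - \<tau>)
      \<le> C\<^sub>1 * (t - \<tau>) powr (\<beta> - 1) * exp (\<mu> * (t - \<tau>)) * gauss_kernel M (x - \<xi>) (t - \<tau>)"
    using C\<^sub>1_pos \<mu> 0
    by (intro mult_right_mono mult_left_mono) (auto simp: gauss_kernel_nonneg admissible_weight_def)
  then show ?case
    using abs_parabolic_op_parametrix_le[OF 0, of \<xi> x] by (simp add: iterate_majorant_def mult_ac)
next
  case (Suc l)
  have "\<bar>parametrix_iterate a b q (Suc l) x t \<xi> \<tau>\<bar>
      \<le> ((1 / 2) ^ l * C\<^sub>1) * (1 / 2 * K (x - \<xi>) (t - \<tau>))"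
    unfolding parametrix_iterate.simps
  proof (rule abs_iterated_integral_le_scaled)
    show "iterated_nn_integral {\<tau><..<t} (\<lambda>\<sigma> \<eta>. C\<^sub>1 * (t - \<sigma>) powr (\<beta> - 1) * exp (t - \<sigma>) * gauss_kernel M (x - \<eta>) (t - \<sigma>)
      * K (\<eta> - \<xi>) (\<sigma> - \<tau>)) \<le> ennreal (1 / 2 * K (x - \<xi>) (t - \<tau>))"
      using \<alpha> C\<^sub>1_pos Suc.prems by (intro nn_integral_defect_iterate \<mu> M) auto
    fix \<sigma> \<eta> assume "\<sigma> \<in> {\<tau><..<t}"
    then have "\<bar>parabolic_op a b q (\<lambda>y s. parametrix a y s \<eta> \<sigma>) x t * parametrix_iterate a b q l \<eta> \<sigma> \<xi> \<tau>\<bar>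
      \<le> (C\<^sub>1 * (t - \<sigma>) powr (\<beta> - 1) * exp (t - \<sigma>) * gauss_kernel M (x - \<eta>) (t - \<sigma>))
        * ((1 / 2) ^ l * C\<^sub>1 * K (\<eta> - \<xi>) (\<sigma> - \<tau>))"
      unfolding abs_mult using C\<^sub>1_pos
      by (intro mult_mono abs_parabolic_op_parametrix_le Suc.IH) (auto simp: gauss_kernel_nonneg)
    then show "\<bar>parabolic_op a b q (\<lambda>y s. parametrix a y s \<eta> \<sigma>) x t * parametrix_iterate a b q l \<eta> \<sigma> \<xi> \<tau>\<bar>
      \<le> (1 / 2) ^ l * C\<^sub>1 * (C\<^sub>1 * (t - \<sigma>) powr (\<beta> - 1) * exp (t - \<sigma>) * gauss_kernel M (x - \<eta>) (t - \<sigma>)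
      * K (\<eta> - \<xi>) (\<sigma> - \<tau>))" by (simp only: mult_ac)
  qed (use C\<^sub>1_pos in \<open>auto simp: iterate_majorant_nonneg\<close>)
  then show ?case by (simp add: mult_ac)
qed

lemma abs_parametrix_density_le:
  assumes "\<tau> < t"
  shows "\<bar>parametrix_density a b q x t \<xi> \<tau>\<bar> \<le> 2 * C\<^sub>1 * K (x - \<xi>) (t - \<tau>)"
proof -
  let ?f = "\<lambda>l. parametrix_iterate a b q l x t \<xi> \<tau>" and ?k = "C\<^sub>1 * K (x - \<xi>) (t - \<tau>)"
  have g: "(\<lambda>l. (1 / 2) ^ l * ?k) sums (2 * ?k)"
    using sums_mult2[OF geometric_sums[of "1 / 2 :: real"], of ?k] by simp
  have le: "norm (?f l) \<le> (1 / 2) ^ l * ?k" for l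
    using abs_parametrix_iterate_le[OF assms, of l x \<xi>] by (simp add: mult.assoc)
  have s: "summable (\<lambda>l. norm (?f l))"
    by (rule summable_comparison_test[OF _ sums_summable[OF g]]) (use le in auto)
  have "norm (suminf ?f) \<le> (\<Sum>l. norm (?f l))" by (rule summable_norm[OF s])
  also have "\<dots> \<le> (\<Sum>l. (1 / 2) ^ l * ?k)" by (rule suminf_le[OF le s sums_summable[OF g]])
  also have "\<dots> = 2 * ?k" using g by (simp add: sums_iff)
  finally show ?thesis by (simp add: parametrix_density_def mult.assoc)
qed

text \<open>The correction term is bounded by the convolution of \<open>H\<close> with \<open>2 C\<^sub>1 K\<close>, in which the singularity
  of \<open>K\<close> is integrated.\<close>
lemma fundamental_solution_le:
  assumes t: "\<tau> < t"
  shows "fundamental_solution a b q x t \<xi> \<tau>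
    \<le> parametrix_constant TYPE('n) \<kappa> * (1 + 2 * C\<^sub>1 * (gauss_mass TYPE('n) M / \<beta>))
      * exp ((\<mu> + 1) * (t - \<tau>)) * gauss_kernel M (x - \<xi>) (t - \<tau>)"
proof -
  let ?c = "parametrix_constant TYPE('n) \<kappa>"
  let ?I = "gauss_mass TYPE('n) M / \<beta> * exp ((\<mu> + 1) * (t - \<tau>)) * gauss_kernel M (x - \<xi>) (t - \<tau>)"
  have \<mu>0: "0 \<le> \<mu>" using \<mu> by (simp add: admissible_weight_def)
  have Z: "\<bar>parametrix a x t \<eta> \<sigma>\<bar> \<le> ?c * gauss_kernel M (x - \<eta>) (t - \<sigma>)" if "\<sigma> < t" for \<eta> \<sigma>
    unfolding parametrix_eq_matrix_gauss[OF that] abs_mult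
    using that parametrix_constant_pos matrix_gauss_le_gauss_kernel'[OF \<kappa> M ell]
    by (intro mult_mono parametrix_factor_le) (auto simp: abs_of_nonneg[OF matrix_gauss_nonneg] matrix_gauss_nonneg)
  have "\<bar>LBINT \<sigma>:{\<tau><..<t}. LBINT \<eta>. parametrix a x t \<eta> \<sigma> * parametrix_density a b q \<eta> \<sigma> \<xi> \<tau>\<bar>
      \<le> (?c * (2 * C\<^sub>1)) * ?I"
  proof (rule abs_iterated_integral_le_scaled)
    show "iterated_nn_integral {\<tau><..<t} (\<lambda>\<sigma> \<eta>. gauss_kernel M (x - \<eta>) (t - \<sigma>) * K (\<eta> - \<xi>) (\<sigma> - \<tau>)) \<le> ennreal ?I"
      using \<alpha> by (intro nn_integral_gauss_iterate \<mu>0 M t) auto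
    fix \<sigma> \<eta> assume "\<sigma> \<in> {\<tau><..<t}"
    then have "\<bar>parametrix a x t \<eta> \<sigma> * parametrix_density a b q \<eta> \<sigma> \<xi> \<tau>\<bar>
      \<le> (?c * gauss_kernel M (x - \<eta>) (t - \<sigma>)) * (2 * C\<^sub>1 * K (\<eta> - \<xi>) (\<sigma> - \<tau>))"
      unfolding abs_mult using parametrix_constant_pos
      by (intro mult_mono Z abs_parametrix_density_le) (auto simp: gauss_kernel_nonneg)
    then show "\<bar>parametrix a x t \<eta> \<sigma> * parametrix_density a b q \<eta> \<sigma> \<xi> \<tau>\<bar>
      \<le> ?c * (2 * C\<^sub>1) * (gauss_kernel M (x - \<eta>) (t - \<sigma>) * K (\<eta> - \<xi>) (\<sigma> - \<tau>))"
      by (simp only: mult_ac)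
  qed (use C\<^sub>1_pos parametrix_constant_pos \<alpha> in \<open>auto simp: gauss_kernel_nonneg\<close>)
  moreover have "parametrix a x t \<xi> \<tau> \<le> ?c * (exp ((\<mu> + 1) * (t - \<tau>)) * gauss_kernel M (x - \<xi>) (t - \<tau>))"
  proof -
    have "1 \<le> exp ((\<mu> + 1) * (t - \<tau>))" using \<mu>0 t by simp
    from mult_right_mono[OF this gauss_kernel_nonneg[of M "x - \<xi>" "t - \<tau>"]]
    have "?c * gauss_kernel M (x - \<xi>) (t - \<tau>) \<le> ?c * (exp ((\<mu> + 1) * (t - \<tau>)) * gauss_kernel M (x - \<xi>) (t - \<tau>))"
      using parametrix_constant_pos by (intro mult_left_mono) auto
    then show ?thesis using Z[OF t, of \<xi>] by linarith
  qed
  ultimately have "fundamental_solution a b q x t \<xi> \<tau>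
      \<le> ?c * (exp ((\<mu> + 1) * (t - \<tau>)) * gauss_kernel M (x - \<xi>) (t - \<tau>)) + (?c * (2 * C\<^sub>1)) * ?I"
    unfolding fundamental_solution_def by linarith
  also have "\<dots> = ?c * (1 + 2 * C\<^sub>1 * (gauss_mass TYPE('n) M / \<beta>))
      * exp ((\<mu> + 1) * (t - \<tau>)) * gauss_kernel M (x - \<xi>) (t - \<tau>)"
    by (simp only: distrib_left distrib_right mult_1 mult_1_right mult_ac)
  finally show ?thesis .
qed

end

section \<open>Second-order conditions at a minimum\<close>

lemma has_partialD:
  assumes "has_partial i f x"
  shows "((\<lambda>s. f (x + s *\<^sub>R axis i 1)) has_real_derivative partial i f x) (at 0)"
  using assms unfolding has_partial_def partial_def
  by (metis DERIV_deriv_iff_real_differentiable)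

lemma has_partialD_shift:
  assumes "has_partial i f (p + r *\<^sub>R axis i 1)"
  shows "((\<lambda>s. f (p + s *\<^sub>R axis i 1)) has_real_derivative partial i f (p + r *\<^sub>R axis i 1)) (at r)"
  using has_partialD[OF assms] DERIV_shift[of "\<lambda>s. f (p + s *\<^sub>R axis i 1)" _ 0 r]
  by (simp add: algebra_simps scaleR_add_left)

lemma partial_local_cong:
  assumes U: "open U" "x \<in> U" and eq: "\<And>y. y \<in> U \<Longrightarrow> f y = g y"
  shows "partial i f x = partial i g x" "has_partial i f x \<longleftrightarrow> has_partial i g x"
proof -
  have "((\<lambda>s. x + s *\<^sub>R axis i 1) \<longlongrightarrow> x + 0 *\<^sub>R axis i 1) (nhds (0::real))"
    by (intro tendsto_intros filterlim_ident)
  then have "eventually (\<lambda>s::real. x + s *\<^sub>R axis i 1 \<in> U) (nhds 0)"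
    using U by (intro topological_tendstoD) auto
  then have ev: "eventually (\<lambda>s::real. f (x + s *\<^sub>R axis i 1) = g (x + s *\<^sub>R axis i 1)) (nhds 0)"
    by (rule eventually_mono) (use eq in auto)
  show "partial i f x = partial i g x"
    unfolding partial_def by (intro deriv_cong_ev ev refl)
  show "has_partial i f x \<longleftrightarrow> has_partial i g x"
    unfolding has_partial_def real_differentiable_def
    using DERIV_cong_ev[OF refl ev refl] by simp
qed

lemma partial_diff:
  assumes "has_partial i f x" "has_partial i g x"
  shows "partial i (\<lambda>y. f y - g y) x = partial i f x - partial i g x"
    and "has_partial i (\<lambda>y. f y - g y) x"
  using DERIV_diff[OF has_partialD[OF assms(1)] has_partialD[OF assms(2)]]
  by (auto simp: partial_def has_partial_def real_differentiable_def DERIV_imp_deriv)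

lemma axis_step_norm_le:
  fixes h :: "real^'n"
  assumes "k \<notin> S" "\<bar>r\<bar> \<le> \<bar>h $ k\<bar>"
  shows "norm ((\<chi> i. if i \<in> S then h $ i else 0) + r *\<^sub>R axis k 1) \<le> norm h"
  using assms by (intro norm_le_componentwise_cart) (auto simp: axis_def)

text \<open>The increment of \<open>f\<close> is split into increments along the axes, each controlled by the mean
  value theorem.\<close>
lemma has_derivative_continuous_partials:
  fixes f :: "real^'n \<Rightarrow> real"
  assumes \<Omega>: "open \<Omega>" "x \<in> \<Omega>" and part: "\<And>i y. y \<in> \<Omega> \<Longrightarrow> has_partial i f y"
    and cont: "\<And>i. continuous_on \<Omega> (partial i f)"
  shows "(f has_derivative (\<lambda>h. \<Sum>i\<in>UNIV. h $ i * partial i f x)) (at x)"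
  unfolding has_derivative_at_alt
proof (intro conjI allI impI)
  show "bounded_linear (\<lambda>h. \<Sum>i\<in>UNIV. h $ i * partial i f x)"
    by (intro bounded_linear_sum bounded_linear_mult_left[THEN bounded_linear_compose]
        bounded_linear_vec_nth)
  fix e :: real assume e: "0 < e"
  define e' where "e' = e / real CARD('n)"
  have e': "0 < e'" using e by (simp add: e'_def)
  have "\<exists>d>0. \<forall>y\<in>\<Omega>. dist y x < d \<longrightarrow> dist (partial i f y) (partial i f x) < e'" for i
    using cont[of i] \<Omega>(2) e' unfolding continuous_on_iff by blast
  then obtain d where d: "\<And>i. 0 < d i"
      "\<And>i y. y \<in> \<Omega> \<Longrightarrow> dist y x < d i \<Longrightarrow> dist (partial i f y) (partial i f x) < e'" by metis
  obtain d' where d': "0 < d'" "ball x d' \<subseteq> \<Omega>" using \<Omega> open_contains_ball by blast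
  define \<delta> where "\<delta> = min d' (Min (range d))"
  have "0 < \<delta>" using d(1) d' by (simp add: \<delta>_def)
  have close: "z \<in> \<Omega>" "\<bar>partial i f z - partial i f x\<bar> \<le> e'" if "norm (z - x) < \<delta>" for z i
  proof -
    have "dist z x < d'" "dist z x < d i" using that by (auto simp: \<delta>_def dist_norm)
    then show "z \<in> \<Omega>" using d' by (auto simp: dist_commute)
    then show "\<bar>partial i f z - partial i f x\<bar> \<le> e'"
      using d(2)[of z i] \<open>dist z x < d i\<close> by (simp add: dist_real_def)
  qed
  show "\<exists>d>0. \<forall>y. norm (y - x) < d \<longrightarrow>
      norm (f y - f x - (\<Sum>i\<in>UNIV. (y - x) $ i * partial i f x)) \<le> e * norm (y - x)"
  proof (intro exI[of _ \<delta>] conjI allI impI \<open>0 < \<delta>\<close>)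
    fix y assume y: "norm (y - x) < \<delta>"
    define h where "h = y - x"
    define p where "p S = x + (\<chi> i. if i \<in> S then h $ i else 0)" for S
    have "\<bar>f (p S) - f x - (\<Sum>i\<in>S. h $ i * partial i f x)\<bar> \<le> real (card S) * (e' * norm h)"
      if "finite S" for S :: "'n set"
      using that
    proof induction
      case empty
      have "p {} = x" by (simp add: p_def vec_eq_iff)
      then show ?case by simp
    next
      case (insert k S)
      let ?I = "{- \<bar>h $ k\<bar>..\<bar>h $ k\<bar>}"
      define \<psi> where "\<psi> r = f (p S + r *\<^sub>R axis k 1) - r * partial k f x" for r
      have near: "norm (p S + r *\<^sub>R axis k 1 - x) < \<delta>" if "r \<in> ?I" for r
        using axis_step_norm_le[OF insert.hyps(2), of r h] that y
        by (auto simp: p_def h_def add.assoc abs_le_iff)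
      have "norm (\<psi> (h $ k) - \<psi> 0) \<le> e' * norm (h $ k - 0)"
      proof (rule field_differentiable_bound[of ?I])
        fix r assume r: "r \<in> ?I"
        have "(\<psi> has_real_derivative partial k f (p S + r *\<^sub>R axis k 1) - 1 * partial k f x) (at r)"
          unfolding \<psi>_def
          by (intro DERIV_diff has_partialD_shift part close near r DERIV_cmult_right DERIV_ident)
        then show "(\<psi> has_real_derivative partial k f (p S + r *\<^sub>R axis k 1) - 1 * partial k f x) (at r within ?I)"
          by (rule has_field_derivative_at_within)
        show "norm (partial k f (p S + r *\<^sub>R axis k 1) - 1 * partial k f x) \<le> e'"
          using close(2)[OF near[OF r]] by simp
      qed auto
      also have "\<dots> \<le> e' * norm h" using e' component_le_norm_cart[of h k] by simp
      finally have "\<bar>f (p S + h $ k *\<^sub>R axis k 1) - f (p S) - h $ k * partial k f x\<bar> \<le> e' * norm h"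
        by (simp add: \<psi>_def algebra_simps)
      moreover have "p S + h $ k *\<^sub>R axis k 1 = p (insert k S)"
        using insert.hyps by (auto simp: p_def vec_eq_iff axis_def)
      ultimately show ?case using insert by (simp add: distrib_right)
    qed
    from this[of UNIV] have "\<bar>f (p UNIV) - f x - (\<Sum>i\<in>UNIV. h $ i * partial i f x)\<bar> \<le> e * norm h"
      by (simp add: e'_def)
    moreover have "p UNIV = y" by (simp add: p_def h_def vec_eq_iff)
    ultimately show "norm (f y - f x - (\<Sum>i\<in>UNIV. (y - x) $ i * partial i f x)) \<le> e * norm (y - x)"
      by (simp add: h_def)
  qed
qed

lemma second_derivative_nonneg_at_minimum:
  fixes g g' :: "real \<Rightarrow> real"
  assumes "0 < d" and g: "\<And>r. \<bar>r\<bar> < d \<Longrightarrow> (g has_real_derivative g' r) (at r)"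
    and g': "(g' has_real_derivative c) (at 0)" and min: "\<And>r. \<bar>r\<bar> < d \<Longrightarrow> g 0 \<le> g r"
  shows "g' 0 = 0" "0 \<le> c"
proof -
  show g0: "g' 0 = 0"
    by (rule DERIV_local_min[OF g \<open>0 < d\<close>]) (use assms in auto)
  show "0 \<le> c"
  proof (rule ccontr)
    assume "\<not> 0 \<le> c"
    then obtain e where e: "0 < e" "\<And>h. 0 < h \<Longrightarrow> h < e \<Longrightarrow> g' (0 + h) < g' 0"
      using DERIV_neg_dec_right[OF g'] by auto
    define r where "r = min d e / 2"
    have r: "0 < r" "r < d" "r < e" using \<open>0 < d\<close> e(1) by (auto simp: r_def)
    obtain z where "0 < z" "z < r" "g r - g 0 = (r - 0) * g' z"
      using MVT2[of 0 r g g'] g r by auto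
    then have "g r < g 0" using e(2)[of z] g0 r mult_pos_neg[of r "g' z"] by simp
    then show False using min[of r] r by simp
  qed
qed

text \<open>Along the line \<open>x + r \<eta>\<close>, the conditions at a minimum are those of one variable; the chain rule
  for the partial derivatives expresses them by gradient and Hessian.\<close>
lemma minimum_partials:
  fixes f :: "real^'n \<Rightarrow> real"
  assumes \<Omega>: "open \<Omega>" "x \<in> \<Omega>"
    and part: "\<And>i y. y \<in> \<Omega> \<Longrightarrow> has_partial i f y"
      "\<And>i. continuous_on \<Omega> (partial i f)"
      "\<And>i j y. y \<in> \<Omega> \<Longrightarrow> has_partial i (partial j f) y"
      "\<And>i j. continuous_on \<Omega> (partial i (partial j f))"
    and min: "\<And>y. y \<in> \<Omega> \<Longrightarrow> f x \<le> f y"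
  shows "partial i f x = 0"
    and "0 \<le> (\<Sum>i\<in>UNIV. \<Sum>j\<in>UNIV. partial i (partial j f) x * (\<eta> $ i * \<eta> $ j))"
proof -
  have main: "(\<Sum>j\<in>UNIV. \<eta> $ j * partial j f x) = 0 \<and>
      0 \<le> (\<Sum>j\<in>UNIV. \<eta> $ j * (\<Sum>i\<in>UNIV. \<eta> $ i * partial i (partial j f) x))" for \<eta>
  proof -
    obtain e where e: "0 < e" "ball x e \<subseteq> \<Omega>" using \<Omega> open_contains_ball by blast
    define d where "d = e / (norm \<eta> + 1)"
    have d: "0 < d" using e by (simp add: d_def add_nonneg_pos)
    have in\<Omega>: "x + r *\<^sub>R \<eta> \<in> \<Omega>" if "\<bar>r\<bar> < d" for r
    proof -
      have "\<bar>r\<bar> * norm \<eta> \<le> \<bar>r\<bar> * (norm \<eta> + 1)" by (simp add: mult_left_mono)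
      also have "\<dots> < e" using that by (simp add: d_def less_divide_eq add_nonneg_pos)
      finally show ?thesis using e by (auto simp: dist_norm)
    qed
    have line: "((\<lambda>r. F (x + r *\<^sub>R \<eta>)) has_real_derivative (\<Sum>i\<in>UNIV. \<eta> $ i * partial i F (x + r *\<^sub>R \<eta>))) (at r)"
      if "\<bar>r\<bar> < d" "\<And>i y. y \<in> \<Omega> \<Longrightarrow> has_partial i F y" "\<And>i. continuous_on \<Omega> (partial i F)" for F r
    proof -
      have "((\<lambda>r. x + r *\<^sub>R \<eta>) has_derivative (\<lambda>s. s *\<^sub>R \<eta>)) (at r)"
        by (auto intro!: derivative_eq_intros)
      from has_derivative_compose[OF this has_derivative_continuous_partials[OF \<Omega>(1) in\<Omega>[OF that(1)] that(2,3)]]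
      show ?thesis
        unfolding has_field_derivative_def
        by (rule has_derivative_eq_rhs) (auto simp: fun_eq_iff sum_distrib_left mult_ac)
    qed
    have "((\<lambda>r. \<Sum>j\<in>UNIV. \<eta> $ j * partial j f (x + r *\<^sub>R \<eta>)) has_real_derivative
        (\<Sum>j\<in>UNIV. \<eta> $ j * (\<Sum>i\<in>UNIV. \<eta> $ i * partial i (partial j f) (x + 0 *\<^sub>R \<eta>)))) (at 0)"
      using d by (intro DERIV_sum DERIV_cmult line part) auto
    note second = second_derivative_nonneg_at_minimum[OF d line[OF _ part(1,2)] this]
    have "f (x + 0 *\<^sub>R \<eta>) \<le> f (x + r *\<^sub>R \<eta>)" if "\<bar>r\<bar> < d" for r
      using min in\<Omega>[OF that] by simp
    from second[OF _ _ this] show ?thesis by simp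
  qed
  have "(\<Sum>j\<in>UNIV. axis i 1 $ j * partial j f x) = partial i f x"
    by (simp add: axis_def if_distrib[of "\<lambda>c. c * _"] sum.delta cong: if_cong)
  then show "partial i f x = 0" using main[of "axis i 1"] by simp
  have "(\<Sum>j\<in>UNIV. \<eta> $ j * (\<Sum>i\<in>UNIV. \<eta> $ i * partial i (partial j f) x))
      = (\<Sum>j\<in>UNIV. \<Sum>i\<in>UNIV. partial i (partial j f) x * (\<eta> $ i * \<eta> $ j))"
    by (simp add: sum_distrib_left mult_ac)
  also have "\<dots> = (\<Sum>i\<in>UNIV. \<Sum>j\<in>UNIV. partial i (partial j f) x * (\<eta> $ i * \<eta> $ j))"
    by (rule sum.swap)
  finally show "0 \<le> (\<Sum>i\<in>UNIV. \<Sum>j\<in>UNIV. partial i (partial j f) x * (\<eta> $ i * \<eta> $ j))"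
    using main[of \<eta>] by simp
qed

text \<open>Completing the square in one variable after the other writes \<open>A\<close> as a sum of matrices \<open>c c\<^sup>T\<close>, and
  \<open>H\<close> paired with \<open>c c\<^sup>T\<close> is a value of its quadratic form. The set \<open>S\<close> contains the variables that remain.\<close>
lemma trace_mult_nonneg:
  fixes A :: "real^'n^'n" and H :: "'n \<Rightarrow> 'n \<Rightarrow> real"
  assumes \<kappa>: "0 < \<kappa>"
    and H: "\<And>\<eta> :: real^'n. 0 \<le> (\<Sum>i\<in>UNIV. \<Sum>j\<in>UNIV. H i j * (\<eta> $ i * \<eta> $ j))"
    and "finite S" and "transpose A = A" and "\<And>i j. i \<notin> S \<Longrightarrow> A $ i $ j = 0"
    and "\<And>\<eta>. \<kappa> * (\<Sum>i\<in>S. (\<eta> $ i)\<^sup>2) \<le> (A *v \<eta>) \<bullet> \<eta>"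
  shows "0 \<le> (\<Sum>i\<in>UNIV. \<Sum>j\<in>UNIV. A $ i $ j * H i j)"
  using assms(3-6)
proof (induction S arbitrary: A)
  case empty
  then show ?case by simp
next
  case (insert k S)
  have sym: "A $ i $ j = A $ j $ i" for i j
    using insert.prems(1) by (metis transpose_def vec_lambda_beta)
  have sym': "(A *v x) \<bullet> y = x \<bullet> (A *v y)" for x y
    using insert.prems(1) by (metis dot_lmul_matrix vector_transpose_matrix)
  have "\<kappa> * (\<Sum>i\<in>insert k S. (axis k (1::real) $ i)\<^sup>2) \<le> A $ k $ k"
    using insert.prems(3)[of "axis k 1"]
    by (simp add: matrix_vector_mult_basis column_def inner_axis)
  moreover have "(\<Sum>i\<in>insert k S. (axis k (1::real) $ i)\<^sup>2) = 1"
    using insert.hyps by (auto simp: axis_def intro!: sum.neutral)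
  ultimately have Akk: "0 < A $ k $ k" using \<kappa> by simp
  define A' :: "real^'n^'n" where "A' = (\<chi> i j. A $ i $ j - A $ k $ i * A $ k $ j / A $ k $ k)"
  have "0 \<le> (\<Sum>i\<in>UNIV. \<Sum>j\<in>UNIV. A' $ i $ j * H i j)"
  proof (rule insert.IH)
    show "transpose A' = A'" by (simp add: A'_def transpose_def vec_eq_iff sym mult.commute)
    show "A' $ i $ j = 0" if "i \<notin> S" for i j
      using that insert.prems(2)[of i] sym[of k i] Akk by (cases "i = k") (auto simp: A'_def)
    fix \<eta> :: "real^'n"
    define s where "s = (A *v \<eta>) $ k / A $ k $ k"
    have "(A' *v \<eta>) $ i = (A *v \<eta>) $ i - A $ k $ i * s" for i
      by (simp add: A'_def s_def matrix_vector_mult_def left_diff_distrib right_diff_distrib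
          sum_subtractf sum_distrib_left sum_divide_distrib mult_ac)
    then have "(A' *v \<eta>) \<bullet> \<eta> = (A *v \<eta>) \<bullet> \<eta> - s * (A *v \<eta>) $ k"
      by (simp add: inner_vec_def left_diff_distrib right_diff_distrib sum_subtractf matrix_vector_mult_def
          sum_distrib_left mult_ac)
    also have "\<dots> = (A *v (\<eta> + (- s) *\<^sub>R axis k 1)) \<bullet> (\<eta> + (- s) *\<^sub>R axis k 1)"
      unfolding quadratic_form_line[OF sym'] using Akk by (simp add: s_def field_simps power2_eq_square)
    also have "\<dots> \<ge> \<kappa> * (\<Sum>i\<in>insert k S. ((\<eta> + (- s) *\<^sub>R axis k 1) $ i)\<^sup>2)"
      by (rule insert.prems(3))
    moreover have "(\<Sum>i\<in>insert k S. ((\<eta> + (- s) *\<^sub>R axis k 1) $ i)\<^sup>2) \<ge> (\<Sum>i\<in>S. (\<eta> $ i)\<^sup>2)"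
    proof -
      have "(\<Sum>i\<in>S. ((\<eta> + (- s) *\<^sub>R axis k 1) $ i)\<^sup>2) = (\<Sum>i\<in>S. (\<eta> $ i)\<^sup>2)"
        using insert.hyps by (intro sum.cong) (auto simp: axis_def)
      then show ?thesis using insert.hyps by simp
    qed
    then have "\<kappa> * (\<Sum>i\<in>S. (\<eta> $ i)\<^sup>2) \<le> \<kappa> * (\<Sum>i\<in>insert k S. ((\<eta> + (- s) *\<^sub>R axis k 1) $ i)\<^sup>2)"
      using \<kappa> by (intro mult_left_mono) auto
    ultimately show "\<kappa> * (\<Sum>i\<in>S. (\<eta> $ i)\<^sup>2) \<le> (A' *v \<eta>) \<bullet> \<eta>" by linarith
  qed
  moreover have "0 \<le> (\<Sum>i\<in>UNIV. \<Sum>j\<in>UNIV. H i j * ((A $ k) $ i * (A $ k) $ j))" by (rule H)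
  moreover have "(\<Sum>i\<in>UNIV. \<Sum>j\<in>UNIV. A $ i $ j * H i j) = (\<Sum>i\<in>UNIV. \<Sum>j\<in>UNIV. A' $ i $ j * H i j)
      + (\<Sum>i\<in>UNIV. \<Sum>j\<in>UNIV. H i j * ((A $ k) $ i * (A $ k) $ j)) / A $ k $ k"
    by (simp add: A'_def left_diff_distrib right_diff_distrib sum_subtractf sum_divide_distrib mult_ac)
  ultimately show ?case using Akk by simp
qed

section \<open>The minimum principle\<close>

lemma C_2_1_on_slice:
  assumes "C_2_1_on (\<Omega> \<times> I) u" "t \<in> I"
  shows "x \<in> \<Omega> \<Longrightarrow> has_partial i (\<lambda>y. u y t) x" "continuous_on \<Omega> (partial i (\<lambda>y. u y t))"
    "x \<in> \<Omega> \<Longrightarrow> has_partial i (partial j (\<lambda>y. u y t)) x"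
    "continuous_on \<Omega> (partial i (partial j (\<lambda>y. u y t)))"
    "x \<in> \<Omega> \<Longrightarrow> u x differentiable (at t)"
proof -
  have slice: "continuous_on \<Omega> (\<lambda>x. F x t)" if "continuous_on (\<Omega> \<times> I) (\<lambda>(x, t). F x t)" for F :: "_ \<Rightarrow> _ \<Rightarrow> real"
  proof -
    have "continuous_on \<Omega> (\<lambda>x. (x, t))" "(\<lambda>x. (x, t)) ` \<Omega> \<subseteq> \<Omega> \<times> I"
      using assms(2) by (auto intro!: continuous_intros)
    from continuous_on_compose2[OF that this] show ?thesis by simp
  qed
  show "continuous_on \<Omega> (partial i (\<lambda>y. u y t))" "continuous_on \<Omega> (partial i (partial j (\<lambda>y. u y t)))"
    using slice[of "\<lambda>x t. partial i (\<lambda>y. u y t) x"] slice[of "\<lambda>x t. partial i (partial j (\<lambda>y. u y t)) x"]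
      assms by (auto simp: C_2_1_on_def)
qed (use assms in \<open>auto simp: C_2_1_on_def\<close>)

text \<open>At a negative minimum of \<open>e\<^sup>-\<^sup>\<mu>\<^sup>t v\<close> with \<open>\<mu> > q\<close>, the first and second order conditions would
  give \<open>L v \<ge> (q - \<mu>) v > 0\<close>.\<close>
lemma parabolic_minimum_principle:
  fixes v :: "real^'n \<Rightarrow> real \<Rightarrow> real"
  assumes \<Omega>: "bounded \<Omega>" "open \<Omega>" and \<kappa>: "0 < \<kappa>" and ell: "\<And>z. elliptic \<kappa> M (a z)" and q: "\<And>z. q z \<le> N"
    and cont: "continuous_on (closure \<Omega> \<times> {\<tau>..T}) (\<lambda>(x, t). v x t)"
    and reg: "C_2_1_on (\<Omega> \<times> {\<tau><..}) v"
    and Lv: "\<And>x t. x \<in> \<Omega> \<Longrightarrow> \<tau> < t \<Longrightarrow> t \<le> T \<Longrightarrow> parabolic_op a b q v x t \<le> 0"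
    and bdry: "\<And>x t. x \<in> frontier \<Omega> \<Longrightarrow> \<tau> < t \<Longrightarrow> t \<le> T \<Longrightarrow> 0 \<le> v x t"
    and init: "\<And>x. x \<in> \<Omega> \<Longrightarrow> 0 \<le> v x \<tau>"
    and x: "x \<in> \<Omega>" and t: "\<tau> < t" "t \<le> T"
  shows "0 \<le> v x t"
proof (rule ccontr)
  assume neg: "\<not> 0 \<le> v x t"
  let ?S = "closure \<Omega> \<times> {\<tau>..T}"
  define \<mu> where "\<mu> = N + 1"
  define f where "f z = exp (- \<mu> * snd z) * (case z of (x, t) \<Rightarrow> v x t)" for z
  have S: "compact ?S" "(x, t) \<in> ?S"
    using \<Omega> x t closure_subset by (auto intro!: compact_Times)
  have "continuous_on ?S f"
    unfolding f_def by (intro continuous_intros cont)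
  then obtain z where "z \<in> ?S" and z: "\<And>y. y \<in> ?S \<Longrightarrow> f z \<le> f y"
    using continuous_attains_inf[OF S(1)] S(2) by blast
  then obtain x0 t0 where x0: "x0 \<in> closure \<Omega>" and t0: "\<tau> \<le> t0" "t0 \<le> T"
    and min: "\<And>y s. y \<in> closure \<Omega> \<Longrightarrow> \<tau> \<le> s \<Longrightarrow> s \<le> T \<Longrightarrow> exp (- \<mu> * t0) * v x0 t0 \<le> exp (- \<mu> * s) * v y s"
    by (cases z) (force simp: f_def)
  have "exp (- \<mu> * t0) * v x0 t0 \<le> exp (- \<mu> * t) * v x t"
    using S(2) t by (intro min) auto
  also have "\<dots> < 0" using neg by (simp add: mult_pos_neg)
  finally have v0: "v x0 t0 < 0" by (simp add: mult_less_0_iff)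
  have x0\<Omega>: "x0 \<in> \<Omega>"
  proof (rule ccontr)
    assume "x0 \<notin> \<Omega>"
    then have fr: "x0 \<in> frontier \<Omega>" using x0 \<Omega> by (simp add: frontier_def interior_open)
    have "continuous_on {\<tau>..T} (v x0)"
    proof -
      have "continuous_on {\<tau>..T} (\<lambda>t. (x0, t))" "(\<lambda>t. (x0, t)) ` {\<tau>..T} \<subseteq> ?S"
        using x0 by (auto intro!: continuous_intros)
      from continuous_on_compose2[OF cont this] show ?thesis by simp
    qed
    then obtain d where d: "0 < d" "\<And>s. s \<in> {\<tau>..T} \<Longrightarrow> dist s t0 < d \<Longrightarrow> dist (v x0 s) (v x0 t0) < - v x0 t0"
      using t0 v0 unfolding continuous_on_iff by (metis atLeastAtMost_iff neg_0_less_iff_less)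
    \<comment> \<open>The boundary values are prescribed after \<open>\<tau>\<close> only, so a minimum at the corner is first moved
      to a later time.\<close>
    define s where "s = (if \<tau> < t0 then t0 else min T (t0 + d / 2))"
    have "\<tau> < s" "s \<le> T" "dist s t0 < d" using t0 t d(1) by (auto simp: s_def dist_real_def)
    then have "v x0 s < 0" using d(2)[of s] by (simp add: dist_real_def)
    then show False using bdry[OF fr \<open>\<tau> < s\<close> \<open>s \<le> T\<close>] by simp
  qed
  have t0\<tau>: "\<tau> < t0" using init[OF x0\<Omega>] v0 t0 by (cases "t0 = \<tau>") auto
  then have t0I: "t0 \<in> {\<tau><..}" by simp
  have minx: "v x0 t0 \<le> v y t0" if "y \<in> \<Omega>" for y
    using min[of y t0] that closure_subset t0 by auto
  note slice = C_2_1_on_slice[OF reg t0I]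
  note grad = minimum_partials[OF \<Omega>(2) x0\<Omega>, of "\<lambda>y. v y t0", OF slice(1-4) minx]
  have "0 \<le> (\<Sum>i\<in>UNIV. \<Sum>j\<in>UNIV. a (x0, t0) $ i $ j * partial i (partial j (\<lambda>y. v y t0)) x0)"
    using grad(2) ell[of "(x0, t0)"]
    by (intro trace_mult_nonneg[OF \<kappa>, where S=UNIV])
       (auto simp: elliptic_def norm_vec_def L2_set_def sum_nonneg)
  moreover have "deriv (v x0) t0 \<le> \<mu> * v x0 t0"
  proof (rule ccontr)
    assume *: "\<not> deriv (v x0) t0 \<le> \<mu> * v x0 t0"
    have "(v x0 has_real_derivative deriv (v x0) t0) (at t0)"
      using slice(5)[OF x0\<Omega>] by (metis DERIV_deriv_iff_real_differentiable)
    then have "((\<lambda>s. exp (- \<mu> * s) * v x0 s) has_real_derivative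
        exp (- \<mu> * t0) * (deriv (v x0) t0 - \<mu> * v x0 t0)) (at t0)"
      by (auto intro!: derivative_eq_intros simp: algebra_simps)
    moreover have "0 < exp (- \<mu> * t0) * (deriv (v x0) t0 - \<mu> * v x0 t0)" using * by simp
    ultimately obtain d where d: "0 < d"
      "\<And>h. 0 < h \<Longrightarrow> h < d \<Longrightarrow> exp (- \<mu> * (t0 - h)) * v x0 (t0 - h) < exp (- \<mu> * t0) * v x0 t0"
      using DERIV_pos_inc_left by blast
    define h where "h = min (d / 2) (t0 - \<tau>)"
    have "0 < h" "h < d" "\<tau> \<le> t0 - h" "t0 - h \<le> T" using d(1) t0\<tau> t0 by (auto simp: h_def)
    then show False using d(2)[of h] min[OF x0, of "t0 - h"] by simp
  qed
  moreover have "q (x0, t0) * v x0 t0 > \<mu> * v x0 t0"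
    using q[of "(x0, t0)"] v0 by (simp add: \<mu>_def mult_less_cancel_right)
  ultimately have "0 < parabolic_op a b q v x0 t0"
    unfolding parabolic_op_def by (simp add: grad(1))
  then show False using Lv[OF x0\<Omega> t0\<tau> t0(2)] by simp
qed

lemma C_2_1_onD:
  assumes "C_2_1_on S u" "(x, t) \<in> S"
  shows "has_partial i (\<lambda>y. u y t) x" "has_partial i (partial j (\<lambda>y. u y t)) x"
    "u x differentiable (at t)"
  using assms unfolding C_2_1_on_def by fastforce+

lemma C_2_1_on_diff:
  fixes S :: "((real^'n) \<times> real) set"
  assumes S: "open S" and w: "C_2_1_on S w" and u: "C_2_1_on S u"
  shows "C_2_1_on S (\<lambda>x t. w x t - u x t)"
    and "(x, t) \<in> S \<Longrightarrow> parabolic_op a b q (\<lambda>x t. w x t - u x t) x t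
      = parabolic_op a b q w x t - parabolic_op a b q u x t"
proof -
  let ?v = "\<lambda>x t. w x t - u x t"
  have open_slice: "open {y. (y, t) \<in> S}" for t
  proof -
    have "continuous_on UNIV (\<lambda>y::real^'n. (y, t))" by (intro continuous_intros)
    from open_vimage[OF S this] show ?thesis by (simp add: vimage_def)
  qed
  have p1: "partial i (\<lambda>y. ?v y t) x = partial i (\<lambda>y. w y t) x - partial i (\<lambda>y. u y t) x"
      "has_partial i (\<lambda>y. ?v y t) x" if "(x, t) \<in> S" for i x t
    using that w u by (auto intro!: partial_diff C_2_1_onD[OF w] C_2_1_onD[OF u])
  have p2: "partial i (partial j (\<lambda>y. ?v y t)) x
      = partial i (partial j (\<lambda>y. w y t)) x - partial i (partial j (\<lambda>y. u y t)) x"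
      "has_partial i (partial j (\<lambda>y. ?v y t)) x" if "(x, t) \<in> S" for i j x t
  proof -
    have "partial j (\<lambda>y. ?v y t) y = partial j (\<lambda>y. w y t) y - partial j (\<lambda>y. u y t) y" if "y \<in> {y. (y, t) \<in> S}" for y
      using that by (simp add: p1)
    note loc = partial_local_cong[OF open_slice[of t] _ this]
    have "has_partial i (partial j (\<lambda>y. w y t)) x" "has_partial i (partial j (\<lambda>y. u y t)) x"
      using that w u by (auto intro!: C_2_1_onD)
    from partial_diff[OF this] show "partial i (partial j (\<lambda>y. ?v y t)) x
      = partial i (partial j (\<lambda>y. w y t)) x - partial i (partial j (\<lambda>y. u y t)) x"
      "has_partial i (partial j (\<lambda>y. ?v y t)) x"
      using loc[where x=x and i=i] that by auto
  qed
  have p3: "deriv (?v x) t = deriv (w x) t - deriv (u x) t" "?v x differentiable (at t)" if "(x, t) \<in> S" for x t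
  proof -
    have "w x differentiable (at t)" "u x differentiable (at t)" using that w u by (auto intro!: C_2_1_onD)
    then have "(?v x has_real_derivative deriv (w x) t - deriv (u x) t) (at t)"
      by (intro DERIV_diff) (auto simp: DERIV_deriv_iff_real_differentiable)
    then show "deriv (?v x) t = deriv (w x) t - deriv (u x) t" "?v x differentiable (at t)"
      by (auto simp: DERIV_imp_deriv real_differentiable_def)
  qed
  have cdiff: "continuous_on S (\<lambda>(x, t). F x t)"
    if "continuous_on S (\<lambda>(x, t). G x t)" "continuous_on S (\<lambda>(x, t). H x t)"
      "\<And>x t. (x, t) \<in> S \<Longrightarrow> F x t = G x t - H x t" for F G H :: "real^'n \<Rightarrow> real \<Rightarrow> real"
    using continuous_on_diff[OF that(1,2)]
    by (rule continuous_on_eq) (auto simp: that(3))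
  show "C_2_1_on S ?v"
    unfolding C_2_1_on_def
  proof (intro conjI allI ballI)
    show "continuous_on S (\<lambda>(x, t). ?v x t)"
      by (rule cdiff[of w u]) (use w u in \<open>auto simp: C_2_1_on_def\<close>)
    show "continuous_on S (\<lambda>(x, t). partial i (\<lambda>y. ?v y t) x)" for i
      by (rule cdiff[OF _ _ p1(1)]) (use w u in \<open>auto simp: C_2_1_on_def\<close>)
    show "continuous_on S (\<lambda>(x, t). partial i (partial j (\<lambda>y. ?v y t)) x)" for i j
      by (rule cdiff[OF _ _ p2(1)]) (use w u in \<open>auto simp: C_2_1_on_def\<close>)
    show "continuous_on S (\<lambda>(x, t). deriv (?v x) t)"
      by (rule cdiff[OF _ _ p3(1)]) (use w u in \<open>auto simp: C_2_1_on_def\<close>)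
  qed (use p1(2) p2(2) p3(2) in auto)
  show "parabolic_op a b q ?v x t = parabolic_op a b q w x t - parabolic_op a b q u x t" if "(x, t) \<in> S"
    by (simp add: parabolic_op_def p1(1)[OF that] p2(1)[OF that] p3(1)[OF that]
        right_diff_distrib sum_subtractf)
qed

section \<open>Integrals depending on a parameter\<close>

lemma C_2_1_onI:
  fixes u :: "real^'n \<Rightarrow> real \<Rightarrow> real"
  assumes der: "has_parabolic_derivatives \<tau> u D DD T"
    and "continuous_on (UNIV \<times> {\<tau><..}) (\<lambda>(x, t). u x t)"
    and "\<And>i. continuous_on (UNIV \<times> {\<tau><..}) (\<lambda>(x, t). D i x t)"
    and "\<And>i j. continuous_on (UNIV \<times> {\<tau><..}) (\<lambda>(x, t). DD i j x t)"
    and "continuous_on (UNIV \<times> {\<tau><..}) (\<lambda>(x, t). T x t)"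
  shows "C_2_1_on (UNIV \<times> {\<tau><..}) u"
proof -
  note p = has_parabolic_derivatives_partials[OF der]
  have tr: "continuous_on (UNIV \<times> {\<tau><..}) (\<lambda>(x, t). F x t)"
    if "continuous_on (UNIV \<times> {\<tau><..}) (\<lambda>(x, t). G x t)" "\<And>x t. \<tau> < t \<Longrightarrow> F x t = G x t"
    for F G :: "real^'n \<Rightarrow> real \<Rightarrow> real"
    using that(1) by (rule continuous_on_eq) (auto simp: that(2))
  show ?thesis
    unfolding C_2_1_on_def
  proof (intro conjI allI)
    show "continuous_on (UNIV \<times> {\<tau><..}) (\<lambda>(x, t). partial i (\<lambda>y. u y t) x)" for i
      by (rule tr[OF assms(3)[of i]]) (simp add: p(1))
    show "continuous_on (UNIV \<times> {\<tau><..}) (\<lambda>(x, t). partial i (partial j (\<lambda>y. u y t)) x)" for i j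
      by (rule tr[OF assms(4)[of i j]]) (simp add: p(3))
    show "continuous_on (UNIV \<times> {\<tau><..}) (\<lambda>(x, t). deriv (u x) t)"
      by (rule tr[OF assms(5)]) (simp add: p(5))
  qed (use assms(2) p(2,4,6) in auto)
qed

lemma C_2_1_on_subset: "C_2_1_on S u \<Longrightarrow> S' \<subseteq> S \<Longrightarrow> C_2_1_on S' u"
  unfolding C_2_1_on_def by (fast intro: continuous_on_subset)

text \<open>The same with continuity, so that the class is contained in \<open>C\<^sup>2\<^sup>,\<^sup>1\<close>.\<close>
definition smooth_parabolic ::
  "real \<Rightarrow> (real^'n \<Rightarrow> real \<Rightarrow> real) \<Rightarrow> ('n \<Rightarrow> real^'n \<Rightarrow> real \<Rightarrow> real) \<Rightarrow>
   ('n \<Rightarrow> 'n \<Rightarrow> real^'n \<Rightarrow> real \<Rightarrow> real) \<Rightarrow> (real^'n \<Rightarrow> real \<Rightarrow> real) \<Rightarrow> bool"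
  where "smooth_parabolic \<tau> u D DD T \<longleftrightarrow> has_parabolic_derivatives \<tau> u D DD T \<and>
    continuous_on (UNIV \<times> {\<tau><..}) (\<lambda>(x, t). u x t) \<and>
    (\<forall>i. continuous_on (UNIV \<times> {\<tau><..}) (\<lambda>(x, t). D i x t)) \<and>
    (\<forall>i j. continuous_on (UNIV \<times> {\<tau><..}) (\<lambda>(x, t). DD i j x t)) \<and>
    continuous_on (UNIV \<times> {\<tau><..}) (\<lambda>(x, t). T x t)"

lemma smooth_parabolic_C_2_1: "smooth_parabolic \<tau> u D DD T \<Longrightarrow> C_2_1_on (UNIV \<times> {\<tau><..}) u"
  unfolding smooth_parabolic_def by (intro C_2_1_onI) auto

lemma has_parabolic_derivatives_add:
  assumes "has_parabolic_derivatives \<tau> u D DD T" "has_parabolic_derivatives \<tau> u' D' DD' T'"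
  shows "has_parabolic_derivatives \<tau> (\<lambda>x t. u x t + u' x t) (\<lambda>i x t. D i x t + D' i x t)
    (\<lambda>i j x t. DD i j x t + DD' i j x t) (\<lambda>x t. T x t + T' x t)"
  using assms unfolding has_parabolic_derivatives_def by (auto intro!: DERIV_add)

lemma smooth_parabolic_add:
  assumes "smooth_parabolic \<tau> u D DD T" "smooth_parabolic \<tau> u' D' DD' T'"
  shows "smooth_parabolic \<tau> (\<lambda>x t. u x t + u' x t) (\<lambda>i x t. D i x t + D' i x t)
    (\<lambda>i j x t. DD i j x t + DD' i j x t) (\<lambda>x t. T x t + T' x t)"
  using assms unfolding smooth_parabolic_def case_prod_unfold
  by (auto intro!: has_parabolic_derivatives_add continuous_on_add)

lemma smooth_parabolic_cmult:
  assumes "smooth_parabolic \<tau> u D DD T"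
  shows "smooth_parabolic \<tau> (\<lambda>x t. c * u x t) (\<lambda>i x t. c * D i x t)
    (\<lambda>i j x t. c * DD i j x t) (\<lambda>x t. c * T x t)"
  using assms unfolding smooth_parabolic_def case_prod_unfold
  by (auto intro!: has_parabolic_derivatives_cmult continuous_on_mult_left)

lemma parabolic_op_add:
  assumes "smooth_parabolic \<tau> u D DD T" "smooth_parabolic \<tau> u' D' DD' T'" "\<tau> < t"
  shows "parabolic_op a b q (\<lambda>x t. u x t + u' x t) x t = parabolic_op a b q u x t + parabolic_op a b q u' x t"
proof -
  have d: "has_parabolic_derivatives \<tau> u D DD T" "has_parabolic_derivatives \<tau> u' D' DD' T'"
    using assms by (auto simp: smooth_parabolic_def)
  show ?thesis
    unfolding parabolic_op_eq[OF d(1) assms(3)] parabolic_op_eq[OF d(2) assms(3)]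
      parabolic_op_eq[OF has_parabolic_derivatives_add[OF d] assms(3)]
    by (simp add: distrib_left sum.distrib)
qed

lemma parabolic_op_cmult:
  assumes "smooth_parabolic \<tau> u D DD T" "\<tau> < t"
  shows "parabolic_op a b q (\<lambda>x t. c * u x t) x t = c * parabolic_op a b q u x t"
proof -
  have d: "has_parabolic_derivatives \<tau> u D DD T" using assms by (auto simp: smooth_parabolic_def)
  show ?thesis
    unfolding parabolic_op_eq[OF d assms(2)] parabolic_op_eq[OF has_parabolic_derivatives_cmult[OF d] assms(2)]
    by (simp add: right_diff_distrib distrib_left sum_distrib_left mult.left_commute)
qed

context
  fixes lo hi :: "'z::euclidean_space" and \<tau> :: real
begin

abbreviation param_continuous :: "(real^'n \<Rightarrow> real \<Rightarrow> 'z \<Rightarrow> real) \<Rightarrow> bool"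
  where "param_continuous k \<equiv> continuous_on ((UNIV \<times> {\<tau><..}) \<times> cbox lo hi) (\<lambda>((x, t), z). k x t z)"

lemma param_continuous_integral:
  assumes "param_continuous k"
  shows "continuous_on (UNIV \<times> {\<tau><..}) (\<lambda>(x, t). integral (cbox lo hi) (k x t))"
  using integral_continuous_on_param[of "UNIV \<times> {\<tau><..}" lo hi "\<lambda>p z. k (fst p) (snd p) z"] assms
  by (simp add: case_prod_unfold)

lemma param_continuous_compose:
  assumes "param_continuous k" and "continuous_on S g" "continuous_on S h"
    and "\<And>y. y \<in> S \<Longrightarrow> \<tau> < h y"
  shows "continuous_on (S \<times> cbox lo hi) (\<lambda>(y, z). k (g y) (h y) z)"
proof -
  have "continuous_on (S \<times> cbox lo hi) (\<lambda>p. ((g (fst p), h (fst p)), snd p))"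
    using assms(2,3)
    by (auto intro!: continuous_intros continuous_on_compose2[of S g] continuous_on_compose2[of S h])
  moreover have *: "(\<lambda>p. ((g (fst p), h (fst p)), snd p)) ` (S \<times> cbox lo hi) \<subseteq> (UNIV \<times> {\<tau><..}) \<times> cbox lo hi"
    using assms(4) by auto
  ultimately show ?thesis
    using continuous_on_compose2[OF assms(1) _ *] by (simp add: case_prod_unfold)
qed

lemma param_continuous_integrable:
  assumes "param_continuous k" and "\<tau> < t"
  shows "continuous_on (cbox lo hi) (k x t)" "k x t integrable_on cbox lo hi"
proof -
  have "continuous_on (cbox lo hi) (\<lambda>z. ((x, t), z))" "(\<lambda>z. ((x, t), z)) ` cbox lo hi \<subseteq> (UNIV \<times> {\<tau><..}) \<times> cbox lo hi"
    using assms(2) by (auto intro!: continuous_intros)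
  from continuous_on_compose2[OF assms(1) this] show c: "continuous_on (cbox lo hi) (k x t)" by simp
  then show "k x t integrable_on cbox lo hi" by (rule integrable_continuous)
qed

text \<open>Differentiation under the integral sign, one variable at a time; compactness of the box makes
  continuity of the derivatives sufficient.\<close>
lemma integral_has_parabolic_derivatives:
  fixes k T :: "real^'n \<Rightarrow> real \<Rightarrow> 'z \<Rightarrow> real"
  assumes der: "\<And>z. z \<in> cbox lo hi \<Longrightarrow> has_parabolic_derivatives \<tau> (\<lambda>x t. k x t z)
      (\<lambda>i x t. D i x t z) (\<lambda>i j x t. DD i j x t z) (\<lambda>x t. T x t z)"
    and k: "param_continuous k" and D: "\<And>i. param_continuous (D i)"
    and DD: "\<And>i j. param_continuous (DD i j)" and T: "param_continuous T"
  shows "has_parabolic_derivatives \<tau> (\<lambda>x t. integral (cbox lo hi) (k x t))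
    (\<lambda>i x t. integral (cbox lo hi) (D i x t)) (\<lambda>i j x t. integral (cbox lo hi) (DD i j x t))
    (\<lambda>x t. integral (cbox lo hi) (T x t))"
  unfolding has_parabolic_derivatives_def
proof (intro allI impI conjI)
  fix x :: "real^'n" and t assume t: "\<tau> < t"
  have line: "((\<lambda>r. integral (cbox lo hi) (F (x + r *\<^sub>R axis i 1) t)) has_real_derivative
      integral (cbox lo hi) (F' x t)) (at 0)"
    if F: "param_continuous F" and F': "param_continuous F'"
      and d: "\<And>x z. z \<in> cbox lo hi \<Longrightarrow>
        ((\<lambda>r. F (x + r *\<^sub>R axis i 1) t z) has_real_derivative F' x t z) (at 0)"
    for F F' and i
  proof -
    have "((\<lambda>r. integral (cbox lo hi) (F (x + r *\<^sub>R axis i 1) t)) has_real_derivative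
        integral (cbox lo hi) (F' (x + 0 *\<^sub>R axis i 1) t)) (at 0 within UNIV)"
    proof (rule leibniz_rule_field_derivative[where fx="\<lambda>r. F' (x + r *\<^sub>R axis i 1) t"])
      fix r z assume z: "z \<in> cbox lo hi"
      show "((\<lambda>r. F (x + r *\<^sub>R axis i 1) t z) has_real_derivative F' (x + r *\<^sub>R axis i 1) t z) (at r within UNIV)"
        using d[OF z, of "x + r *\<^sub>R axis i 1"] DERIV_shift[of "\<lambda>s. F (x + s *\<^sub>R axis i 1) t z" _ 0 r]
        by (simp add: algebra_simps scaleR_add_left)
    next
      show "F (x + r *\<^sub>R axis i 1) t integrable_on cbox lo hi" for r
        by (rule param_continuous_integrable[OF F t])
      show "continuous_on (UNIV \<times> cbox lo hi) (\<lambda>(r, z). F' (x + r *\<^sub>R axis i 1) t z)"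
        by (rule param_continuous_compose[OF F']) (use t in \<open>auto intro!: continuous_intros\<close>)
    qed auto
    then show ?thesis by simp
  qed
  show "((\<lambda>r. integral (cbox lo hi) (k (x + r *\<^sub>R axis i 1) t)) has_real_derivative
      integral (cbox lo hi) (D i x t)) (at 0)" for i
    using der t by (intro line k D) (auto simp: has_parabolic_derivatives_def)
  show "((\<lambda>r. integral (cbox lo hi) (D j (x + r *\<^sub>R axis i 1) t)) has_real_derivative
      integral (cbox lo hi) (DD i j x t)) (at 0)" for i j
    using der t by (intro line D DD) (auto simp: has_parabolic_derivatives_def)
  have "((\<lambda>s. integral (cbox lo hi) (k x s)) has_real_derivative integral (cbox lo hi) (T x t))
      (at t within {\<tau><..})"
  proof (rule leibniz_rule_field_derivative[where fx="\<lambda>s. T x s"])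
    fix s z assume "z \<in> cbox lo hi" "s \<in> {\<tau><..}"
    then have "((\<lambda>s. k x s z) has_real_derivative T x s z) (at s)"
      using der by (auto simp: has_parabolic_derivatives_def)
    then show "((\<lambda>s. k x s z) has_real_derivative T x s z) (at s within {\<tau><..})"
      by (rule has_field_derivative_at_within)
  next
    show "k x s integrable_on cbox lo hi" if "s \<in> {\<tau><..}" for s
      using that by (intro param_continuous_integrable[OF k]) auto
    show "continuous_on ({\<tau><..} \<times> cbox lo hi) (\<lambda>(s, z). T x s z)"
      by (rule param_continuous_compose[OF T]) (auto intro!: continuous_intros)
  qed (use t in auto)
  then show "((\<lambda>s. integral (cbox lo hi) (k x s)) has_real_derivative integral (cbox lo hi) (T x t)) (at t)"
    using t by (simp add: at_within_open[of t "{\<tau><..}"])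
qed

end

text \<open>Tonelli's theorem on a box in space-time.\<close>
lemma abs_integral_cbox_le_iterated:
  fixes F :: "'a::euclidean_space \<times> real \<Rightarrow> real"
  assumes cont: "continuous_on (cbox lo hi) F"
    and F: "\<And>\<eta> \<sigma>. (\<eta>, \<sigma>) \<in> cbox lo hi \<Longrightarrow> \<sigma> \<in> S \<Longrightarrow> \<bar>F (\<eta>, \<sigma>)\<bar> \<le> k * g \<sigma> \<eta>"
    and F0: "\<And>\<eta> \<sigma>. (\<eta>, \<sigma>) \<in> cbox lo hi \<Longrightarrow> \<sigma> \<notin> S \<Longrightarrow> F (\<eta>, \<sigma>) = 0"
    and k: "0 < k"
    and le: "iterated_nn_integral S (\<lambda>\<sigma> \<eta>. g \<sigma> \<eta>) \<le> ennreal c" and c: "0 \<le> c"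
  shows "\<bar>integral (cbox lo hi) F\<bar> \<le> k * c"
proof -
  let ?f = "\<lambda>z. indicator (cbox lo hi) z *\<^sub>R F z"
  have cont': "continuous_on (cbox lo hi) (\<lambda>z. F z / k)" using k by (intro continuous_intros cont) auto
  have meas: "(\<lambda>z. indicator (cbox lo hi) z *\<^sub>R (F z / k)) \<in> borel_measurable borel"
    by (rule borel_measurable_continuous_on_indicator[OF _ cont']) simp
  have "set_integrable lborel (cbox lo hi) (\<lambda>z. F z / k)"
    unfolding set_integrable_def by (rule borel_integrable_compact[OF compact_cbox cont'])
  from set_borel_integral_eq_integral(2)[OF this]
  have eq: "integral (cbox lo hi) F / k = (LINT z:cbox lo hi|lborel. F z / k)" by auto
  have "ennreal \<bar>integral (cbox lo hi) F / k\<bar> \<le> (\<integral>\<^sup>+z. ennreal \<bar>indicator (cbox lo hi) z *\<^sub>R (F z / k)\<bar> \<partial>lborel)"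
    unfolding eq set_lebesgue_integral_def by (rule abs_lebesgue_integral_le)
  also have "\<dots> = (\<integral>\<^sup>+\<sigma>. (\<integral>\<^sup>+\<eta>. ennreal \<bar>indicator (cbox lo hi) (\<eta>, \<sigma>) *\<^sub>R (F (\<eta>, \<sigma>) / k)\<bar> \<partial>lborel) \<partial>lborel)"
  proof -
    have "(\<lambda>z. ennreal \<bar>indicator (cbox lo hi) z *\<^sub>R (F z / k)\<bar>) \<in> borel_measurable (lborel \<Otimes>\<^sub>M lborel)"
      unfolding lborel_prod measurable_lborel1 using meas by measurable
    from lborel_pair.nn_integral_snd[OF this] show ?thesis by (simp only: lborel_prod)
  qed
  also have "\<dots> \<le> iterated_nn_integral S (\<lambda>\<sigma> \<eta>. g \<sigma> \<eta>)"
  proof (rule nn_integral_mono)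
    fix \<sigma>
    show "(\<integral>\<^sup>+\<eta>. ennreal \<bar>indicator (cbox lo hi) (\<eta>, \<sigma>) *\<^sub>R (F (\<eta>, \<sigma>) / k)\<bar> \<partial>lborel)
        \<le> (\<integral>\<^sup>+\<eta>. ennreal (g \<sigma> \<eta>) \<partial>lborel) * indicator S \<sigma>"
    proof (cases "\<sigma> \<in> S")
      case True
      have "ennreal \<bar>indicator (cbox lo hi) (\<eta>, \<sigma>) *\<^sub>R (F (\<eta>, \<sigma>) / k)\<bar> \<le> ennreal (g \<sigma> \<eta>)" for \<eta>
      proof (cases "(\<eta>, \<sigma>) \<in> cbox lo hi")
        case in_box: True
        then show ?thesis
          using F[OF in_box True] k by (intro ennreal_leI) (simp add: abs_divide divide_le_eq mult.commute)
      qed simp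
      then show ?thesis using True by (auto intro!: nn_integral_mono)
    next
      case False
      then have 0: "indicator (cbox lo hi) (\<eta>, \<sigma>) *\<^sub>R (F (\<eta>, \<sigma>) / k) = 0" for \<eta>
        using F0 by (auto split: split_indicator)
      show ?thesis unfolding 0 by simp
    qed
  qed
  also have "\<dots> \<le> ennreal c" by (rule le)
  finally show ?thesis using c k by (simp add: abs_divide divide_le_eq mult.commute)
qed

section \<open>A smooth temporal cutoff\<close>

text \<open>A continuously differentiable approximation of the indicator of \<open>{0<..}\<close> that vanishes
  up to \<open>h\<close> and approaches one.\<close>
definition cutoff :: "real \<Rightarrow> real \<Rightarrow> real"
  where "cutoff h s = (max 0 (s - h))\<^sup>2 / ((max 0 (s - h))\<^sup>2 + h\<^sup>2)"

definition cutoff_deriv :: "real \<Rightarrow> real \<Rightarrow> real"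
  where "cutoff_deriv h s = 2 * max 0 (s - h) * h\<^sup>2 / ((max 0 (s - h))\<^sup>2 + h\<^sup>2)\<^sup>2"

lemma cutoff_bounds: "0 \<le> cutoff h s" "cutoff h s \<le> 1" "s \<le> h \<Longrightarrow> cutoff h s = 0"
  "s \<le> h \<Longrightarrow> cutoff_deriv h s = 0" "0 \<le> cutoff_deriv h s"
proof -
  let ?p = "max 0 (s - h)"
  show "cutoff h s \<le> 1"
  proof (cases "?p\<^sup>2 + h\<^sup>2 = 0")
    case False
    then have "0 < ?p\<^sup>2 + h\<^sup>2" by (simp add: less_le)
    then show ?thesis by (simp add: cutoff_def)
  qed (simp add: cutoff_def)
qed (auto simp: cutoff_def cutoff_deriv_def intro!: divide_nonneg_nonneg)

lemma max_square_derivative: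
  "((\<lambda>s. (max 0 (s - h))\<^sup>2) has_real_derivative 2 * max 0 (s - h)) (at s)"
proof (cases s h rule: linorder_cases)
  case less
  have "((\<lambda>s. 0) has_real_derivative 0) (at s)" by simp
  then have "((\<lambda>s. (max 0 (s - h))\<^sup>2) has_real_derivative 0) (at s)"
    by (rule has_field_derivative_transform_within_open[where S="{..<h}"]) (use less in auto)
  then show ?thesis using less by simp
next
  case greater
  have "((\<lambda>s. (s - h)\<^sup>2) has_real_derivative 2 * (s - h)) (at s)"
    by (auto intro!: derivative_eq_intros)
  then have "((\<lambda>s. (max 0 (s - h))\<^sup>2) has_real_derivative 2 * (s - h)) (at s)"
    by (rule has_field_derivative_transform_within_open[where S="{h<..}"]) (use greater in auto)
  then show ?thesis using greater by simp
next
  case equal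
  have "((\<lambda>s. (max 0 (s - h))\<^sup>2) has_real_derivative 0) (at h)"
    unfolding CARAT_DERIV
  proof (intro exI[of _ "\<lambda>s. max 0 (s - h)"] conjI allI)
    show "isCont (\<lambda>s. max 0 (s - h)) h" by (intro continuous_intros)
  qed (auto simp: max_def power2_eq_square)
  then show ?thesis using equal by simp
qed

lemma cutoff_has_derivative:
  assumes "0 < h"
  shows "(cutoff h has_real_derivative cutoff_deriv h s) (at s)"
proof -
  have "0 < (max 0 (s - h))\<^sup>2 + h\<^sup>2" using assms by (intro add_nonneg_pos) auto
  then have "(max 0 (s - h))\<^sup>2 + h\<^sup>2 \<noteq> 0" using assms by simp
  from DERIV_divide[OF max_square_derivative[of h s] DERIV_add[OF max_square_derivative[of h s] DERIV_const] this]
  show ?thesis unfolding cutoff_def cutoff_deriv_def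
    by (rule DERIV_cong) (simp add: power2_eq_square algebra_simps)
qed

lemma cutoff_continuous:
  assumes "0 < h" "continuous_on S f"
  shows "continuous_on S (\<lambda>x. cutoff h (f x))" "continuous_on S (\<lambda>x. cutoff_deriv h (f x))"
proof -
  have "0 < (max 0 (s - h))\<^sup>2 + h\<^sup>2" for s using assms(1) by (intro add_nonneg_pos) auto
  then have "(max 0 (s - h))\<^sup>2 + h\<^sup>2 \<noteq> 0" for s using assms(1) by simp
  then show "continuous_on S (\<lambda>x. cutoff h (f x))" "continuous_on S (\<lambda>x. cutoff_deriv h (f x))"
    unfolding cutoff_def cutoff_deriv_def using assms(2) by (auto intro!: continuous_intros)
qed

lemma cutoff_deriv_ge:
  assumes h: "0 < h" and s: "3 / 2 * h \<le> s" "s \<le> 2 * h"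
  shows "1 / (4 * h) \<le> cutoff_deriv h s"
proof -
  define p where "p = max 0 (s - h)"
  have p: "h / 2 \<le> p" "p \<le> h" using s h by (auto simp: p_def)
  have "0 < p\<^sup>2 + h\<^sup>2" using h by (simp add: add_nonneg_pos)
  have "p\<^sup>2 \<le> h\<^sup>2" using p h by (intro power_mono) auto
  then have "(p\<^sup>2 + h\<^sup>2)\<^sup>2 \<le> (2 * h\<^sup>2)\<^sup>2" by (intro power_mono) auto
  have "1 / (4 * h) = h * h\<^sup>2 / (2 * h\<^sup>2)\<^sup>2" using h by (simp add: power2_eq_square)
  also have "\<dots> \<le> 2 * p * h\<^sup>2 / (p\<^sup>2 + h\<^sup>2)\<^sup>2"
    using p h \<open>(p\<^sup>2 + h\<^sup>2)\<^sup>2 \<le> (2 * h\<^sup>2)\<^sup>2\<close> \<open>0 < p\<^sup>2 + h\<^sup>2\<close> by (intro frac_le mult_right_mono) auto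
  finally show ?thesis by (simp add: cutoff_deriv_def p_def)
qed

lemma DERIV_mult_zero:
  fixes c U :: "real \<Rightarrow> real"
  assumes "(c has_real_derivative 0) (at t)" "c t = 0" "isCont U t"
  shows "((\<lambda>s. c s * U s) has_real_derivative 0) (at t)"
proof -
  obtain g where "\<And>z. c z - c t = g z * (z - t)" "isCont g t" "g t = 0"
    using assms(1) unfolding CARAT_DERIV by auto
  then show ?thesis
    unfolding CARAT_DERIV using assms(2,3)
    by (intro exI[of _ "\<lambda>z. g z * U z"]) (auto intro!: continuous_intros simp: mult_ac)
qed

text \<open>A singularity at \<open>\<sigma>\<close> is removed by the cutoff; freezing the time at \<open>\<sigma> + h\<close> where the
  cutoff vanishes gives formulas that are valid at all times.\<close>
lemma cutoff_parabolic_derivatives: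
  assumes der: "has_parabolic_derivatives \<sigma> u D DD T" and h: "0 < h"
  defines "m \<equiv> \<lambda>t. max t (\<sigma> + h)" and "c \<equiv> \<lambda>t. cutoff h (t - \<sigma>)"
  shows "has_parabolic_derivatives \<tau> (\<lambda>x t. c t * u x (m t)) (\<lambda>i x t. c t * D i x (m t))
    (\<lambda>i j x t. c t * DD i j x (m t)) (\<lambda>x t. c t * T x (m t) + cutoff_deriv h (t - \<sigma>) * u x (m t))"
  unfolding has_parabolic_derivatives_def
proof (intro allI impI conjI)
  fix x t
  have m: "\<sigma> < m t" using h by (simp add: m_def)
  show "((\<lambda>r. c t * u (x + r *\<^sub>R axis i 1) (m t)) has_real_derivative c t * D i x (m t)) (at 0)" for i
    using der m by (intro DERIV_cmult) (auto simp: has_parabolic_derivatives_def)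
  show "((\<lambda>r. c t * D j (x + r *\<^sub>R axis i 1) (m t)) has_real_derivative c t * DD i j x (m t)) (at 0)" for i j
    using der m by (intro DERIV_cmult) (auto simp: has_parabolic_derivatives_def)
  have u: "(u x has_real_derivative T x s) (at s)" if "\<sigma> < s" for s
    using der that by (auto simp: has_parabolic_derivatives_def)
  have c: "(c has_real_derivative cutoff_deriv h (t - \<sigma>)) (at t)"
  proof -
    have "((\<lambda>t. t - \<sigma>) has_real_derivative 1) (at t)" by (auto intro!: derivative_eq_intros)
    from DERIV_chain2[where f="cutoff h" and g="\<lambda>t. t - \<sigma>" and x=t, OF cutoff_has_derivative[OF h] this]
    show ?thesis by (simp add: c_def)
  qed
  show "((\<lambda>t. c t * u x (m t)) has_real_derivative
      c t * T x (m t) + cutoff_deriv h (t - \<sigma>) * u x (m t)) (at t)"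
  proof (cases "\<sigma> + h < t")
    case True
    have "((\<lambda>t. c t * u x t) has_real_derivative c t * T x t + cutoff_deriv h (t - \<sigma>) * u x t) (at t)"
      using DERIV_mult[OF c u[of t]] True h by (simp add: add.commute mult.commute)
    then have "((\<lambda>t. c t * u x (m t)) has_real_derivative c t * T x t + cutoff_deriv h (t - \<sigma>) * u x t) (at t)"
      by (rule has_field_derivative_transform_within_open[where S="{\<sigma> + h<..}"])
         (use True in \<open>auto simp: m_def max_def\<close>)
    then show ?thesis using True by (simp add: m_def)
  next
    case False
    then have 0: "c t = 0" "cutoff_deriv h (t - \<sigma>) = 0" by (auto simp: c_def cutoff_bounds)
    have "isCont (u x) (m t)" by (rule DERIV_isCont[OF u[OF m]])
    then have "isCont (\<lambda>t. u x (m t)) t"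
      by (intro isCont_o2[where g="u x" and f=m]) (auto simp: m_def intro!: continuous_intros)
    then have "((\<lambda>t. c t * u x (m t)) has_real_derivative 0) (at t)"
      using c by (intro DERIV_mult_zero) (simp_all add: 0)
    then show ?thesis by (simp add: 0)
  qed
qed

lemma cutoff_parabolic_derivatives_scaled:
  assumes "has_parabolic_derivatives \<sigma> u D DD T" "0 < h"
  shows "has_parabolic_derivatives \<tau> (\<lambda>x t. r * cutoff h (t - \<sigma>) * u x (max t (\<sigma> + h)))
    (\<lambda>i x t. r * cutoff h (t - \<sigma>) * D i x (max t (\<sigma> + h)))
    (\<lambda>i j x t. r * cutoff h (t - \<sigma>) * DD i j x (max t (\<sigma> + h)))
    (\<lambda>x t. r * cutoff h (t - \<sigma>) * T x (max t (\<sigma> + h))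
      + r * cutoff_deriv h (t - \<sigma>) * u x (max t (\<sigma> + h)))"
  using has_parabolic_derivatives_cmult[OF cutoff_parabolic_derivatives[OF assms], of \<tau> r]
  by (simp add: distrib_left mult.assoc)

section \<open>Supersolutions with a Gaussian bound\<close>

lemma continuous_on_matrix_vector_mult:
  fixes A :: "'a::topological_space \<Rightarrow> real^'n^'m"
  assumes "continuous_on S A" "continuous_on S v"
  shows "continuous_on S (\<lambda>p. A p *v v p)"
  unfolding matrix_vector_mult_def using assms by (intro continuous_intros)

lemma continuous_on_matrix_gauss:
  assumes "continuous_on S A" "continuous_on S v" "continuous_on S s" "\<And>p. p \<in> S \<Longrightarrow> 0 < s p"
  shows "continuous_on S (\<lambda>p. matrix_gauss (A p) (v p) (s p))"
proof -
  have "s p \<noteq> 0" if "p \<in> S" for p using assms(4)[OF that] by simp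
  then show ?thesis unfolding matrix_gauss_def using assms(1-3)
    by (intro continuous_intros continuous_on_matrix_vector_mult) auto
qed

lemma continuous_on_iterate_majorant:
  assumes "0 < M" "continuous_on S v" "continuous_on S s" "\<And>p. p \<in> S \<Longrightarrow> 0 < s p"
  shows "continuous_on S (\<lambda>p. iterate_majorant \<beta> \<mu> M (v p) (s p))"
proof -
  have "s p \<noteq> 0" if "p \<in> S" for p using assms(4)[OF that] by simp
  then show ?thesis unfolding iterate_majorant_def gauss_kernel_def using assms(1-3)
    by (intro continuous_intros) auto
qed

lemma integral_linear_combination:
  fixes f :: "'n::finite \<Rightarrow> 'n \<Rightarrow> 'z::euclidean_space \<Rightarrow> real" and g :: "'n \<Rightarrow> 'z \<Rightarrow> real"
  assumes "\<And>i j. f i j integrable_on S" "\<And>i. g i integrable_on S" "k integrable_on S" "T integrable_on S"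
  shows "(\<Sum>i\<in>UNIV. \<Sum>j\<in>UNIV. a i j * integral S (f i j)) + (\<Sum>i\<in>UNIV. b i * integral S (g i))
      + q * integral S k - integral S T
    = integral S (\<lambda>z. (\<Sum>i\<in>UNIV. \<Sum>j\<in>UNIV. a i j * f i j z) + (\<Sum>i\<in>UNIV. b i * g i z) + q * k z - T z)"
  by (rule integral_unique[symmetric], intro has_integral_diff has_integral_add has_integral_sum
      has_integral_mult_right integrable_integral assms) simp_all

lemma factor_parabolic_expression:
  fixes X :: "'n::finite \<Rightarrow> 'n \<Rightarrow> real"
  shows "(\<Sum>i\<in>UNIV. \<Sum>j\<in>UNIV. a i j * (k * X i j)) + (\<Sum>i\<in>UNIV. b i * (k * Y i)) + q * (k * Z) - (k * W + e)
    = k * ((\<Sum>i\<in>UNIV. \<Sum>j\<in>UNIV. a i j * X i j) + (\<Sum>i\<in>UNIV. b i * Y i) + q * Z - W) - e"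
proof -
  have "(\<Sum>i\<in>UNIV. \<Sum>j\<in>UNIV. a i j * (k * X i j)) = k * (\<Sum>i\<in>UNIV. \<Sum>j\<in>UNIV. a i j * X i j)"
    "(\<Sum>i\<in>UNIV. b i * (k * Y i)) = k * (\<Sum>i\<in>UNIV. b i * Y i)"
    by (simp_all only: sum_distrib_left mult.left_commute[of _ k])
  then show ?thesis by (simp add: algebra_simps)
qed

text \<open>A lower bound for the mass of \<open>cutoff_deriv h\<close> times the frozen kernel near the pole, uniformly
  in \<open>h\<close>: the time interval of \<open>cutoff_deriv_ge\<close> contributes \<open>1/8\<close>, and in space the cube of side
  \<open>2 (h / n)\<^sup>1\<^sup>/\<^sup>2\<close> is taken, which lies in the ball of radius \<open>h\<^sup>1\<^sup>/\<^sup>2\<close>.\<close>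
definition mass_constant :: "'n itself \<Rightarrow> real \<Rightarrow> real"
  where "mass_constant _ \<kappa> = exp (- (1 / (4 * \<kappa>))) / 8 * 2 powr (- (real CARD('n) / 2))
    * (2 / sqrt (real CARD('n))) ^ CARD('n)"

definition cube :: "real^'n \<Rightarrow> real \<Rightarrow> (real^'n) set"
  where "cube x r = cbox (x - (\<chi> i. r)) (x + (\<chi> i. r))"

lemma cube_norm_le:
  fixes x :: "real^'n"
  assumes "y \<in> cube x (s / sqrt (real CARD('n)))" "0 \<le> s"
  shows "norm (y - x) \<le> s"
proof -
  let ?n = "real CARD('n)"
  have c: "\<bar>(y - x) $ i\<bar> \<le> s / sqrt ?n" for i
    using assms(1) by (simp add: cube_def mem_box_cart abs_le_iff) (metis add.commute diff_le_eq)
  have "(norm (y - x))\<^sup>2 = (\<Sum>i\<in>UNIV. ((y - x) $ i)\<^sup>2)"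
    by (simp add: norm_vec_def L2_set_def sum_nonneg)
  also have "\<dots> \<le> (\<Sum>i\<in>(UNIV::'n set). (s / sqrt ?n)\<^sup>2)"
    using c by (intro sum_mono) (metis abs_ge_zero power2_abs power_mono)
  also have "\<dots> = s\<^sup>2" by (simp add: power_divide)
  finally show ?thesis using assms(2) by (rule power2_le_imp_le)
qed

lemma content_cube:
  fixes x :: "real^'n"
  assumes "0 \<le> r"
  shows "measure lborel (cube x r) = (2 * r) ^ CARD('n)"
proof -
  have "x \<in> cube x r" using assms by (simp add: cube_def mem_box_cart)
  then have "cube x r \<noteq> {}" by blast
  then show ?thesis unfolding cube_def by (simp add: content_cbox_cart)
qed

context parabolic_coefficients
begin

lemma B_continuous: "continuous_on UNIV B"
  by (rule continuous_on_matrix_inv[OF \<kappa> M ell admissible_continuous[OF adm]])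

lemma B_continuous_compose: "continuous_on S f \<Longrightarrow> continuous_on S (\<lambda>p. B (f p))"
  using continuous_on_compose2[OF B_continuous] by auto

lemma B_entry_continuous_compose: "continuous_on S f \<Longrightarrow> continuous_on S (\<lambda>p. B (f p) $ i $ j)"
  by (intro continuous_on_component B_continuous_compose)

text \<open>The frozen kernel at the time that \<open>cutoff_parabolic_derivatives\<close> prescribes.\<close>
abbreviation reg_gauss :: "real \<Rightarrow> real^'n \<Rightarrow> real \<Rightarrow> (real^'n) \<times> real \<Rightarrow> real"
  where "reg_gauss h x t z \<equiv> matrix_gauss (B z) (x - fst z) (max t (snd z + h) - snd z)"

text \<open>A heat potential whose singularity on the diagonal is removed by the cutoff. Where the cutoff
  does not vanish, \<open>L\<close> turns the kernel into \<open>frozen_defect\<close>; the other term comes from the time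
  derivative of the cutoff and takes the place of the density in the equation for the full potential.\<close>
lemma regularized_potential:
  fixes lo hi :: "(real^'n) \<times> real" and \<rho> :: "(real^'n) \<times> real \<Rightarrow> real"
  assumes h: "0 < h" and \<rho>: "continuous_on (cbox lo hi) \<rho>"
  defines "V \<equiv> \<lambda>x t. integral (cbox lo hi) (\<lambda>z. \<rho> z * cutoff h (t - snd z) *
      reg_gauss h x t z)"
  shows "\<exists>D DD T. smooth_parabolic \<tau> V D DD T"
    and "continuous_on (cbox lo hi) (\<lambda>z. \<rho> z * cutoff h (t - snd z) * frozen_defect a b q x t (fst z) (snd z))"
    and "continuous_on (cbox lo hi) (\<lambda>z. \<rho> z * cutoff_deriv h (t - snd z) *
      reg_gauss h x t z)"
    and "parabolic_op a b q V x t
      = integral (cbox lo hi) (\<lambda>z. \<rho> z * cutoff h (t - snd z) * frozen_defect a b q x t (fst z) (snd z))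
        - integral (cbox lo hi) (\<lambda>z. \<rho> z * cutoff_deriv h (t - snd z) *
            reg_gauss h x t z)"
    and "continuous_on (cbox lo hi) (\<lambda>z. \<rho> z * cutoff h (t - snd z) *
      reg_gauss h x t z)"
proof -
  define g where "g x t z = reg_gauss h x t z" for x t z
  define w where "w x z = B z *v (x - fst z)" for x z
  define s where "s t z = max t (snd z + h) - snd z" for t and z :: "(real^'n) \<times> real"
  define k where "k x t z = \<rho> z * cutoff h (t - snd z) * g x t z" for x t z
  define D where "D i x t z = \<rho> z * cutoff h (t - snd z) * (- (w x z $ i / (2 * s t z)) * g x t z)" for i x t z
  define DD where "DD i j x t z = \<rho> z * cutoff h (t - snd z) *
    ((w x z $ i * w x z $ j / (4 * (s t z)\<^sup>2) - B z $ j $ i / (2 * s t z)) * g x t z)" for i j x t z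
  define e where "e x t z = \<rho> z * cutoff_deriv h (t - snd z) * g x t z" for x t z
  define T where "T x t z = \<rho> z * cutoff h (t - snd z) *
    ((w x z \<bullet> (x - fst z) / (4 * (s t z)\<^sup>2) - real CARD('n) / (2 * s t z)) * g x t z) + e x t z" for x t z
  have V: "V = (\<lambda>x t. integral (cbox lo hi) (k x t))" by (simp add: V_def k_def[abs_def] g_def)
  have der: "has_parabolic_derivatives \<tau> (\<lambda>x t. k x t z) (\<lambda>i x t. D i x t z) (\<lambda>i j x t. DD i j x t z) (\<lambda>x t. T x t z)" for z \<tau>
    using cutoff_parabolic_derivatives_scaled[OF matrix_gauss_derivatives[OF B_symmetric, of "snd z" z "fst z"] h, of \<tau> "\<rho> z"]
    unfolding k_def D_def DD_def T_def e_def g_def w_def s_def by simp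
  have spos: "0 < s t z" for t z using h by (simp add: s_def)
  then have s0: "s t z \<noteq> 0" for t z by (simp add: less_imp_neq[symmetric])
  let ?U = "(UNIV \<times> {\<tau><..}) \<times> cbox lo hi"
  have \<rho>': "continuous_on ((UNIV \<times> {\<tau><..}) \<times> cbox lo hi) (\<lambda>p. \<rho> (snd p))" for \<tau> :: real
    by (rule continuous_on_compose2[OF \<rho>]) (auto intro!: continuous_intros)
  note ci = continuous_intros cutoff_continuous[OF h] B_continuous_compose B_entry_continuous_compose \<rho>'
    continuous_on_matrix_vector_mult continuous_on_matrix_gauss
  have cs: "continuous_on ((UNIV \<times> {\<tau><..}) \<times> cbox lo hi) (\<lambda>p. s (snd (fst p)) (snd p))" for \<tau> :: real
    unfolding s_def by (intro ci)
  have cw: "continuous_on ((UNIV \<times> {\<tau><..}) \<times> cbox lo hi) (\<lambda>p. w (fst (fst p)) (snd p))" for \<tau> :: real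
    unfolding w_def by (intro ci)
  have cg: "continuous_on ((UNIV \<times> {\<tau><..}) \<times> cbox lo hi) (\<lambda>p. g (fst (fst p)) (snd (fst p)) (snd p))" for \<tau> :: real
    unfolding g_def using h by (intro ci) auto
  have pk: "continuous_on ((UNIV \<times> {\<tau><..}) \<times> cbox lo hi) (\<lambda>((x, t), z). k x t z)"
    and pD: "continuous_on ((UNIV \<times> {\<tau><..}) \<times> cbox lo hi) (\<lambda>((x, t), z). D i x t z)"
    and pDD: "continuous_on ((UNIV \<times> {\<tau><..}) \<times> cbox lo hi) (\<lambda>((x, t), z). DD i j x t z)"
    and pe: "continuous_on ((UNIV \<times> {\<tau><..}) \<times> cbox lo hi) (\<lambda>((x, t), z). e x t z)"
    and pT: "continuous_on ((UNIV \<times> {\<tau><..}) \<times> cbox lo hi) (\<lambda>((x, t), z). T x t z)" for i j and \<tau> :: real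
    unfolding k_def D_def DD_def T_def e_def case_prod_unfold using s0
    by (intro ci cs cw cg; simp)+
  note der' = integral_has_parabolic_derivatives[OF der pk pD pDD pT]
  have "smooth_parabolic \<tau> V (\<lambda>i x t. integral (cbox lo hi) (D i x t))
      (\<lambda>i j x t. integral (cbox lo hi) (DD i j x t)) (\<lambda>x t. integral (cbox lo hi) (T x t))"
    unfolding smooth_parabolic_def V
    using der' param_continuous_integral[OF pk] param_continuous_integral[OF pD]
      param_continuous_integral[OF pDD] param_continuous_integral[OF pT] by blast
  then show "\<exists>D DD T. smooth_parabolic \<tau> V D DD T" by blast
  have t: "t - 1 < t" by simp
  note cont = param_continuous_integrable(1)[OF _ t] and int = param_continuous_integrable(2)[OF _ t]
  define defect where "defect z = \<rho> z * cutoff h (t - snd z) * frozen_defect a b q x t (fst z) (snd z)" for z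
  have pt: "(\<Sum>i\<in>UNIV. \<Sum>j\<in>UNIV. a (x, t) $ i $ j * DD i j x t z) + (\<Sum>i\<in>UNIV. b (x, t) $ i * D i x t z)
      + q (x, t) * k x t z - T x t z = defect z - e x t z" for z
  proof (cases "snd z + h < t")
    case True
    then have "snd z < t" "s t z = t - snd z" "g x t z = matrix_gauss (B z) (x - fst z) (t - snd z)"
      using h by (auto simp: s_def g_def max_def)
    then show ?thesis
      unfolding DD_def D_def k_def T_def factor_parabolic_expression defect_def w_def
      using parabolic_expression_matrix_gauss[of "snd z" t x "fst z"] by simp
  next
    case False
    then have "cutoff h (t - snd z) = 0" by (intro cutoff_bounds) auto
    then show ?thesis by (simp add: DD_def D_def k_def T_def defect_def)
  qed
  show ce: "continuous_on (cbox lo hi) (\<lambda>z. \<rho> z * cutoff_deriv h (t - snd z) *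
      reg_gauss h x t z)"
    using cont[OF pe, of x] by (simp add: e_def[abs_def] g_def)
  show "continuous_on (cbox lo hi) (\<lambda>z. \<rho> z * cutoff h (t - snd z) *
      reg_gauss h x t z)"
    using cont[OF pk, of x] by (simp add: k_def[abs_def] g_def)
  have "continuous_on (cbox lo hi) (\<lambda>z. ((\<Sum>i\<in>UNIV. \<Sum>j\<in>UNIV. a (x, t) $ i $ j * DD i j x t z)
      + (\<Sum>i\<in>UNIV. b (x, t) $ i * D i x t z) + q (x, t) * k x t z - T x t z) + e x t z)"
    by (intro continuous_intros cont[OF pDD] cont[OF pD] cont[OF pk] cont[OF pT] cont[OF pe])
  then have cd: "continuous_on (cbox lo hi) defect" unfolding pt by simp
  then show "continuous_on (cbox lo hi) (\<lambda>z. \<rho> z * cutoff h (t - snd z) * frozen_defect a b q x t (fst z) (snd z))"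
    by (simp add: defect_def[abs_def])
  have "parabolic_op a b q V x t = integral (cbox lo hi) (\<lambda>z. defect z - e x t z)"
    unfolding V parabolic_op_eq[OF der' t]
    by (subst integral_linear_combination) (auto simp: pt intro: int[OF pk] int[OF pD] int[OF pDD] int[OF pT])
  also have "\<dots> = integral (cbox lo hi) defect - integral (cbox lo hi) (e x t)"
    by (intro integral_diff integrable_continuous cd cont[OF pe])
  finally show "parabolic_op a b q V x t
      = integral (cbox lo hi) (\<lambda>z. \<rho> z * cutoff h (t - snd z) * frozen_defect a b q x t (fst z) (snd z))
        - integral (cbox lo hi) (\<lambda>z. \<rho> z * cutoff_deriv h (t - snd z) *
            reg_gauss h x t z)"
    by (simp add: defect_def[abs_def] e_def[abs_def] g_def)
qed

lemma matrix_gauss_ge: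
  assumes s: "0 < s" and v: "(norm v)\<^sup>2 \<le> s" and s': "s \<le> s'"
  shows "s' powr (- (real CARD('n) / 2)) * exp (- (1 / (4 * \<kappa>))) \<le> matrix_gauss (B z) v s"
proof -
  have "(B z *v v) \<bullet> v / (4 * s) \<le> ((norm v)\<^sup>2 / \<kappa>) / (4 * s)"
    using s by (intro divide_right_mono matrix_inv_quadratic_le[OF \<kappa> M ell]) auto
  also have "\<dots> \<le> (s / \<kappa>) / (4 * s)" using v \<kappa> s by (intro divide_right_mono) auto
  also have "\<dots> = 1 / (4 * \<kappa>)" using s by simp
  finally have "exp (- (1 / (4 * \<kappa>))) \<le> exp (- ((B z *v v) \<bullet> v / (4 * s)))" by simp
  moreover have "s' powr (- (real CARD('n) / 2)) \<le> s powr (- (real CARD('n) / 2))"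
    using s s' by (intro powr_mono2') auto
  ultimately show ?thesis unfolding matrix_gauss_def by (intro mult_mono) auto
qed

text \<open>The lower bound survives the passage to \<open>h \<rightarrow> 0\<close> because all powers of \<open>h\<close> cancel:
  \<open>1 / (4 h)\<close> from the cutoff and \<open>h\<^sup>-\<^sup>n\<^sup>/\<^sup>2\<close> from the kernel against the volume \<open>h / 2 \<cdot> h\<^sup>n\<^sup>/\<^sup>2\<close>.\<close>
lemma cutoff_mass_ge:
  fixes x :: "real^'n"
  assumes h: "0 < h" and \<rho>: "continuous_on (cbox lo hi) \<rho>" "\<And>z. z \<in> cbox lo hi \<Longrightarrow> 0 \<le> \<rho> z"
    and R: "\<And>\<eta> \<sigma>. \<eta> \<in> cube x (sqrt h / sqrt (real CARD('n))) \<Longrightarrow> t - 2 * h \<le> \<sigma> \<Longrightarrow> \<sigma> \<le> t - 3 / 2 * h \<Longrightarrow>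
      (\<eta>, \<sigma>) \<in> cbox lo hi \<and> c \<le> \<rho> (\<eta>, \<sigma>)"
  shows "mass_constant TYPE('n) \<kappa> * c \<le> integral (cbox lo hi) (\<lambda>z. \<rho> z * cutoff_deriv h (t - snd z) *
      reg_gauss h x t z)"
    (is "_ \<le> integral _ ?F")
proof -
  have F0: "0 \<le> ?F z" if "z \<in> cbox lo hi" for z
    using \<rho>(2)[OF that] by (simp add: matrix_gauss_nonneg cutoff_bounds(5))
  have intF: "?F integrable_on cbox lo hi"
    by (intro integrable_continuous regularized_potential(3)[OF h \<rho>(1)])
  show ?thesis
  proof (cases "c \<le> 0")
    case True
    have "mass_constant TYPE('n) \<kappa> * c \<le> 0"
      using True by (simp add: mass_constant_def mult_nonneg_nonpos)
    also have "0 \<le> integral (cbox lo hi) ?F" by (intro integral_nonneg intF F0)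
    finally show ?thesis .
  next
    case False
    define n where "n = real CARD('n)"
    define r where "r = sqrt h / sqrt n"
    define lo' hi' where "lo' = (x - (\<chi> i. r), t - 2 * h)" and "hi' = (x + (\<chi> i. r), t - 3 / 2 * h)"
    have R': "cbox lo' hi' = cube x r \<times> {t - 2 * h..t - 3 / 2 * h}"
      by (simp add: lo'_def hi'_def cube_def cbox_Pair_eq)
    have sub: "cbox lo' hi' \<subseteq> cbox lo hi" using R unfolding R' r_def n_def by auto
    define L where "L = c * (1 / (4 * h)) * ((2 * h) powr (- (n / 2)) * exp (- (1 / (4 * \<kappa>))))"
    have LF: "L \<le> ?F z" if "z \<in> cbox lo' hi'" for z
    proof -
      obtain \<eta> \<sigma> where z: "z = (\<eta>, \<sigma>)" by (cases z)
      have \<eta>: "\<eta> \<in> cube x r" and \<sigma>: "t - 2 * h \<le> \<sigma>" "\<sigma> \<le> t - 3 / 2 * h"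
        using that unfolding R' z by auto
      have c: "c \<le> \<rho> z" using R[of \<eta> \<sigma>] \<eta> \<sigma> by (simp add: r_def n_def z)
      have "norm (\<eta> - x) \<le> sqrt h" using \<eta> h cube_norm_le[of \<eta> x "sqrt h"] by (simp add: r_def n_def)
      then have "(norm (x - \<eta>))\<^sup>2 \<le> (sqrt h)\<^sup>2" by (simp add: norm_minus_commute power_mono)
      then have v: "(norm (x - \<eta>))\<^sup>2 \<le> t - \<sigma>" using h \<sigma> by simp
      have m: "max t (\<sigma> + h) = t" using \<sigma> h by simp
      have "(2 * h) powr (- (n / 2)) * exp (- (1 / (4 * \<kappa>))) \<le> matrix_gauss (B z) (x - \<eta>) (t - \<sigma>)"
        unfolding n_def using \<sigma> h v by (intro matrix_gauss_ge) auto
      moreover have "1 / (4 * h) \<le> cutoff_deriv h (t - \<sigma>)" using \<sigma> by (intro cutoff_deriv_ge h) auto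
      ultimately have "L \<le> \<rho> z * cutoff_deriv h (t - \<sigma>) * matrix_gauss (B z) (x - \<eta>) (t - \<sigma>)"
        unfolding L_def using c False h by (intro mult_mono) (auto simp: cutoff_bounds(5))
      then show ?thesis by (simp add: z m)
    qed
    have "measure lborel (cbox lo' hi') = (2 * r) ^ CARD('n) * (h / 2)"
    proof -
      have "measure lborel (cbox lo' hi') = measure lborel (cube x r) * measure lborel (cbox (t - 2 * h) (t - 3 / 2 * h))"
        unfolding lo'_def hi'_def cube_def by (rule content_Pair)
      then show ?thesis using h by (subst (asm) content_cube) (auto simp: r_def n_def content_real)
    qed
    moreover have "(2 * r) ^ CARD('n) = (2 / sqrt n) ^ CARD('n) * h powr (n / 2)"
    proof -
      have "h powr (n / 2) = (sqrt h) ^ CARD('n)"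
        using h by (simp add: n_def powr_half_sqrt[symmetric] powr_powr flip: powr_realpow)
      then show ?thesis by (simp add: r_def flip: power_mult_distrib)
    qed
    ultimately have e: "measure lborel (cbox lo' hi') = (2 / sqrt n) ^ CARD('n) * h powr (n / 2) * (h / 2)"
      by simp
    have "L * measure lborel (cbox lo' hi') = c * exp (- (1 / (4 * \<kappa>))) / 8 * (2 / sqrt n) ^ CARD('n)
        * ((2 * h) powr (- (n / 2)) * h powr (n / 2))"
      unfolding e using h by (simp add: L_def)
    also have "(2 * h) powr (- (n / 2)) * h powr (n / 2) = 2 powr (- (n / 2))"
      using h by (simp add: powr_mult mult.assoc flip: powr_add)
    finally have "mass_constant TYPE('n) \<kappa> * c = L * measure lborel (cbox lo' hi')"
      by (simp add: mass_constant_def n_def mult_ac)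
    also have "\<dots> = integral (cbox lo' hi') (\<lambda>z. L)" by simp
    also have "\<dots> \<le> integral (cbox lo' hi') ?F"
      using integrable_on_subcbox[OF intF sub] LF by (intro integral_le) auto
    also have "\<dots> \<le> integral (cbox lo hi) ?F"
      using integrable_on_subcbox[OF intF sub] intF F0 sub by (intro integral_subset_le) auto
    finally show ?thesis .
  qed
qed

end

lemma mass_constant_pos: "0 < mass_constant TYPE('n::finite) \<kappa>"
  unfolding mass_constant_def by (intro mult_pos_pos zero_less_power divide_pos_pos) auto

lemma matrix_gauss_smooth_parabolic:
  fixes B :: "real^'n^'n"
  assumes sym: "\<And>x y. (B *v x) \<bullet> y = x \<bullet> (B *v y)"
  shows "\<exists>D DD T. smooth_parabolic \<tau> (\<lambda>x t. matrix_gauss B (x - \<xi>) (t - \<tau>)) D DD T"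
proof -
  let ?S = "UNIV \<times> {\<tau><..} :: ((real^'n) \<times> real) set"
  have w: "continuous_on ?S (\<lambda>p. B *v (fst p - \<xi>))"
    by (intro continuous_on_matrix_vector_mult continuous_intros)
  have g: "continuous_on ?S (\<lambda>p. matrix_gauss B (fst p - \<xi>) (snd p - \<tau>))"
    by (rule continuous_on_matrix_gauss) (auto intro!: continuous_intros)
  show ?thesis
    unfolding smooth_parabolic_def case_prod_unfold
    by (intro exI conjI allI, rule matrix_gauss_derivatives[OF sym])
       (intro continuous_intros w g; auto)+
qed

lemma exp_smooth_parabolic:
  "smooth_parabolic \<tau> (\<lambda>(x :: real^'n) t. exp (c * (t - s))) (\<lambda>i x t. 0) (\<lambda>i j x t. 0) (\<lambda>x t. c * exp (c * (t - s)))"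
  unfolding smooth_parabolic_def has_parabolic_derivatives_def case_prod_unfold
  by (auto intro!: continuous_intros derivative_eq_intros)

locale barrier_weight = parabolic_coefficients \<alpha> N\<^sub>1 N\<^sub>2 M \<kappa> C\<^sub>0 a b q
  for \<alpha> N\<^sub>1 N\<^sub>2 M \<kappa> C\<^sub>0 :: real and a :: "(real^'n) \<times> real \<Rightarrow> real^'n^'n"
    and b :: "(real^'n) \<times> real \<Rightarrow> real^'n" and q :: "(real^'n) \<times> real \<Rightarrow> real" +
  fixes m\<^sub>0 \<mu> :: real
  assumes m\<^sub>0: "m\<^sub>0 = mass_constant TYPE('n) \<kappa>"
    and \<mu>: "admissible_weight TYPE('n) M \<beta> C\<^sub>0 (m\<^sub>0 / 2) \<mu>"
begin

lemma m\<^sub>0_pos: "0 < m\<^sub>0"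
  unfolding m\<^sub>0 by (rule mass_constant_pos)

abbreviation K where "K \<equiv> iterate_majorant \<beta> \<mu> M"

text \<open>The supersolution is the frozen kernel with pole \<open>(\<xi>, \<tau> - \<delta>)\<close> plus the regularized potential of
  a multiple of \<open>K\<close>. Applying \<open>L\<close> to the potential gives at most \<open>- m\<^sub>0\<close> times the density, up to
  \<open>\<epsilon>\<close>, from the cutoff, and at most \<open>m\<^sub>0 / 2\<close> times the density from the defect, by the choice of \<open>\<mu>\<close>;
  the remaining half absorbs the defect of the first summand.\<close>
lemma barrier_exists:
  fixes \<xi> :: "real^'n"
  assumes \<Omega>: "bounded \<Omega>" and \<delta>: "0 < \<delta>" and \<epsilon>: "0 < \<epsilon>" and T: "\<tau> < T"
  defines "\<tau>0 \<equiv> \<tau> - \<delta>"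
  shows "\<exists>w D DD Dt. smooth_parabolic \<tau>0 w D DD Dt \<and>
    (\<forall>x\<in>\<Omega>. \<forall>t. \<tau> < t \<longrightarrow> t \<le> T \<longrightarrow> parabolic_op a b q w x t \<le> \<epsilon>) \<and>
    (\<forall>x t. \<tau>0 < t \<longrightarrow> matrix_gauss (B (\<xi>, \<tau>0)) (x - \<xi>) (t - \<tau>0) \<le> w x t \<and>
      w x t \<le> (1 + 2 * C\<^sub>0 / m\<^sub>0 * (gauss_mass TYPE('n) M / \<beta>)) * exp ((\<mu> + 1) * (t - \<tau>0))
        * gauss_kernel M (x - \<xi>) (t - \<tau>0))"
proof -
  define A where "A = 2 * C\<^sub>0 / m\<^sub>0"
  have A: "0 < A" using C\<^sub>0_pos m\<^sub>0_pos by (simp add: A_def)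
  define \<rho> where "\<rho> z = A * K (fst z - \<xi>) (snd z - \<tau>0)" for z
  obtain R where R: "\<And>x. x \<in> \<Omega> \<Longrightarrow> norm x \<le> R" using \<Omega> by (auto simp: bounded_iff)
  obtain bb :: "real^'n" where bb: "cball 0 (R + 1) \<subseteq> cbox (- bb) bb"
    using bounded_subset_cbox_symmetric[OF bounded_cball[of "0 :: real^'n" "R + 1"]] by auto
  define lo hi where "lo = (- bb, \<tau>0 + \<delta> / 2)" and "hi = (bb, T)"
  have box: "(\<eta>, \<sigma>) \<in> cbox lo hi \<longleftrightarrow> \<eta> \<in> cbox (- bb) bb \<and> \<tau>0 + \<delta> / 2 \<le> \<sigma> \<and> \<sigma> \<le> T" for \<eta> \<sigma>
    by (simp add: lo_def hi_def cbox_Pair_eq)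
  have after: "\<tau>0 < snd z" if "z \<in> cbox lo hi" for z
    using that \<delta> box[of "fst z" "snd z"] by simp
  have \<rho>c: "continuous_on (cbox lo hi) \<rho>"
    unfolding \<rho>_def using after by (intro continuous_intros continuous_on_iterate_majorant M) auto
  have \<rho>0: "0 \<le> \<rho> z" for z using A by (simp add: \<rho>_def iterate_majorant_nonneg)

  \<comment> \<open>The width \<open>h\<close> of the cutoff is chosen by uniform continuity of the density.\<close>
  have "uniformly_continuous_on (cbox lo hi) \<rho>"
    by (rule compact_uniformly_continuous[OF \<rho>c compact_cbox])
  moreover have "0 < \<epsilon> / m\<^sub>0" using \<epsilon> m\<^sub>0_pos by simp
  ultimately obtain d where d: "0 < d"
    "\<And>z z'. z \<in> cbox lo hi \<Longrightarrow> z' \<in> cbox lo hi \<Longrightarrow> dist z' z < d \<Longrightarrow> dist (\<rho> z') (\<rho> z) < \<epsilon> / m\<^sub>0"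
    unfolding uniformly_continuous_on_def by metis
  define h where "h = min (min 1 (\<delta> / 4)) (min (d / 16) ((d / 4)\<^sup>2))"
  have h: "0 < h" using \<delta> d(1) by (simp add: h_def)
  have "sqrt h \<le> sqrt ((d / 4)\<^sup>2)" by (rule real_sqrt_le_mono) (simp add: h_def)
  then have hd: "sqrt h \<le> d / 4" using d(1) by (simp add: real_sqrt_abs)
  have "sqrt h \<le> sqrt 1" by (rule real_sqrt_le_mono) (simp add: h_def)
  then have h1: "sqrt h \<le> 1" by simp
  have h2: "h \<le> d / 16" "2 * h \<le> \<delta> / 2" by (simp_all add: h_def)

  define V where "V x t = integral (cbox lo hi) (\<lambda>z. \<rho> z * cutoff h (t - snd z) *
      reg_gauss h x t z)" for x t
  note V_def' = V_def[abs_def]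
  define Z where "Z x t = matrix_gauss (B (\<xi>, \<tau>0)) (x - \<xi>) (t - \<tau>0)" for x t
  obtain D1 DD1 T1 where sV: "smooth_parabolic \<tau>0 V D1 DD1 T1"
    using regularized_potential(1)[OF h \<rho>c, of \<tau>0] unfolding V_def' by blast
  obtain D2 DD2 T2 where sZ: "smooth_parabolic \<tau>0 Z D2 DD2 T2"
    using matrix_gauss_smooth_parabolic[OF B_symmetric] unfolding Z_def by blast
  define w where "w x t = Z x t + V x t" for x t
  have sw: "smooth_parabolic \<tau>0 w (\<lambda>i x t. D2 i x t + D1 i x t) (\<lambda>i j x t. DD2 i j x t + DD1 i j x t)
      (\<lambda>x t. T2 x t + T1 x t)"
    unfolding w_def[abs_def] by (rule smooth_parabolic_add[OF sZ sV])

  have V0: "0 \<le> V x t" for x t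
    unfolding V_def
    by (intro integral_nonneg integrable_continuous regularized_potential(5)[OF h \<rho>c])
       (auto simp: \<rho>0 cutoff_bounds matrix_gauss_nonneg)
  have Vle: "V x t \<le> A * (gauss_mass TYPE('n) M / \<beta> * exp ((\<mu> + 1) * (t - \<tau>0)) * gauss_kernel M (x - \<xi>) (t - \<tau>0))"
    if t: "\<tau>0 < t" for x t
  proof -
    have "\<bar>V x t\<bar> \<le> A * (gauss_mass TYPE('n) M / \<beta> * exp ((\<mu> + 1) * (t - \<tau>0)) * gauss_kernel M (x - \<xi>) (t - \<tau>0))"
      unfolding V_def
    proof (rule abs_integral_cbox_le_iterated[where S="{\<tau>0<..<t}"])
      show "continuous_on (cbox lo hi) (\<lambda>z. \<rho> z * cutoff h (t - snd z) *
          reg_gauss h x t z)"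
        by (rule regularized_potential(5)[OF h \<rho>c])
      show "iterated_nn_integral {\<tau>0<..<t} (\<lambda>\<sigma> \<eta>. gauss_kernel M (x - \<eta>) (t - \<sigma>) * K (\<eta> - \<xi>) (\<sigma> - \<tau>0))
        \<le> ennreal (gauss_mass TYPE('n) M / \<beta> * exp ((\<mu> + 1) * (t - \<tau>0)) * gauss_kernel M (x - \<xi>) (t - \<tau>0))"
        using \<alpha> \<mu> t by (intro nn_integral_gauss_iterate M) (auto simp: admissible_weight_def)
      fix \<eta> \<sigma> assume z: "(\<eta>, \<sigma>) \<in> cbox lo hi"
      show "\<rho> (\<eta>, \<sigma>) * cutoff h (t - snd (\<eta>, \<sigma>)) * matrix_gauss (B (\<eta>, \<sigma>)) (x - fst (\<eta>, \<sigma>))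
          (max t (snd (\<eta>, \<sigma>) + h) - snd (\<eta>, \<sigma>)) = 0" if "\<sigma> \<notin> {\<tau>0<..<t}"
        using that after[OF z] h by (simp add: cutoff_bounds(3))
      show "\<bar>\<rho> (\<eta>, \<sigma>) * cutoff h (t - snd (\<eta>, \<sigma>)) * matrix_gauss (B (\<eta>, \<sigma>)) (x - fst (\<eta>, \<sigma>))
          (max t (snd (\<eta>, \<sigma>) + h) - snd (\<eta>, \<sigma>))\<bar>
        \<le> A * (gauss_kernel M (x - \<eta>) (t - \<sigma>) * K (\<eta> - \<xi>) (\<sigma> - \<tau>0))" if "\<sigma> \<in> {\<tau>0<..<t}"
      proof (cases "\<sigma> + h < t")
        case True
        have "\<rho> (\<eta>, \<sigma>) * cutoff h (t - \<sigma>) * matrix_gauss (B (\<eta>, \<sigma>)) (x - \<eta>) (t - \<sigma>)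
            \<le> \<rho> (\<eta>, \<sigma>) * 1 * gauss_kernel M (x - \<eta>) (t - \<sigma>)"
          using that by (intro mult_mono mult_left_mono matrix_gauss_le_gauss_kernel'[OF \<kappa> M ell])
            (auto simp: \<rho>0 cutoff_bounds matrix_gauss_nonneg)
        then show ?thesis
          using True by (simp add: max_def \<rho>_def abs_mult iterate_majorant_nonneg cutoff_bounds
              matrix_gauss_nonneg A[THEN less_imp_le] mult_ac)
      next
        case False
        then show ?thesis
          using A by (simp add: cutoff_bounds(3) iterate_majorant_nonneg gauss_kernel_nonneg)
      qed
    qed (use A \<alpha> in \<open>auto simp: gauss_kernel_nonneg\<close>)
    then show ?thesis by simp
  qed
  have wle: "w x t \<le> (1 + 2 * C\<^sub>0 / m\<^sub>0 * (gauss_mass TYPE('n) M / \<beta>)) * exp ((\<mu> + 1) * (t - \<tau>0))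
      * gauss_kernel M (x - \<xi>) (t - \<tau>0)" if t: "\<tau>0 < t" for x t
  proof -
    let ?E = "exp ((\<mu> + 1) * (t - \<tau>0))" and ?H = "gauss_kernel M (x - \<xi>) (t - \<tau>0)"
    have "Z x t \<le> ?H"
      unfolding Z_def using t by (intro matrix_gauss_le_gauss_kernel'[OF \<kappa> M ell]) auto
    also have "1 \<le> ?E" using \<mu> t by (simp add: admissible_weight_def)
    then have "?H \<le> ?E * ?H" using mult_right_mono[OF _ gauss_kernel_nonneg, of 1 ?E M "x - \<xi>" "t - \<tau>0"] by simp
    finally have "w x t \<le> ?E * ?H + A * (gauss_mass TYPE('n) M / \<beta> * ?E * ?H)"
      using Vle[OF t, of x] by (simp add: w_def)
    also have "\<dots> = (1 + A * (gauss_mass TYPE('n) M / \<beta>)) * ?E * ?H" by (simp add: distrib_right)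
    finally show ?thesis by (simp add: A_def)
  qed

  have op: "parabolic_op a b q w x t \<le> \<epsilon>" if x: "x \<in> \<Omega>" and t: "\<tau> < t" "t \<le> T" for x t
  proof -
    have t0: "\<tau>0 < t" using t \<delta> by (simp add: \<tau>0_def)
    define k where "k = K (x - \<xi>) (t - \<tau>0)"
    have k: "\<rho> (x, t) = A * k" by (simp add: \<rho>_def k_def)
    have dZ: "has_parabolic_derivatives \<tau>0 Z
      (\<lambda>i x t. gauss_D (B (\<xi>, \<tau>0)) i (x - \<xi>) (t - \<tau>0))
      (\<lambda>i j x t. gauss_DD (B (\<xi>, \<tau>0)) i j (x - \<xi>) (t - \<tau>0))
      (\<lambda>x t. gauss_T (B (\<xi>, \<tau>0)) (x - \<xi>) (t - \<tau>0))"
      unfolding Z_def[abs_def] by (rule matrix_gauss_derivatives[OF B_symmetric])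
    have "parabolic_op a b q Z x t = frozen_defect a b q x t \<xi> \<tau>0"
      unfolding parabolic_op_eq[OF dZ t0] Z_def by (rule parabolic_expression_matrix_gauss[OF t0])
    also have "\<dots> \<le> C\<^sub>0 * (t - \<tau>0) powr (\<beta> - 1) * exp (t - \<tau>0) * gauss_kernel M (x - \<xi>) (t - \<tau>0)"
      using abs_frozen_defect_le[OF t0, of x \<xi>] by linarith
    also have "\<dots> \<le> C\<^sub>0 * (t - \<tau>0) powr (\<beta> - 1) * exp (\<mu> * (t - \<tau>0)) * gauss_kernel M (x - \<xi>) (t - \<tau>0)"
      using C\<^sub>0_pos \<mu> t0
      by (intro mult_right_mono mult_left_mono) (auto simp: gauss_kernel_nonneg admissible_weight_def)
    also have "\<dots> = m\<^sub>0 / 2 * (A * k)"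
      using m\<^sub>0_pos by (simp add: k_def A_def iterate_majorant_def mult_ac)
    finally have opZ: "parabolic_op a b q Z x t \<le> m\<^sub>0 / 2 * (A * k)" .

    let ?F = "\<lambda>z. \<rho> z * cutoff h (t - snd z) * frozen_defect a b q x t (fst z) (snd z)"
    have F: "\<bar>integral (cbox lo hi) ?F\<bar> \<le> A * (m\<^sub>0 / 2 * k)"
    proof (rule abs_integral_cbox_le_iterated[where S="{\<tau>0<..<t}"])
      show "continuous_on (cbox lo hi) ?F" by (rule regularized_potential(2)[OF h \<rho>c])
      show "iterated_nn_integral {\<tau>0<..<t} (\<lambda>\<sigma> \<eta>. C\<^sub>0 * (t - \<sigma>) powr (\<beta> - 1) * exp (t - \<sigma>) * gauss_kernel M (x - \<eta>) (t - \<sigma>)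
          * K (\<eta> - \<xi>) (\<sigma> - \<tau>0)) \<le> ennreal (m\<^sub>0 / 2 * k)"
        unfolding k_def using \<alpha> C\<^sub>0_pos t0 by (intro nn_integral_defect_iterate \<mu> M) auto
      fix \<eta> \<sigma> assume z: "(\<eta>, \<sigma>) \<in> cbox lo hi"
      show "?F (\<eta>, \<sigma>) = 0" if "\<sigma> \<notin> {\<tau>0<..<t}"
        using that after[OF z] h by (simp add: cutoff_bounds(3))
      show "\<bar>?F (\<eta>, \<sigma>)\<bar> \<le> A * (C\<^sub>0 * (t - \<sigma>) powr (\<beta> - 1) * exp (t - \<sigma>) * gauss_kernel M (x - \<eta>) (t - \<sigma>)
          * K (\<eta> - \<xi>) (\<sigma> - \<tau>0))" if "\<sigma> \<in> {\<tau>0<..<t}"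
      proof -
        have "\<bar>?F (\<eta>, \<sigma>)\<bar> = \<rho> (\<eta>, \<sigma>) * cutoff h (t - \<sigma>) * \<bar>frozen_defect a b q x t \<eta> \<sigma>\<bar>"
          by (simp add: abs_mult \<rho>0 cutoff_bounds)
        also have "\<dots> \<le> \<rho> (\<eta>, \<sigma>) * 1 * (C\<^sub>0 * (t - \<sigma>) powr (\<beta> - 1) * exp (t - \<sigma>) * gauss_kernel M (x - \<eta>) (t - \<sigma>))"
          using that by (intro mult_mono mult_left_mono abs_frozen_defect_le) (auto simp: \<rho>0 cutoff_bounds)
        finally show ?thesis by (simp add: \<rho>_def mult_ac)
      qed
    qed (use A m\<^sub>0_pos in \<open>auto simp: k_def iterate_majorant_nonneg\<close>)

    have in_box: "(\<eta>, \<sigma>) \<in> cbox lo hi" if "norm (\<eta> - x) \<le> 1" "\<tau> - \<delta> / 2 \<le> \<sigma>" "\<sigma> \<le> T" for \<eta> \<sigma>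
    proof -
      have "norm x \<le> R" using x R by auto
      then have "norm \<eta> \<le> R + 1" using that(1) norm_triangle_ineq[of x "\<eta> - x"] by simp
      then show ?thesis using bb that(2,3) by (auto simp: box \<tau>0_def)
    qed
    have xt: "(x, t) \<in> cbox lo hi" using t \<delta> by (intro in_box) auto
    have E: "mass_constant TYPE('n) \<kappa> * (A * k - \<epsilon> / m\<^sub>0) \<le> integral (cbox lo hi)
      (\<lambda>z. \<rho> z * cutoff_deriv h (t - snd z) * reg_gauss h x t z)"
    proof (rule cutoff_mass_ge[OF h \<rho>c \<rho>0])
      fix \<eta> \<sigma>
      assume \<eta>: "\<eta> \<in> cube x (sqrt h / sqrt (real CARD('n)))" and \<sigma>: "t - 2 * h \<le> \<sigma>" "\<sigma> \<le> t - 3 / 2 * h"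
      have n: "norm (\<eta> - x) \<le> sqrt h" using \<eta> h by (intro cube_norm_le) auto
      have z: "(\<eta>, \<sigma>) \<in> cbox lo hi" using order_trans[OF n h1] h2 h \<sigma> t by (intro in_box) auto
      have "dist (\<eta>, \<sigma>) (x, t) \<le> norm (\<eta> - x) + \<bar>\<sigma> - t\<bar>"
        using norm_Pair_le[of "\<eta> - x" "\<sigma> - t"] by (simp add: dist_norm)
      also have "\<dots> < d" using n hd h2 \<sigma> h d(1) by auto
      finally have "dist (\<rho> (\<eta>, \<sigma>)) (\<rho> (x, t)) < \<epsilon> / m\<^sub>0" by (rule d(2)[OF xt z])
      then show "(\<eta>, \<sigma>) \<in> cbox lo hi \<and> A * k - \<epsilon> / m\<^sub>0 \<le> \<rho> (\<eta>, \<sigma>)"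
        using z by (simp add: dist_real_def k)
    qed
    have "parabolic_op a b q V x t \<le> A * (m\<^sub>0 / 2 * k) - mass_constant TYPE('n) \<kappa> * (A * k - \<epsilon> / m\<^sub>0)"
      using regularized_potential(4)[OF h \<rho>c, of x t] F E unfolding V_def' by linarith
    also have "\<dots> = \<epsilon> - m\<^sub>0 / 2 * (A * k)"
      using m\<^sub>0_pos by (simp add: right_diff_distrib flip: m\<^sub>0) 
    finally show ?thesis
      using opZ parabolic_op_add[OF sZ sV t0, of a b q x] by (simp add: w_def[abs_def])
  qed
  have "Z x t \<le> w x t" for x t using V0 by (simp add: w_def)
  then show ?thesis using sw op wle unfolding Z_def by blast
qed

end

section \<open>Smooth bump functions\<close>

text \<open>The functions \<open>P(1 / s) e\<^sup>-\<^sup>1\<^sup>/\<^sup>s\<close> for \<open>s > 0\<close>, extended by zero; the family is closed under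
  differentiation.\<close>
definition flat_fun :: "real poly \<Rightarrow> real \<Rightarrow> real"
  where "flat_fun p s = (if 0 < s then poly p (inverse s) * exp (- inverse s) else 0)"

definition flat_step :: "real poly \<Rightarrow> real poly"
  where "flat_step p = (p - pderiv p) * [:0, 0, 1:]"

text \<open>The power in front makes the induction on \<open>p\<close> work, as it takes up the factor that splits off.\<close>
lemma poly_times_exp_tendsto_0: "((\<lambda>y::real. y ^ k * poly p y * exp (- y)) \<longlongrightarrow> 0) at_top"
proof (induction p arbitrary: k)
  case (pCons c p)
  have "((\<lambda>y::real. c * (y ^ k / exp y) + y ^ Suc k * poly p y * exp (- y)) \<longlongrightarrow> c * 0 + 0) at_top"
    by (intro tendsto_intros tendsto_power_div_exp_0 pCons.IH)
  then show ?case by (simp add: algebra_simps exp_minus divide_inverse)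
qed simp

lemma flat_fun_derivative: "(flat_fun p has_real_derivative flat_fun (flat_step p) s) (at s)"
proof (cases s "0 :: real" rule: linorder_cases)
  case less
  have "((\<lambda>s. 0) has_real_derivative 0) (at s)" by simp
  then have "(flat_fun p has_real_derivative 0) (at s)"
    by (rule has_field_derivative_transform_within_open[where S="{..<0}"]) (use less in \<open>auto simp: flat_fun_def\<close>)
  then show ?thesis using less by (simp add: flat_fun_def)
next
  case greater
  have "((\<lambda>s. poly p (inverse s) * exp (- inverse s)) has_real_derivative
      poly (flat_step p) (inverse s) * exp (- inverse s)) (at s)"
    using greater by (auto intro!: derivative_eq_intros DERIV_chain2[OF poly_DERIV]
        simp: flat_step_def algebra_simps power2_eq_square)
  then have "(flat_fun p has_real_derivative poly (flat_step p) (inverse s) * exp (- inverse s)) (at s)"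
    by (rule has_field_derivative_transform_within_open[where S="{0<..}"]) (use greater in \<open>auto simp: flat_fun_def\<close>)
  then show ?thesis using greater by (simp add: flat_fun_def)
next
  case equal
  have "((\<lambda>h. inverse h ^ 1 * poly p (inverse h) * exp (- inverse h)) \<longlongrightarrow> 0) (at_right (0::real))"
    by (rule filterlim_compose[OF poly_times_exp_tendsto_0 filterlim_inverse_at_top_right])
  then have "((\<lambda>h. flat_fun p h / h) \<longlongrightarrow> 0) (at_right 0)"
    by (rule Lim_transform_eventually)
       (auto simp: eventually_at_right_field flat_fun_def divide_inverse mult_ac intro!: exI[of _ 1])
  moreover have "((\<lambda>h. flat_fun p h / h) \<longlongrightarrow> 0) (at_left 0)"
    by (rule Lim_transform_eventually[OF tendsto_const])
       (auto simp: eventually_at_left_field flat_fun_def intro!: exI[of _ "-1"])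
  ultimately have "((\<lambda>h. flat_fun p h / h) \<longlongrightarrow> 0) (at 0)"
    by (simp add: filterlim_at_split)
  then show ?thesis using equal by (simp add: DERIV_def flat_fun_def)
qed

text \<open>A class that contains the bumps and is closed under partial derivatives, so that membership
  alone implies smoothness.\<close>
inductive bump_algebra :: "real^'n \<Rightarrow> real \<Rightarrow> (real^'n \<Rightarrow> real) \<Rightarrow> bool" for \<xi> r where
  const: "bump_algebra \<xi> r (\<lambda>x. c)"
| coord: "bump_algebra \<xi> r (\<lambda>x. x $ i)"
| flat: "bump_algebra \<xi> r (\<lambda>x. flat_fun p (1 - (norm (x - \<xi>))\<^sup>2 / r\<^sup>2))"
| add: "bump_algebra \<xi> r f \<Longrightarrow> bump_algebra \<xi> r g \<Longrightarrow> bump_algebra \<xi> r (\<lambda>x. f x + g x)"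
| mult: "bump_algebra \<xi> r f \<Longrightarrow> bump_algebra \<xi> r g \<Longrightarrow> bump_algebra \<xi> r (\<lambda>x. f x * g x)"

lemma bump_algebra_partial:
  fixes f :: "real^'n \<Rightarrow> real"
  assumes "bump_algebra \<xi> r f"
  shows "\<exists>g. bump_algebra \<xi> r g \<and> (\<forall>x. ((\<lambda>s. f (x + s *\<^sub>R axis i 1)) has_real_derivative g x) (at 0))"
  using assms
proof induction
  case (const c)
  show ?case by (intro exI[of _ "\<lambda>x. 0"]) (auto intro: bump_algebra.const)
next
  case (coord j)
  have "((\<lambda>s. (x + s *\<^sub>R axis i 1) $ j) has_real_derivative axis i 1 $ j) (at 0)" for x :: "real^'n"
    by (auto intro!: derivative_eq_intros)
  then show ?case by (intro exI[of _ "\<lambda>x. axis i 1 $ j"]) (auto intro: bump_algebra.const)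
next
  case (flat p)
  let ?\<rho> = "\<lambda>x. 1 - (norm (x - \<xi>))\<^sup>2 / r\<^sup>2"
  let ?g = "\<lambda>x. flat_fun (flat_step p) (?\<rho> x) * (- 2 / r\<^sup>2 * (x $ i + - \<xi> $ i))"
  have "((\<lambda>s. flat_fun p (?\<rho> (x + s *\<^sub>R axis i 1))) has_real_derivative ?g x) (at 0)" for x
  proof -
    have e: "?\<rho> (x + s *\<^sub>R axis i 1) = 1 - ((norm (x - \<xi>))\<^sup>2 + 2 * s * (x $ i - \<xi> $ i) + s\<^sup>2) / r\<^sup>2" for s
      unfolding power2_norm_eq_inner
      by (simp add: inner_add_left inner_add_right inner_diff_left inner_diff_right inner_axis inner_axis'
          power2_eq_square algebra_simps)
    have "((\<lambda>s. ?\<rho> (x + s *\<^sub>R axis i 1)) has_real_derivative - 2 / r\<^sup>2 * (x $ i + - \<xi> $ i)) (at 0)"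
      unfolding e by (cases "r = 0") (auto intro!: derivative_eq_intros simp: field_simps)
    from DERIV_chain2[OF flat_fun_derivative this] show ?thesis by simp
  qed
  moreover have "bump_algebra \<xi> r ?g" by (intro bump_algebra.intros)
  ultimately show ?case by blast
next
  case (add f g)
  then obtain f' g' where "bump_algebra \<xi> r f'" "bump_algebra \<xi> r g'"
    "\<And>x. ((\<lambda>s. f (x + s *\<^sub>R axis i 1)) has_real_derivative f' x) (at 0)"
    "\<And>x. ((\<lambda>s. g (x + s *\<^sub>R axis i 1)) has_real_derivative g' x) (at 0)" by blast
  then show ?case
    by (intro exI[of _ "\<lambda>x. f' x + g' x"]) (auto intro!: bump_algebra.add DERIV_add)
next
  case (mult f g)
  then obtain f' g' where *: "bump_algebra \<xi> r f'" "bump_algebra \<xi> r g'"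
    "\<And>x. ((\<lambda>s. f (x + s *\<^sub>R axis i 1)) has_real_derivative f' x) (at 0)"
    "\<And>x. ((\<lambda>s. g (x + s *\<^sub>R axis i 1)) has_real_derivative g' x) (at 0)" by blast
  have "((\<lambda>s. f (x + s *\<^sub>R axis i 1) * g (x + s *\<^sub>R axis i 1)) has_real_derivative f' x * g x + g' x * f x) (at 0)" for x
    using DERIV_mult[OF *(3)[of x] *(4)[of x]] by simp
  then show ?case using *(1,2) mult.hyps
    by (intro exI[of _ "\<lambda>x. f' x * g x + g' x * f x"]) (auto intro!: bump_algebra.add bump_algebra.mult)
qed

lemma bump_algebra_continuous: "bump_algebra \<xi> r f \<Longrightarrow> continuous_on S f"
proof (induction rule: bump_algebra.induct)
  case (flat p)
  have "continuous_on UNIV (flat_fun p)"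
    by (rule continuous_at_imp_continuous_on) (auto intro: DERIV_isCont flat_fun_derivative)
  moreover have "continuous_on S (\<lambda>x. 1 - (norm (x - \<xi>))\<^sup>2 / r\<^sup>2)"
    by (cases "r = 0") (auto intro!: continuous_intros)
  ultimately show ?case using continuous_on_compose2 by blast
qed (auto intro!: continuous_intros)

lemma bump_algebra_C_k: "bump_algebra \<xi> r f \<Longrightarrow> C_k k f"
proof (induction k arbitrary: f)
  case (Suc k)
  have "(\<forall>x. has_partial i f x) \<and> C_k k (partial i f)" for i
  proof -
    obtain g where g: "bump_algebra \<xi> r g"
      "\<And>x. ((\<lambda>s. f (x + s *\<^sub>R axis i 1)) has_real_derivative g x) (at 0)"
      using bump_algebra_partial[OF Suc.prems] by blast
    have "partial i f = g" using partialI(1)[OF g(2)] by auto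
    then show ?thesis using partialI(2)[OF g(2)] Suc.IH[OF g(1)] by simp
  qed
  then show ?case using bump_algebra_continuous[OF Suc.prems] by simp
qed (simp add: bump_algebra_continuous)

definition bump :: "real^'n \<Rightarrow> real \<Rightarrow> real^'n \<Rightarrow> real"
  where "bump \<xi> r x = flat_fun 1 (1 - (norm (x - \<xi>))\<^sup>2 / r\<^sup>2)"

lemma bump_continuous: "continuous_on S (bump \<xi> r)"
  unfolding bump_def[abs_def] by (rule bump_algebra_continuous[OF bump_algebra.flat])

lemma bump_bounds: "0 \<le> bump \<xi> r x" "bump \<xi> r x \<le> 1"
  by (auto simp: bump_def flat_fun_def)

lemma bump_support:
  assumes "0 < r" "bump \<xi> r x \<noteq> 0"
  shows "x \<in> cball \<xi> r"
proof -
  have "(norm (x - \<xi>))\<^sup>2 / r\<^sup>2 < 1" using assms(2) by (simp add: bump_def flat_fun_def split: if_splits)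
  then have "(norm (x - \<xi>))\<^sup>2 < r\<^sup>2" using assms(1) by (simp add: divide_less_eq)
  then have "norm (x - \<xi>) < r" using assms(1) by (simp add: power_less_imp_less_base)
  then show ?thesis by (simp add: dist_norm norm_minus_commute)
qed

lemma bump_ge:
  assumes "0 < r" "norm (x - \<xi>) \<le> r / 2"
  shows "exp (- (4 / 3)) \<le> bump \<xi> r x"
proof -
  have "(norm (x - \<xi>))\<^sup>2 \<le> (r / 2)\<^sup>2" using assms by (intro power_mono) auto
  then have "(norm (x - \<xi>))\<^sup>2 / r\<^sup>2 \<le> 1 / 4" using assms(1) by (simp add: power_divide divide_le_eq)
  define y where "y = 1 - (norm (x - \<xi>))\<^sup>2 / r\<^sup>2"
  have y: "3 / 4 \<le> y" using \<open>_ \<le> 1 / 4\<close> by (simp add: y_def)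
  then have "inverse y \<le> inverse (3 / 4)" by (intro le_imp_inverse_le) auto
  then show ?thesis using y by (simp add: bump_def flat_fun_def flip: y_def)
qed

lemma bump_test_function:
  assumes r: "0 < r" and sub: "cball \<xi> r \<subseteq> \<Omega>"
  shows "bump \<xi> r \<in> test_functions \<Omega>"
proof -
  have cl: "closure {x. bump \<xi> r x \<noteq> 0} \<subseteq> cball \<xi> r"
    by (rule closure_minimal) (use bump_support[OF r] in auto)
  moreover have "compact (closure {x. bump \<xi> r x \<noteq> 0})"
    using cl bounded_subset[OF bounded_cball] by (simp add: compact_eq_bounded_closed)
  moreover have "C_k k (bump \<xi> r)" for k
    unfolding bump_def[abs_def] by (rule bump_algebra_C_k[OF bump_algebra.flat])
  ultimately show ?thesis using sub unfolding test_functions_def by auto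
qed

text \<open>The bump is bounded below on the ball of radius \<open>r / 2\<close>, hence on a cube inscribed in it, whose volume is
  explicit.\<close>
lemma integral_bump_ge:
  fixes H :: "real^'n \<Rightarrow> real"
  assumes r: "0 < r" and sub: "cball \<xi> r \<subseteq> \<Omega>" and H: "continuous_on (cball \<xi> r) H"
    and ge: "\<And>\<eta>. \<eta> \<in> cball \<xi> r \<Longrightarrow> c \<le> H \<eta>" and c: "0 \<le> c"
  shows "c * (exp (- (4 / 3)) * (r / sqrt (real CARD('n))) ^ CARD('n)) \<le> (LBINT \<eta>:\<Omega>. H \<eta> * bump \<xi> r \<eta>)"
proof -
  let ?n = "real CARD('n)"
  let ?C = "cube \<xi> (r / 2 / sqrt ?n)"
  have C: "norm (\<eta> - \<xi>) \<le> r / 2" if "\<eta> \<in> ?C" for \<eta> using that r by (intro cube_norm_le) auto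
  have eq: "indicator \<Omega> \<eta> *\<^sub>R (H \<eta> * bump \<xi> r \<eta>) = indicator (cball \<xi> r) \<eta> *\<^sub>R (H \<eta> * bump \<xi> r \<eta>)" for \<eta>
    using bump_support[OF r, of \<xi> \<eta>] sub by (auto split: split_indicator)
  have "integrable lborel (\<lambda>\<eta>. indicator (cball \<xi> r) \<eta> *\<^sub>R (H \<eta> * bump \<xi> r \<eta>))"
    by (intro borel_integrable_compact compact_cball continuous_on_mult H bump_continuous)
  moreover have "integrable lborel (\<lambda>\<eta>. indicator ?C \<eta> *\<^sub>R (c * exp (- (4 / 3))))"
    unfolding cube_def by (intro borel_integrable_compact compact_cbox continuous_intros)
  ultimately have "(LBINT \<eta>. indicator ?C \<eta> *\<^sub>R (c * exp (- (4 / 3))))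
      \<le> (LBINT \<eta>. indicator (cball \<xi> r) \<eta> *\<^sub>R (H \<eta> * bump \<xi> r \<eta>))"
  proof (intro integral_mono)
    fix \<eta>
    show "indicator ?C \<eta> *\<^sub>R (c * exp (- (4 / 3))) \<le> indicator (cball \<xi> r) \<eta> *\<^sub>R (H \<eta> * bump \<xi> r \<eta>)"
    proof (cases "\<eta> \<in> ?C")
      case True
      then have "\<eta> \<in> cball \<xi> r" using C[OF True] r by (simp add: dist_norm norm_minus_commute)
      moreover from this have "c * exp (- (4 / 3)) \<le> H \<eta> * bump \<xi> r \<eta>"
        using ge c bump_ge[OF r C[OF True]] by (intro mult_mono) (auto intro: order_trans)
      ultimately show ?thesis using True by simp
    next
      case False
      then show ?thesis using ge[of \<eta>] c bump_bounds(1)[of \<xi> r \<eta>]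
        by (auto split: split_indicator intro!: mult_nonneg_nonneg intro: order_trans)
    qed
  qed auto
  also have "(LBINT \<eta>. indicator ?C \<eta> *\<^sub>R (c * exp (- (4 / 3)))) = measure lborel ?C * (c * exp (- (4 / 3)))"
    unfolding cube_def by (simp add: lmeasure_integral_UNIV)
  also have "measure lborel ?C = (r / sqrt ?n) ^ CARD('n)"
    using r by (subst content_cube) auto
  finally show ?thesis unfolding set_lebesgue_integral_def eq by (simp add: mult_ac)
qed

section \<open>The Gaussian bound for the Dirichlet-Green function\<close>

text \<open>The constant of the barrier, multiplied by \<open>exp(1 / (4 \<kappa>))\<close> for the comparison at the initial time and
  divided by the lower bound from \<open>integral_bump_ge\<close> for the mass of a bump of width one.\<close>
definition green_constant :: "'n itself \<Rightarrow> real \<Rightarrow> real \<Rightarrow> real \<Rightarrow> real \<Rightarrow> real \<Rightarrow> real"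
  where "green_constant _ \<beta> M \<kappa> C\<^sub>0 m\<^sub>0 =
    exp (1 / (4 * \<kappa>)) * (1 + 2 * C\<^sub>0 / m\<^sub>0 * (gauss_mass TYPE('n) M / \<beta>))
      / (exp (- (4 / 3)) * (1 / sqrt (real CARD('n))) ^ CARD('n))"

context barrier_weight
begin

lemma q_le: "q z \<le> N\<^sub>2"
  using admissible_lower_order(2)[OF adm, of z] by linarith

lemma dirichlet_solution_nonneg:
  assumes \<Omega>: "bounded \<Omega>" "open \<Omega>" and u: "classical_dirichlet_solution a b q \<Omega> \<tau> f u"
    and f: "\<And>x. 0 \<le> f x" and x: "x \<in> \<Omega>" and t: "\<tau> < t"
  shows "0 \<le> u x t"
proof (rule parabolic_minimum_principle[where a=a and b=b and q=q, OF \<Omega> \<kappa> ell q_le _ _ _ _ _ x t order.refl])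
  show "continuous_on (closure \<Omega> \<times> {\<tau>..t}) (\<lambda>(x, t). u x t)"
    by (rule continuous_on_subset[of "closure \<Omega> \<times> {\<tau>..}"])
      (use u in \<open>auto simp: classical_dirichlet_solution_def\<close>)
qed (use u f in \<open>auto simp: classical_dirichlet_solution_def\<close>)

text \<open>The comparison with the barrier with pole \<open>(\<xi>, \<tau> - r\<^sup>2)\<close>: on the support of the bump, at time
  \<open>\<tau>\<close>, this barrier is at least of the order \<open>r\<^sup>-\<^sup>n\<close>. The term \<open>\<epsilon> exp((N\<^sub>2 + 1) (t - \<tau>))\<close> makes up for the
  error \<open>\<epsilon>\<close> of the barrier, since \<open>q - (N\<^sub>2 + 1) \<le> - 1\<close>.\<close>
lemma dirichlet_solution_bump_le:
  fixes \<Omega> :: "(real^'n) set"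
  assumes \<Omega>: "bounded \<Omega>" "open \<Omega>" and u: "classical_dirichlet_solution a b q \<Omega> \<tau> (bump \<xi> r) u"
    and r: "0 < r" and x: "x \<in> \<Omega>" and t: "\<tau> < t"
  shows "u x t \<le> r ^ CARD('n) * exp (1 / (4 * \<kappa>)) *
    ((1 + 2 * C\<^sub>0 / m\<^sub>0 * (gauss_mass TYPE('n) M / \<beta>)) * exp ((\<mu> + 1) * (t - \<tau> + r\<^sup>2))
      * gauss_kernel M (x - \<xi>) (t - \<tau> + r\<^sup>2))"
    (is "_ \<le> ?m * ?w")
proof -
  define E where "E = exp ((N\<^sub>2 + 1) * (t - \<tau>))"
  have m: "0 < ?m" using r by simp
  have le: "u x t \<le> ?m * ?w + ?m * E * \<epsilon>" if \<epsilon>: "0 < \<epsilon>" for \<epsilon>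
  proof -
    let ?\<tau>0 = "\<tau> - r\<^sup>2"
    have r2: "0 < r\<^sup>2" using r by simp
    have later: "?\<tau>0 < s" if "\<tau> \<le> s" for s using that r2 by linarith
    obtain w D DD Dt where w: "smooth_parabolic ?\<tau>0 w D DD Dt"
      "\<And>x t'. x \<in> \<Omega> \<Longrightarrow> \<tau> < t' \<Longrightarrow> t' \<le> t \<Longrightarrow> parabolic_op a b q w x t' \<le> \<epsilon>"
      "\<And>x t. ?\<tau>0 < t \<Longrightarrow> matrix_gauss (B (\<xi>, ?\<tau>0)) (x - \<xi>) (t - ?\<tau>0) \<le> w x t"
      "\<And>x t. ?\<tau>0 < t \<Longrightarrow> w x t \<le> (1 + 2 * C\<^sub>0 / m\<^sub>0 * (gauss_mass TYPE('n) M / \<beta>)) * exp ((\<mu> + 1) * (t - ?\<tau>0))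
        * gauss_kernel M (x - \<xi>) (t - ?\<tau>0)"
      using barrier_exists[OF \<Omega>(1) r2 \<epsilon> t, of \<xi>] by blast
    have w0: "0 \<le> w x t" if "?\<tau>0 < t" for x t
      using w(3)[OF that, of x] matrix_gauss_nonneg order_trans by blast
    define e :: "real^'n \<Rightarrow> real \<Rightarrow> real" where "e y s = exp ((N\<^sub>2 + 1) * (s - \<tau>))" for y s
    have se: "smooth_parabolic ?\<tau>0 e (\<lambda>i x t. 0) (\<lambda>i j x t. 0) (\<lambda>x t. (N\<^sub>2 + 1) * exp ((N\<^sub>2 + 1) * (t - \<tau>)))"
      unfolding e_def[abs_def] by (rule exp_smooth_parabolic)
    define W where "W y s = ?m * (w y s + \<epsilon> * e y s)" for y s
    note se' = smooth_parabolic_cmult[OF se, of \<epsilon>]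
    note sw = smooth_parabolic_add[OF w(1) se']
    note sW = smooth_parabolic_cmult[OF sw, of ?m, folded W_def]
    have LW: "parabolic_op a b q W y s \<le> 0" if y: "y \<in> \<Omega>" and s: "\<tau> < s" "s \<le> t" for y s
    proof -
      have s0: "?\<tau>0 < s" using s by (intro later) simp
      have "has_parabolic_derivatives ?\<tau>0 e (\<lambda>i x t. 0) (\<lambda>i j x t. 0) (\<lambda>x t. (N\<^sub>2 + 1) * exp ((N\<^sub>2 + 1) * (t - \<tau>)))"
        using se by (simp add: smooth_parabolic_def)
      from parabolic_op_eq[OF this s0, of a b q y]
      have "parabolic_op a b q e y s = (q (y, s) - (N\<^sub>2 + 1)) * exp ((N\<^sub>2 + 1) * (s - \<tau>))"
        by (simp add: e_def algebra_simps)
      also have "\<dots> \<le> (- 1) * exp ((N\<^sub>2 + 1) * (s - \<tau>))"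
        using q_le[of "(y, s)"] by (intro mult_right_mono) auto
      also have "\<dots> \<le> - 1" using s N\<^sub>2 by simp
      finally have "\<epsilon> * parabolic_op a b q e y s \<le> \<epsilon> * (- 1)" using \<epsilon> by (intro mult_left_mono) auto
      then have "parabolic_op a b q w y s + \<epsilon> * parabolic_op a b q e y s \<le> 0" using w(2)[OF y s] by linarith
      moreover have "parabolic_op a b q W y s = ?m * (parabolic_op a b q w y s + \<epsilon> * parabolic_op a b q e y s)"
        unfolding W_def[abs_def] parabolic_op_cmult[OF sw s0] parabolic_op_add[OF w(1) se' s0]
          parabolic_op_cmult[OF se s0] ..
      ultimately show ?thesis using m by (simp add: mult_nonneg_nonpos)
    qed
    have CW: "C_2_1_on (UNIV \<times> {?\<tau>0<..}) W" by (rule smooth_parabolic_C_2_1[OF sW])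
    have sub: "\<Omega> \<times> {\<tau><..} \<subseteq> UNIV \<times> {?\<tau>0<..}" by (auto intro!: later)
    have Cu: "C_2_1_on (\<Omega> \<times> {\<tau><..}) u" using u by (simp add: classical_dirichlet_solution_def)
    have op: "open (\<Omega> \<times> {\<tau><..})" using \<Omega>(2) by (intro open_Times) auto
    note diff = C_2_1_on_diff[OF op C_2_1_on_subset[OF CW sub] Cu]
    have "0 \<le> W x t - u x t"
    proof (rule parabolic_minimum_principle[where a=a and b=b and q=q, OF \<Omega> \<kappa> ell q_le _ diff(1) _ _ _ x t order.refl])
      have "continuous_on (closure \<Omega> \<times> {\<tau>..t}) (\<lambda>(x, t). W x t)"
        by (rule continuous_on_subset[of "UNIV \<times> {?\<tau>0<..}"])
           (use CW in \<open>auto simp: C_2_1_on_def intro!: later\<close>)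
      moreover have "continuous_on (closure \<Omega> \<times> {\<tau>..t}) (\<lambda>(x, t). u x t)"
        by (rule continuous_on_subset[of "closure \<Omega> \<times> {\<tau>..}"])
      (use u in \<open>auto simp: classical_dirichlet_solution_def\<close>)
      ultimately show "continuous_on (closure \<Omega> \<times> {\<tau>..t}) (\<lambda>(x, t). W x t - u x t)"
        unfolding case_prod_unfold by (rule continuous_on_diff)
      show "parabolic_op a b q (\<lambda>x t. W x t - u x t) y s \<le> 0" if "y \<in> \<Omega>" "\<tau> < s" "s \<le> t" for y s
        using LW[OF that] diff(2)[of y s a b q] that u by (simp add: classical_dirichlet_solution_def)
      have W0: "0 \<le> W y s" if "\<tau> \<le> s" for y s
        using w0[OF later[OF that], of y] m \<epsilon> by (simp add: W_def e_def)
      show "0 \<le> W y s - u y s" if "y \<in> frontier \<Omega>" "\<tau> < s" "s \<le> t" for y s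
        using W0[of s y] that u by (simp add: classical_dirichlet_solution_def)
      show "0 \<le> W y \<tau> - u y \<tau>" if y: "y \<in> \<Omega>" for y
      proof -
        have "bump \<xi> r y \<le> W y \<tau>"
        proof (cases "bump \<xi> r y = 0")
          case False
          from bump_support[OF r this] have "norm (y - \<xi>) \<le> r" by (simp add: dist_norm norm_minus_commute)
          then have v: "(norm (y - \<xi>))\<^sup>2 \<le> r\<^sup>2" by (intro power_mono) auto
          have e: "r\<^sup>2 powr (- (real CARD('n) / 2)) = inverse (r ^ CARD('n))"
          proof -
            have "r\<^sup>2 powr (real CARD('n) / 2) = (r powr 2) powr (real CARD('n) / 2)" using r by simp
            also have "\<dots> = r powr real CARD('n)" by (simp only: powr_powr) simp
            also have "\<dots> = r ^ CARD('n)" using r by (rule powr_realpow)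
            finally show ?thesis by (simp only: powr_minus)
          qed
          then have "1 = ?m * (r\<^sup>2 powr (- (real CARD('n) / 2)) * exp (- (1 / (4 * \<kappa>))))"
            unfolding e using r by (simp add: exp_minus field_simps)
          also have "\<dots> \<le> ?m * matrix_gauss (B (\<xi>, ?\<tau>0)) (y - \<xi>) (r\<^sup>2)"
            using m by (intro mult_left_mono matrix_gauss_ge r2 v order.refl) auto
          also have "\<dots> \<le> ?m * w y \<tau>" using m w(3)[OF later[OF order.refl], of y] by (intro mult_left_mono) auto
          also have "\<dots> \<le> W y \<tau>" unfolding W_def using m \<epsilon> by (intro mult_left_mono) (auto simp: e_def)
          finally show ?thesis using bump_bounds(2)[of \<xi> r y] by linarith
        qed (simp add: W0)
        then show ?thesis using y u by (simp add: classical_dirichlet_solution_def)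
      qed
    qed
    also have "W x t \<le> ?m * (?w + \<epsilon> * E)"
    proof -
      have "w x t \<le> ?w" using w(4)[OF later[OF less_imp_le[OF t]], of x] by (simp add: algebra_simps)
      then show ?thesis unfolding W_def e_def E_def using m by (intro mult_left_mono) auto
    qed
    finally show ?thesis by (simp add: algebra_simps)
  qed
  show ?thesis
  proof (rule field_le_epsilon)
    fix \<epsilon> :: real assume \<epsilon>: "0 < \<epsilon>"
    have mE: "0 < ?m * E" using m by (simp add: E_def)
    have eq: "?m * E * (\<epsilon> / (?m * E)) = \<epsilon>"
      using mE by (metis less_irrefl nonzero_mult_div_cancel_left times_divide_eq_right)
    show "u x t \<le> ?m * ?w + \<epsilon>" using le[OF divide_pos_pos[OF \<epsilon> mE]] unfolding eq .
  qed
qed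

text \<open>Testing the Green function against bumps that shrink to \<open>\<xi>\<close> turns the bounds for the solutions
  into pointwise ones, as the mass of a bump of width \<open>r\<close> is of the order \<open>r\<^sup>n\<close> too.\<close>
lemma green_function_bounds:
  fixes \<Omega> :: "(real^'n) set"
  assumes \<Omega>: "bounded \<Omega>" "open \<Omega>" and G: "dirichlet_green_function a b q \<Omega> G"
    and x: "x \<in> \<Omega>" and \<xi>: "\<xi> \<in> \<Omega>" and t: "\<tau> < t"
  shows "0 \<le> G x t \<xi> \<tau>"
    and "G x t \<xi> \<tau> \<le> green_constant TYPE('n) \<beta> M \<kappa> C\<^sub>0 m\<^sub>0 * exp ((\<mu> + 1) * (t - \<tau>)) * gauss_kernel M (x - \<xi>) (t - \<tau>)"
proof -
  define g where "g \<eta> = G x t \<eta> \<tau>" for \<eta>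
  have g: "continuous_on \<Omega> g"
  proof -
    have "continuous_on {(x, t, \<xi>, \<tau>). x \<in> \<Omega> \<and> \<xi> \<in> \<Omega> \<and> \<tau> < t} (\<lambda>(x, t, \<xi>, \<tau>). G x t \<xi> \<tau>)"
      using G by (simp add: dirichlet_green_function_def)
    moreover have "continuous_on \<Omega> (\<lambda>\<eta>. (x, t, \<eta>, \<tau>))" by (intro continuous_intros)
    moreover have "(\<lambda>\<eta>. (x, t, \<eta>, \<tau>)) ` \<Omega> \<subseteq> {(x, t, \<xi>, \<tau>). x \<in> \<Omega> \<and> \<xi> \<in> \<Omega> \<and> \<tau> < t}" using x t by auto
    ultimately show ?thesis unfolding g_def using continuous_on_compose2 by fastforce
  qed
  obtain R where R: "0 < R" "cball \<xi> R \<subseteq> \<Omega>" using \<Omega>(2) \<xi> open_contains_cball by blast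
  have sol: "\<exists>u. classical_dirichlet_solution a b q \<Omega> \<tau> (bump \<xi> r) u \<and> u x t = (LBINT \<eta>:\<Omega>. g \<eta> * bump \<xi> r \<eta>)"
    if "0 < r" "r \<le> R" for r
  proof -
    have "cball \<xi> r \<subseteq> \<Omega>" using that R by auto
    then have "bump \<xi> r \<in> test_functions \<Omega>" by (intro bump_test_function that)
    then show ?thesis using G x t unfolding dirichlet_green_function_def g_def by blast
  qed
  have near: "\<exists>d>0. d \<le> R \<and> (\<forall>r. 0 < r \<longrightarrow> r \<le> d \<longrightarrow> (\<forall>\<eta>\<in>cball \<xi> r. \<bar>g \<eta> - g \<xi>\<bar>< e))" if e: "0 < e" for e
  proof -
    obtain d where d: "0 < d" "\<And>\<eta>. \<eta> \<in> \<Omega> \<Longrightarrow> dist \<eta> \<xi> < d \<Longrightarrow> dist (g \<eta>) (g \<xi>) < e"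
      using g \<xi> e unfolding continuous_on_iff by blast
    show ?thesis
    proof (intro exI[of _ "min R (d / 2)"] conjI allI impI ballI)
      fix r \<eta> assume "0 < r" "r \<le> min R (d / 2)" "\<eta> \<in> cball \<xi> r"
      then have "\<eta> \<in> cball \<xi> R" "dist \<eta> \<xi> < d" using d(1) by (auto simp: dist_commute)
      then show "\<bar>g \<eta> - g \<xi>\<bar> < e" using d(2)[of \<eta>] R(2) by (auto simp: dist_real_def)
    qed (use d R in auto)
  qed
  let ?n = "real CARD('n)"
  have mass: "0 < exp (- (4 / 3)) * (r / sqrt ?n) ^ CARD('n)" if "0 < r" for r :: real
    using that by simp
  have cont: "continuous_on (cball \<xi> r) g" if "r \<le> R" for r
    by (rule continuous_on_subset[OF g order_trans[OF subset_cball[OF that] R(2)]])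
  show "0 \<le> G x t \<xi> \<tau>"
  proof (rule ccontr)
    assume "\<not> 0 \<le> G x t \<xi> \<tau>"
    then have neg: "g \<xi> < 0" by (simp add: g_def)
    then obtain r where r: "0 < r" "r \<le> R" "\<And>\<eta>. \<eta> \<in> cball \<xi> r \<Longrightarrow> \<bar>g \<eta> - g \<xi>\<bar> < - g \<xi> / 2"
      using near[of "- g \<xi> / 2"] by fastforce
    obtain u where u: "classical_dirichlet_solution a b q \<Omega> \<tau> (bump \<xi> r) u"
      "u x t = (LBINT \<eta>:\<Omega>. g \<eta> * bump \<xi> r \<eta>)" using sol[OF r(1,2)] by blast
    have "(- g \<xi> / 2) * (exp (- (4 / 3)) * (r / sqrt ?n) ^ CARD('n)) \<le> (LBINT \<eta>:\<Omega>. - g \<eta> * bump \<xi> r \<eta>)"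
    proof (rule integral_bump_ge[OF r(1)])
      show "cball \<xi> r \<subseteq> \<Omega>" using R r(2) by auto
      show "continuous_on (cball \<xi> r) (\<lambda>\<eta>. - g \<eta>)" by (intro continuous_intros cont r)
      show "- g \<xi> / 2 \<le> - g \<eta>" if "\<eta> \<in> cball \<xi> r" for \<eta> using r(3)[OF that] neg by (auto simp: abs_less_iff)
    qed (use neg in simp)
    also have "\<dots> = - u x t" by (simp add: u(2) set_lebesgue_integral_def)
    finally have "u x t < 0" using mult_pos_pos[OF _ mass[OF r(1)], of "- g \<xi> / 2"] neg by simp
    then show False using dirichlet_solution_nonneg[OF \<Omega> u(1) bump_bounds(1) x t] by simp
  qed
  define Cw where "Cw = 1 + 2 * C\<^sub>0 / m\<^sub>0 * (gauss_mass TYPE('n) M / \<beta>)"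
  define F where "F \<delta> = green_constant TYPE('n) \<beta> M \<kappa> C\<^sub>0 m\<^sub>0 * exp ((\<mu> + 1) * (t - \<tau> + \<delta>)) * gauss_kernel M (x - \<xi>) (t - \<tau> + \<delta>)" for \<delta>
  have "g \<xi> \<le> F 0"
  proof (rule ccontr)
    assume "\<not> g \<xi> \<le> F 0"
    define c where "c = (g \<xi> + F 0) / 2"
    have c: "F 0 < c" "c < g \<xi>" using \<open>\<not> g \<xi> \<le> F 0\<close> by (auto simp: c_def)
    have F0: "0 \<le> F 0" unfolding F_def green_constant_def
      using C\<^sub>0_pos m\<^sub>0_pos \<alpha> by (simp add: gauss_kernel_nonneg)
    obtain d where d: "0 < d" "d \<le> R" "\<And>r \<eta>. 0 < r \<Longrightarrow> r \<le> d \<Longrightarrow> \<eta> \<in> cball \<xi> r \<Longrightarrow> \<bar>g \<eta> - g \<xi>\<bar> < g \<xi> - c"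
      using near[of "g \<xi> - c"] c by fastforce
    have "((\<lambda>r. F (r\<^sup>2)) \<longlongrightarrow> F (0\<^sup>2)) (at_right 0)"
      unfolding F_def gauss_kernel_def using t M by (intro tendsto_intros) auto
    then have "eventually (\<lambda>r. F (r\<^sup>2) < c) (at_right 0)"
      using c(1) by (simp add: order_tendsto_iff)
    moreover have "eventually (\<lambda>r. r < d) (at_right (0 :: real))"
      using d(1) by (auto simp: eventually_at_right_field)
    moreover have "eventually (\<lambda>r. 0 < r) (at_right (0 :: real))"
      by (rule eventually_at_right_less)
    ultimately have "eventually (\<lambda>r. F (r\<^sup>2) < c \<and> r < d \<and> 0 < r) (at_right 0)"
      by eventually_elim auto
    then obtain r where r: "F (r\<^sup>2) < c" "r < d" "0 < r"
      using eventually_happens'[OF trivial_limit_at_right_real] by blast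
    have rR: "r \<le> R" using r d by simp
    obtain u where u: "classical_dirichlet_solution a b q \<Omega> \<tau> (bump \<xi> r) u"
      "u x t = (LBINT \<eta>:\<Omega>. g \<eta> * bump \<xi> r \<eta>)" using sol[OF r(3) rR] by blast
    let ?E = "exp ((\<mu> + 1) * (t - \<tau> + r\<^sup>2)) * gauss_kernel M (x - \<xi>) (t - \<tau> + r\<^sup>2)"
    have "c * (exp (- (4 / 3)) * (r / sqrt ?n) ^ CARD('n)) \<le> u x t"
      unfolding u(2)
    proof (rule integral_bump_ge[OF r(3)])
      show "cball \<xi> r \<subseteq> \<Omega>" using R rR by auto
      show "continuous_on (cball \<xi> r) g" by (intro cont rR)
      show "c \<le> g \<eta>" if "\<eta> \<in> cball \<xi> r" for \<eta>
        using d(3)[OF r(3) _ that] r(2) by (auto simp: abs_less_iff)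
    qed (use F0 c in simp)
    also have "\<dots> \<le> r ^ CARD('n) * exp (1 / (4 * \<kappa>)) * (Cw * exp ((\<mu> + 1) * (t - \<tau> + r\<^sup>2))
        * gauss_kernel M (x - \<xi>) (t - \<tau> + r\<^sup>2))"
      unfolding Cw_def by (rule dirichlet_solution_bump_le[OF \<Omega> u(1) r(3) x t])
    also have "\<dots> = F (r\<^sup>2) * (exp (- (4 / 3)) * (r / sqrt ?n) ^ CARD('n))"
      unfolding F_def green_constant_def Cw_def[symmetric] by (simp add: power_divide)
    finally have "c \<le> F (r\<^sup>2)" using mass[OF r(3)] by (rule mult_right_le_imp_le)
    then show False using r(1) by simp
  qed
  then show "G x t \<xi> \<tau> \<le> green_constant TYPE('n) \<beta> M \<kappa> C\<^sub>0 m\<^sub>0 * exp ((\<mu> + 1) * (t - \<tau>)) * gauss_kernel M (x - \<xi>) (t - \<tau>)"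
    by (simp add: F_def g_def)
qed

end

theorem corollary1p1:
  fixes \<alpha> N\<^sub>1 N\<^sub>2 M \<kappa> :: real
  assumes "0 < \<alpha>" and "\<alpha> \<le> 1" and "0 < N\<^sub>1" and "0 < N\<^sub>2" and "0 < M" and "0 < \<kappa>"
  shows "\<exists>C\<^sub>2 > 0. \<exists>C\<^sub>3 \<ge> 0.
    \<forall>(a :: (real^'n) \<times> real \<Rightarrow> real^'n^'n) (b :: (real^'n) \<times> real \<Rightarrow> real^'n)
      (q :: (real^'n) \<times> real \<Rightarrow> real).
      admissible_coefficients \<alpha> N\<^sub>1 N\<^sub>2 M \<kappa> a b q \<longrightarrow>
        (\<forall>x t \<xi> \<tau>. \<tau> < t \<longrightarrow>
          fundamental_solution a b q x t \<xi> \<tau> \<le>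
            C\<^sub>2 * exp (C\<^sub>3 * (t - \<tau>)) * (t - \<tau>) powr (- (real CARD('n) / 2)) *
            exp (- (1 / (8 * M)) * (norm (x - \<xi>))\<^sup>2 / (t - \<tau>))) \<and>
        (\<forall>\<Omega> G. bounded_C11_domain \<Omega> \<longrightarrow> dirichlet_green_function a b q \<Omega> G \<longrightarrow>
          (\<forall>x \<in> \<Omega>. \<forall>\<xi> \<in> \<Omega>. \<forall>t \<tau>. \<tau> < t \<longrightarrow>
            0 \<le> G x t \<xi> \<tau> \<and>
            G x t \<xi> \<tau> \<le>
              C\<^sub>2 * exp (C\<^sub>3 * (t - \<tau>)) * (t - \<tau>) powr (- (real CARD('n) / 2)) *
              exp (- (1 / (8 * M)) * (norm (x - \<xi>))\<^sup>2 / (t - \<tau>))))"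
proof -
  define C\<^sub>0 where "C\<^sub>0 = defect_constant TYPE('n) N\<^sub>1 N\<^sub>2 M \<kappa>"
  define C\<^sub>1 where "C\<^sub>1 = parametrix_constant TYPE('n) \<kappa> * C\<^sub>0"
  define m\<^sub>0 where "m\<^sub>0 = mass_constant TYPE('n) \<kappa>"
  have \<beta>: "0 < \<alpha> / 2" using assms by simp
  have m0: "0 < m\<^sub>0 / 2" using mass_constant_pos by (simp add: m\<^sub>0_def)
  obtain \<mu> where \<mu>: "admissible_weight TYPE('n) M (\<alpha> / 2) C\<^sub>1 (1 / 2) \<mu>"
    using admissible_weight_exists[OF \<beta>, of "1 / 2"] by auto
  obtain \<nu> where \<nu>: "admissible_weight TYPE('n) M (\<alpha> / 2) C\<^sub>0 (m\<^sub>0 / 2) \<nu>"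
    using admissible_weight_exists[OF \<beta> m0] by blast
  define A\<^sub>1 where "A\<^sub>1 = parametrix_constant TYPE('n) \<kappa> * (1 + 2 * C\<^sub>1 * (gauss_mass TYPE('n) M / (\<alpha> / 2)))"
  define A\<^sub>2 where "A\<^sub>2 = green_constant TYPE('n) (\<alpha> / 2) M \<kappa> C\<^sub>0 m\<^sub>0"
  define C\<^sub>2 where "C\<^sub>2 = max 1 (max A\<^sub>1 A\<^sub>2)"
  define C\<^sub>3 where "C\<^sub>3 = max \<mu> \<nu> + 1"
  have "1 < \<mu>" using \<mu> by (simp add: admissible_weight_def)
  then have C3: "0 \<le> C\<^sub>3" by (simp add: C\<^sub>3_def max_def)
  have le: "A\<^sub>1 \<le> C\<^sub>2" "A\<^sub>2 \<le> C\<^sub>2" "\<mu> + 1 \<le> C\<^sub>3" "\<nu> + 1 \<le> C\<^sub>3"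
    by (auto simp: C\<^sub>2_def C\<^sub>3_def)
  have common: "A * exp ((\<mu>' + 1) * (t - \<tau>)) * gauss_kernel M (x - \<xi>) (t - \<tau>)
      \<le> C\<^sub>2 * exp (C\<^sub>3 * (t - \<tau>)) * (t - \<tau>) powr (- (real CARD('n) / 2)) *
        exp (- (1 / (8 * M)) * (norm (x - \<xi>))\<^sup>2 / (t - \<tau>))"
    if "A \<le> C\<^sub>2" "\<mu>' + 1 \<le> C\<^sub>3" "\<tau> < t" for A \<mu>' t \<tau> and x \<xi> :: "real^'n"
  proof -
    have "A * exp ((\<mu>' + 1) * (t - \<tau>)) * gauss_kernel M (x - \<xi>) (t - \<tau>)
        \<le> C\<^sub>2 * exp (C\<^sub>3 * (t - \<tau>)) * gauss_kernel M (x - \<xi>) (t - \<tau>)"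
      using that by (intro mult_right_mono mult_mono gauss_kernel_nonneg) (auto simp: C\<^sub>2_def)
    then show ?thesis by (simp add: gauss_kernel_def mult.assoc)
  qed
  show ?thesis
  proof (rule exI[of _ C\<^sub>2], rule conjI, simp add: C\<^sub>2_def, rule exI[of _ C\<^sub>3],
      intro conjI allI impI ballI C3)
    fix a :: "(real^'n) \<times> real \<Rightarrow> real^'n^'n" and b :: "(real^'n) \<times> real \<Rightarrow> real^'n"
      and q :: "(real^'n) \<times> real \<Rightarrow> real"
    assume adm: "admissible_coefficients \<alpha> N\<^sub>1 N\<^sub>2 M \<kappa> a b q"
    interpret E: parametrix_iteration \<alpha> N\<^sub>1 N\<^sub>2 M \<kappa> C\<^sub>0 a b q C\<^sub>1 \<mu>
      by unfold_locales (use assms adm \<mu> in \<open>auto simp: C\<^sub>0_def C\<^sub>1_def\<close>)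
    interpret G: barrier_weight \<alpha> N\<^sub>1 N\<^sub>2 M \<kappa> C\<^sub>0 a b q m\<^sub>0 \<nu>
      by unfold_locales (use \<nu> in \<open>auto simp: m\<^sub>0_def\<close>)
    show "fundamental_solution a b q x t \<xi> \<tau> \<le> C\<^sub>2 * exp (C\<^sub>3 * (t - \<tau>)) *
        (t - \<tau>) powr (- (real CARD('n) / 2)) * exp (- (1 / (8 * M)) * (norm (x - \<xi>))\<^sup>2 / (t - \<tau>))"
      if "\<tau> < t" for x t \<xi> \<tau>
    proof -
      have "fundamental_solution a b q x t \<xi> \<tau> \<le> A\<^sub>1 * exp ((\<mu> + 1) * (t - \<tau>)) * gauss_kernel M (x - \<xi>) (t - \<tau>)"
        unfolding A\<^sub>1_def by (rule E.fundamental_solution_le[OF that])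
      also note common[OF le(1) le(3) that, of x \<xi>]
      finally show ?thesis .
    qed
    fix \<Omega> G x \<xi> and t \<tau> :: real
    assume \<Omega>: "bounded_C11_domain \<Omega>" and G: "dirichlet_green_function a b q \<Omega> G"
      and x: "x \<in> \<Omega>" "\<xi> \<in> \<Omega>" and t: "\<tau> < t"
    have \<Omega>': "bounded \<Omega>" "open \<Omega>" using \<Omega> by (auto simp: bounded_C11_domain_def)
    show "0 \<le> G x t \<xi> \<tau>" by (rule G.green_function_bounds(1)[OF \<Omega>' G x t])
    show "G x t \<xi> \<tau> \<le> C\<^sub>2 * exp (C\<^sub>3 * (t - \<tau>)) *
        (t - \<tau>) powr (- (real CARD('n) / 2)) * exp (- (1 / (8 * M)) * (norm (x - \<xi>))\<^sup>2 / (t - \<tau>))"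
    proof -
      have "G x t \<xi> \<tau> \<le> A\<^sub>2 * exp ((\<nu> + 1) * (t - \<tau>)) * gauss_kernel M (x - \<xi>) (t - \<tau>)"
        unfolding A\<^sub>2_def by (rule G.green_function_bounds(2)[OF \<Omega>' G x t])
      also note common[OF le(2) le(4) t, of x \<xi>]
      finally show ?thesis .
    qed
  qed
qed

end
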